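(* Let $x^*$ be a KKT point of the NSDP satisfying Assumption 1 (both described in the context), and let $w_a=(x^*,Y_a,z_a)$, where $(Y_a,z_a)$ is the analytic center at $x^*$. Then, for a sufficiently small $\bar\mu>0$, there exists a unique path $w:(0,\bar\mu)\to\mathcal W_{++}$ such that 1. $w$ is smooth (continuously differentiable) and, for each $\mu\in(0,\bar\mu)$, $w(\mu)$ is a BKKT triplet of the NSDP with barrier parameter $\mu$; and 2. $\lim_{\mu\to 0}w(\mu)=w_a$.
   Context: Notation. $\mathbb S^m$, $\mathbb S^m_+$, $\mathbb S^m_{++}$ denote the real symmetric, symmetric positive semidefinite, symmetric positive definite $m\times m$ matrices; $X\bullet Y=\mathrm{trace}(XY)$. $f:\mathbb R^n\to\mathbb R$, $G:\mathbb R^n\to\mathbb S^m$, $h:\mathbb R^n\to\mathbb R^s$ are twice continuously differentiable. The NSDP is: minimize $f(x)$ subject to $G(x)\in\mathbb S^m_+$, $h(x)=0$. $\mathcal G_i(x)=\partial G(x)/\partial x_i$, $\Delta G(x;d)=\sum_{i=1}^n d_i\mathcal G_i(x)$, $\mathcal JG(x)^*Y=[\mathcal G_1(x)\bullet Y,\dots,\mathcal G_n(x)\bullet Y]^\top$, and $\nabla h(x)\in\mathbb R^{n\times s}$ has columns $\nabla h_i(x)$. $\mathcal W=\mathbb R^n\times\mathbb S^m\times\mathbb R^s$, $\mathcal W_{++}=\{(x,Y,z)\in\mathcal W: G(x)\in\mathbb S^m_{++},\,Y\in\mathbb S^m_{++}\}$. For $w=(x,Y,z)\in\mathcal W$, $L(w)=f(x)-G(x)\bullet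 Y+h(x)^\top z$, so $\nabla_xL(w)=\nabla f(x)-\mathcal JG(x)^*Y+\nabla h(x)z$. KKT. $x$ is a KKT point if there is $(Y,z)\in\mathbb S^m\times\mathbb R^s$ with $\nabla_xL(x,Y,z)=0$, $G(x)\bullet Y=0$, $G(x)\in\mathbb S^m_+$, $Y\in\mathbb S^m_+$, $h(x)=0$; $\Lambda(x)$ is the set of all such $(Y,z)$. BKKT. For $\mu>0$, $(x,Y,z)$ is a BKKT triplet with barrier parameter $\mu$ (and $x$ a BKKT point) if $\nabla_xL(x,Y,z)=0$, $h(x)=0$, $G(x)Y=\mu I$, $G(x)\in\mathbb S^m_{++}$, $Y\in\mathbb S^m_{++}$. A central path is a path formed by BKKT triplets. Assumption 1 on the KKT point $x^*$: (1) there is $(Y,z)\in\Lambda(x^* )$ with $G(x^* )+Y\in\mathbb S^m_{++}$ (strict complementarity); (2) (enhanced second-order sufficient condition) for all $(Y,z)\in\Lambda(x^* )$ and all $d\in C(x^* )\setminus\{0\}$, $d^\top(\nabla^2_{xx}L(x^*,Y,z)+\Omega(x^*,Y))d>0$, where $\Omega(x,Y)_{ij}=2\,Y\bullet(\mathcal G_i(x)G(x)^\dagger\mathcal G_j(x))$ ($\dagger$ = Moore–Penrose inverse), $C(x^* )=\{d:\nabla f(x^* )^\top d=0,\ \nabla h(x^* )^\top d=0,\ \Delta G(x^*;d)\in T_{\mathbb S^m_+}(G(x^* ))\}$ and $T_{\mathbb S^m_+}(G(x^* ))$ is the tangent cone of $\mathbb S^m_+$ at $G(x^* )$; (3) (MFCQ)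 $\nabla h(x^* )$ has full column rank and there is $d\in\mathbb R^n$ with $G(x^* )+\Delta G(x^*;d)\in\mathbb S^m_{++}$, $\nabla h(x^* )^\top d=0$. Analytic center. Let $r_*=\mathrm{rank}\,G(x^* )$ and let $E_*\in\mathbb R^{m\times(m-r_* )}$ have columns forming an orthonormal basis of $\mathrm{Ker}\,G(x^* )$; for $Y\in\mathbb S^m$ put $Y^{EE}=E_*^\top YE_*$. The analytic center $(Y_a,z_a)$ at $x^*$ is the (unique, under Assumption 1) optimum of: minimize $-\log\det Y^{EE}$ subject to $(Y,z)\in\Lambda(x^* )$, with $\log 0:=-\infty$. *)

theory Defs
  imports
    "Jordan_Normal_Form.Determinant"
    "HOL-Analysis.Analysis"
    "HOL-Library.FuncSet"
begin

no_notation Matrix.vec_index (infixl \<open>$\<close> 100)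
no_notation Matrix.scalar_prod (infix \<open>\<bullet>\<close> 70)
hide_const (open) Matrix.mat Matrix.vec Determinant.det Matrix.row Matrix.rows

section \<open>Differential calculus\<close>

definition twice_cont_diff :: "('a::real_normed_vector \<Rightarrow> 'b::real_normed_vector) \<Rightarrow> bool" where
  "twice_cont_diff f \<longleftrightarrow>
    (\<exists>(f' :: 'a \<Rightarrow> 'a \<Rightarrow>\<^sub>L 'b) (f'' :: 'a \<Rightarrow> 'a \<Rightarrow>\<^sub>L ('a \<Rightarrow>\<^sub>L 'b)).
      (\<forall>x. (f has_derivative blinfun_apply (f' x)) (at x)) \<and>
      (\<forall>x. (f' has_derivative blinfun_apply (f'' x)) (at x)) \<and>
      continuous_on UNIV f'')"

definition partial_deriv :: "'n \<Rightarrow> (real^'n \<Rightarrow> 'b::real_normed_vector) \<Rightarrow> real^'n \<Rightarrow> 'b" where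
  "partial_deriv i f x = frechet_derivative f (at x) (axis i 1)"

definition grad :: "(real^'n \<Rightarrow> real) \<Rightarrow> real^'n \<Rightarrow> real^'n" where
  "grad f x = (\<chi> i. partial_deriv i f x)"

definition hessian :: "(real^'n \<Rightarrow> real) \<Rightarrow> real^'n \<Rightarrow> real^'n^'n" where
  "hessian f x = jacobian (grad f) (at x)"

text \<open>The columns of \<open>nabla h x\<close> are the gradients of the components of \<open>h\<close>.\<close>

definition nabla :: "(real^'n \<Rightarrow> real^'s) \<Rightarrow> real^'n \<Rightarrow> real^'s^'n" where
  "nabla h x = transpose (jacobian h (at x))"


section \<open>Symmetric matrices\<close>

definition sym_mats :: "(real^'m^'m) set" where
  "sym_mats = {A. transpose A = A}"

definition psd_mats :: "(real^'m^'m) set" where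
  "psd_mats = {A \<in> sym_mats. \<forall>v. 0 \<le> inner v (A *v v)}"

definition pd_mats :: "(real^'m^'m) set" where
  "pd_mats = {A \<in> sym_mats. \<forall>v. v \<noteq> 0 \<longrightarrow> 0 < inner v (A *v v)}"

definition trace_inner :: "real^'m^'m \<Rightarrow> real^'m^'m \<Rightarrow> real" where
  "trace_inner X Y = trace (X ** Y)"

definition is_moore_penrose :: "real^'n^'m \<Rightarrow> real^'m^'n \<Rightarrow> bool" where
  "is_moore_penrose A B \<longleftrightarrow>
    A ** B ** A = A \<and> B ** A ** B = B \<and>
    transpose (A ** B) = A ** B \<and> transpose (B ** A) = B ** A"

definition pinv :: "real^'n^'m \<Rightarrow> real^'m^'n" where
  "pinv A = (THE B. is_moore_penrose A B)"

definition tangent_cone :: "'a::real_normed_vector set \<Rightarrow> 'a \<Rightarrow> 'a set" where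
  "tangent_cone S a =
    {d. \<exists>(t :: nat \<Rightarrow> real) (u :: nat \<Rightarrow> 'a).
      (\<forall>k. 0 < t k) \<and> t \<longlonglongrightarrow> 0 \<and> u \<longlonglongrightarrow> d \<and> (\<forall>k. a + t k *\<^sub>R u k \<in> S)}"


section \<open>The nonlinear semidefinite program\<close>

text \<open>Throughout, the program is: minimize \<open>f x\<close> subject to \<open>G x \<in> psd_mats\<close> and \<open>h x = 0\<close>.\<close>

definition Delta_G :: "(real^'n \<Rightarrow> real^'m^'m) \<Rightarrow> real^'n \<Rightarrow> real^'n \<Rightarrow> real^'m^'m" where
  "Delta_G G x d = (\<Sum>i\<in>UNIV. (d $ i) *\<^sub>R partial_deriv i G x)"

definition W_pp ::
  "(real^'n \<Rightarrow> real^'m^'m) \<Rightarrow> ((real^'n) \<times> (real^'m^'m) \<times> (real^'s)) set" where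
  "W_pp G = {(x, Y, z). G x \<in> pd_mats \<and> Y \<in> pd_mats}"

definition lagrangian ::
  "(real^'n \<Rightarrow> real) \<Rightarrow> (real^'n \<Rightarrow> real^'m^'m) \<Rightarrow> (real^'n \<Rightarrow> real^'s) \<Rightarrow>
   real^'n \<Rightarrow> real^'m^'m \<Rightarrow> real^'s \<Rightarrow> real" where
  "lagrangian f G h x Y z = f x - trace_inner (G x) Y + inner (h x) z"

definition multipliers ::
  "(real^'n \<Rightarrow> real) \<Rightarrow> (real^'n \<Rightarrow> real^'m^'m) \<Rightarrow> (real^'n \<Rightarrow> real^'s) \<Rightarrow>
   real^'n \<Rightarrow> ((real^'m^'m) \<times> (real^'s)) set" where
  "multipliers f G h x =
    {(Y, z). Y \<in> sym_mats \<and> grad (\<lambda>x. lagrangian f G h x Y z) x = 0 \<and>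
      trace_inner (G x) Y = 0 \<and> G x \<in> psd_mats \<and> Y \<in> psd_mats \<and> h x = 0}"

definition KKT_point ::
  "(real^'n \<Rightarrow> real) \<Rightarrow> (real^'n \<Rightarrow> real^'m^'m) \<Rightarrow> (real^'n \<Rightarrow> real^'s) \<Rightarrow>
   real^'n \<Rightarrow> bool" where
  "KKT_point f G h x \<longleftrightarrow> multipliers f G h x \<noteq> {}"

definition BKKT_triplet ::
  "(real^'n \<Rightarrow> real) \<Rightarrow> (real^'n \<Rightarrow> real^'m^'m) \<Rightarrow> (real^'n \<Rightarrow> real^'s) \<Rightarrow>
   real \<Rightarrow> (real^'n) \<times> (real^'m^'m) \<times> (real^'s) \<Rightarrow> bool" where
  "BKKT_triplet f G h \<mu> = (\<lambda>(x, Y, z).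
    0 < \<mu> \<and> grad (\<lambda>x. lagrangian f G h x Y z) x = 0 \<and> h x = 0 \<and>
    G x ** Y = \<mu> *\<^sub>R mat 1 \<and> G x \<in> pd_mats \<and> Y \<in> pd_mats)"


section \<open>Regularity assumptions\<close>

definition strict_complementarity ::
  "(real^'n \<Rightarrow> real) \<Rightarrow> (real^'n \<Rightarrow> real^'m^'m) \<Rightarrow> (real^'n \<Rightarrow> real^'s) \<Rightarrow>
   real^'n \<Rightarrow> bool" where
  "strict_complementarity f G h x \<longleftrightarrow>
    (\<exists>(Y, z) \<in> multipliers f G h x. G x + Y \<in> pd_mats)"

definition Omega :: "(real^'n \<Rightarrow> real^'m^'m) \<Rightarrow> real^'n \<Rightarrow> real^'m^'m \<Rightarrow> real^'n^'n" where
  "Omega G x Y =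
    (\<chi> i j. 2 * trace_inner Y (partial_deriv i G x ** pinv (G x) ** partial_deriv j G x))"

definition critical_cone ::
  "(real^'n \<Rightarrow> real) \<Rightarrow> (real^'n \<Rightarrow> real^'m^'m) \<Rightarrow> (real^'n \<Rightarrow> real^'s) \<Rightarrow>
   real^'n \<Rightarrow> (real^'n) set" where
  "critical_cone f G h x =
    {d. inner (grad f x) d = 0 \<and> transpose (nabla h x) *v d = 0 \<and>
      Delta_G G x d \<in> tangent_cone psd_mats (G x)}"

definition enhanced_SOSC ::
  "(real^'n \<Rightarrow> real) \<Rightarrow> (real^'n \<Rightarrow> real^'m^'m) \<Rightarrow> (real^'n \<Rightarrow> real^'s) \<Rightarrow>
   real^'n \<Rightarrow> bool" where
  "enhanced_SOSC f G h x \<longleftrightarrow>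
    (\<forall>(Y, z) \<in> multipliers f G h x. \<forall>d \<in> critical_cone f G h x - {0}.
      0 < inner d ((hessian (\<lambda>x. lagrangian f G h x Y z) x + Omega G x Y) *v d))"

definition MFCQ ::
  "(real^'n \<Rightarrow> real^'m^'m) \<Rightarrow> (real^'n \<Rightarrow> real^'s) \<Rightarrow> real^'n \<Rightarrow> bool" where
  "MFCQ G h x \<longleftrightarrow>
    rank (nabla h x) = CARD('s) \<and>
    (\<exists>d. G x + Delta_G G x d \<in> pd_mats \<and> transpose (nabla h x) *v d = 0)"


section \<open>The analytic center\<close>

text \<open>
  The number of columns of \<open>E\<^sub>*\<close> depends on the rank of a matrix and may be \<open>0\<close>, so
  \<open>E\<^sub>*\<close> is given by its columns \<open>e 0, \<dots>, e (k - 1)\<close> with \<open>k\<close> a natural number, and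
  \<open>E\<^sub>*\<^sup>T Y E\<^sub>*\<close> is a matrix whose dimension is a value. For \<open>k = 0\<close> its determinant is \<open>1\<close>.
\<close>

definition kernel_onb :: "real^'m^'m \<Rightarrow> (nat \<Rightarrow> real^'m) \<Rightarrow> bool" where
  "kernel_onb A e \<longleftrightarrow> (let k = CARD('m) - rank A in
    (\<forall>i<k. \<forall>j<k. inner (e i) (e j) = (if i = j then 1 else 0)) \<and>
    span (e ` {..<k}) = {v. A *v v = 0})"

definition compress :: "nat \<Rightarrow> (nat \<Rightarrow> real^'m) \<Rightarrow> real^'m^'m \<Rightarrow> real Matrix.mat" where
  "compress k e Y = Matrix.mat k k (\<lambda>(i, j). inner (e i) (Y *v e j))"

definition log_ereal :: "real \<Rightarrow> ereal" where
  "log_ereal t = (if 0 < t then ereal (ln t) else - \<infinity>)"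

definition analytic_center ::
  "(real^'n \<Rightarrow> real) \<Rightarrow> (real^'n \<Rightarrow> real^'m^'m) \<Rightarrow> (real^'n \<Rightarrow> real^'s) \<Rightarrow>
   (nat \<Rightarrow> real^'m) \<Rightarrow> real^'n \<Rightarrow> (real^'m^'m) \<times> (real^'s) \<Rightarrow> bool" where
  "analytic_center f G h e x = (\<lambda>(Y, z).
    let k = CARD('m) - rank (G x);
        obj = (\<lambda>Y. - log_ereal (Determinant.det (compress k e Y)))
    in (Y, z) \<in> multipliers f G h x \<and>
       (\<forall>(Y', z') \<in> multipliers f G h x. obj Y \<le> obj Y'))"

end

(*
  Put x = xs + mu xi. Since xs is only a limit of interior points, the BKKT system degenerates at
  mu = 0: the multipliers of xs are not unique, and the part of the stationarity equation in the
  space U = {d. P (dG d) P = 0, dh d = 0}, where P projects onto the kernel of G xs, holds there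
  for all multipliers. Dividing that part and the equation h x = 0 by mu, and expressing Y
  through a matrix N with M N = I for a suitable rescaling M of G x, gives a system F(mu, (xi, N, z)) = 0
  that makes sense for mu = 0. There it says that P (dG xi) P inverts Y on the kernel of G xs with
  dh xi = 0, which is the optimality condition of the analytic center, together with a linear
  equation for the component of xi in U, which the second-order condition makes uniquely solvable.
  The derivative of F at that solution is injective, so an implicit function theorem on mu >= 0
  yields the path. Conversely, BKKT triplets close to the analytic center have rescalings close to
  the solution at mu = 0, which gives uniqueness near the limit; it extends to the whole interval
  because the interval is connected.
*)
theory Submission
  imports Defs
begin

section \<open>Matrices and positive semidefiniteness\<close>

text \<open>With \<open>Q = mat 1 - P\<close>, the rescaling is one-sided:
  \<open>G x = (\<mu> P + Q) M\<close>, \<open>Y = N (P + \<mu> Q)\<close>. Symmetric factors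
  \<open>sqrt \<mu> P + Q\<close> would let Y differ from \<open>P N P\<close> by terms carrying
  only \<open>sqrt \<mu>\<close>, which resist division by \<mu>; here \<open>M N = I\<close> itself
  turns the block \<open>Q N P\<close> into \<mu> times a continuous expression. The price is that N
  is not symmetric and the system does not see definiteness. The former is harmless: N ranges over
  all square matrices, unknowns and equations live in the same space, so injectivity of the
  derivative suffices, and Y is symmetric as a multiple of the inverse of \<open>G x\<close>.
  Definiteness is checked separately, with the symmetric scaling. For the same dimension count the
  two scales of the stationarity equation stay in one equation: they are orthogonal to each other,
  so their sum vanishes only if both do. Injectivity then rests on two quadratic forms:
  \<open>trace (dG a Ya dG a Ya)\<close>, the curvature of the barrier, forces a velocity a with
  \<open>dh a = 0\<close> into U, and on U the second-order condition takes over.\<close>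

lemma bounded_bilinear_matrix_matrix_mult:
  "bounded_bilinear ((**) :: real^'n^'m \<Rightarrow> real^'p^'n \<Rightarrow> real^'p^'m)"
  unfolding bilinear_conv_bounded_bilinear[symmetric]
  by (auto simp: bilinear_def linear_iff matrix_matrix_mult_def vec_eq_iff sum.distrib
      sum_distrib_left algebra_simps)

lemma bounded_bilinear_matrix_vector_mult:
  "bounded_bilinear ((*v) :: real^'n^'m \<Rightarrow> real^'n \<Rightarrow> real^'m)"
  unfolding bilinear_conv_bounded_bilinear[symmetric]
  by (auto simp: bilinear_def linear_iff matrix_vector_mult_def vec_eq_iff sum.distrib
      sum_distrib_left algebra_simps)

lemma bounded_linear_transpose: "bounded_linear (transpose :: real^'n^'m \<Rightarrow> _)"
  unfolding linear_conv_bounded_linear[symmetric]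
  by (auto simp: linear_iff transpose_def vec_eq_iff)

lemma bounded_linear_trace: "bounded_linear (trace :: real^'n^'n \<Rightarrow> _)"
  unfolding linear_conv_bounded_linear[symmetric]
  by (auto simp: linear_iff trace_def sum.distrib sum_distrib_left)

interpretation mm: bounded_bilinear "(**) :: real^'n^'m \<Rightarrow> real^'p^'n \<Rightarrow> real^'p^'m"
  by (rule bounded_bilinear_matrix_matrix_mult)

interpretation mv: bounded_bilinear "(*v) :: real^'n^'m \<Rightarrow> real^'n \<Rightarrow> real^'m"
  by (rule bounded_bilinear_matrix_vector_mult)

lemmas tp_linear = bounded_linear.linear[OF bounded_linear_transpose]
lemmas tp_simps = linear_add[OF tp_linear] linear_diff[OF tp_linear] linear_scale[OF tp_linear]
  linear_0[OF tp_linear] linear_neg[OF tp_linear] matrix_transpose_mul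

lemmas tr_linear = bounded_linear.linear[OF bounded_linear_trace]
lemmas tr_simps = linear_add[OF tr_linear] linear_diff[OF tr_linear] linear_scale[OF tr_linear]
  linear_0[OF tr_linear] linear_neg[OF tr_linear]

lemmas mat_distrib = mm.add_left mm.add_right mm.diff_left mm.diff_right mm.minus_left mm.minus_right
  mm.scaleR_left mm.scaleR_right mm.zero_left mm.zero_right matrix_mul_assoc[symmetric]
  matrix_mul_lid matrix_mul_rid

lemmas mat_vec = mv.add_left mv.add_right mv.diff_left mv.diff_right mv.minus_left mv.minus_right
  mv.scaleR_left mv.scaleR_right mv.zero_left mv.zero_right

lemma matrix_mul_pull: "A ** B = C \<Longrightarrow> A ** (B ** X) = C ** X"
  by (simp add: matrix_mul_assoc)

lemma inner_matrix_vector_mult: "inner x (A *v y) = inner (transpose A *v x) (y :: real^'n)"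
  by (metis dot_lmul_matrix vector_transpose_matrix transpose_transpose)

lemma sym_inner: "A \<in> sym_mats \<Longrightarrow> inner x (A *v y) = inner (A *v x) y"
  using inner_matrix_vector_mult[of x A y] by (simp add: sym_mats_def)

section \<open>Semidefiniteness without eigenvalues\<close>

lemma psd_sym: "A \<in> psd_mats \<Longrightarrow> A \<in> sym_mats"
  and psd_ge: "A \<in> psd_mats \<Longrightarrow> 0 \<le> inner v (A *v v)"
  by (auto simp: psd_mats_def)

lemma psd_add_sym_expand:
  assumes "A \<in> sym_mats"
  shows "inner (u + t *\<^sub>R v) (A *v (u + t *\<^sub>R v)) =
    inner u (A *v u) + 2 * t * inner u (A *v v) + t^2 * inner v (A *v v)"
proof -
  have "inner v (A *v u) = inner u (A *v v)" using sym_inner[OF assms, of v u] by (simp add: inner_commute)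
  then show ?thesis by (simp add: mat_vec inner_simps algebra_simps power2_eq_square)
qed

lemma psd_Cauchy_Schwarz:
  assumes A: "A \<in> psd_mats"
  shows "(inner u (A *v v))^2 \<le> inner u (A *v u) * inner v (A *v v)"
proof -
  let ?a = "inner u (A *v u)" and ?b = "inner u (A *v v)" and ?c = "inner v (A *v v)"
  have q: "0 \<le> ?a + 2 * t * ?b + t^2 * ?c" for t
    using psd_ge[OF A, of "u + t *\<^sub>R v"] psd_add_sym_expand[OF psd_sym[OF A], of u t v] by simp
  show ?thesis
  proof (cases "?c = 0")
    case True
    have "?b = 0"
    proof (rule ccontr)
      assume "?b \<noteq> 0"
      \<comment> \<open>With vanishing quadratic coefficient the expression is affine in t; at this
        t it equals -1.\<close>
      then show False using q[of "- (?a + 1) / (2 * ?b)"] True by (simp add: field_simps)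
    qed
    then show ?thesis using True by simp
  next
    case False
    then have c: "?c > 0" using psd_ge[OF A, of v] by simp
    have "0 \<le> ?c * (?a + 2 * (- ?b / ?c) * ?b + (- ?b / ?c)^2 * ?c)"
      using q[of "- ?b / ?c"] c by simp
    also have "\<dots> = ?a * ?c - ?b^2"
      using c by (simp add: field_simps power2_eq_square)
    finally show ?thesis by simp
  qed
qed

text \<open>Cauchy-Schwarz for the form of A, tested with \<open>A *v v\<close>, bounds the fourth
  power of the norm of \<open>A *v v\<close> by zero.\<close>

lemma psd_null:
  assumes A: "A \<in> psd_mats" and "inner v (A *v v) = 0"
  shows "A *v v = 0"
  using psd_Cauchy_Schwarz[OF A, of "A *v v" v] assms(2) by simp

definition outer :: "real^'m \<Rightarrow> real^'n \<Rightarrow> real^'n^'m" where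
  "outer a b = (\<chi> i j. a $ i * b $ j)"

lemma outer_mult_vec: "outer a b *v v = inner b v *\<^sub>R a"
  by (simp add: outer_def matrix_vector_mult_def vec_eq_iff inner_vec_def sum_distrib_left mult_ac)

lemma transpose_outer [simp]: "transpose (outer a b) = outer b a"
  by (simp add: outer_def transpose_def vec_eq_iff mult.commute)

lemma matrix_mult_outer: "A ** outer a b = outer (A *v a) b"
  by (simp add: outer_def matrix_matrix_mult_def matrix_vector_mult_def vec_eq_iff sum_distrib_right mult.assoc)

lemma trace_outer: "trace (outer a b) = inner a b"
  by (simp add: trace_def outer_def inner_vec_def)

text \<open>
  If \<open>v\<close> is not in the kernel of \<open>B\<close>, subtracting \<open>(B v) (B v)\<^sup>T / v\<^sup>T B v\<close> keeps \<open>B\<close> positive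
  semidefinite and lowers its rank, so \<open>B\<close> is a sum of rank-one terms and no spectral theorem
  is needed.
\<close>

lemma psd_trace_mult:
  fixes A B :: "real^'m^'m"
  assumes A: "A \<in> psd_mats" and "B \<in> psd_mats"
  shows "0 \<le> trace (A ** B)" and "trace (A ** B) = 0 \<Longrightarrow> A ** B = 0"
proof -
  have "0 \<le> trace (A ** B) \<and> (trace (A ** B) = 0 \<longrightarrow> A ** B = 0)" using assms(2)
  proof (induction "rank B" arbitrary: B rule: less_induct)
    case less
    note B = \<open>B \<in> psd_mats\<close>
    show ?case
    proof (cases "\<forall>v. inner v (B *v v) = 0")
      case True
      then have "B *v v = 0" for v using psd_null[OF B] by blast
      then have "B = 0" using matrix_eq[of B 0] by simp
      then show ?thesis by (simp add: mm.zero_right tr_simps)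
    next
      case False
      then obtain v where v: "inner v (B *v v) > 0" using psd_ge[OF B] by (metis order_le_less)
      define \<beta> where "\<beta> = inner v (B *v v)"
      define w where "w = B *v v"
      have \<beta>: "\<beta> > 0" using v by (simp add: \<beta>_def)
      define B' where "B' = B - (1/\<beta>) *\<^sub>R outer w w"
      have B'v: "B' *v u = B *v (u - (inner w u / \<beta>) *\<^sub>R v)" for u
        by (simp add: B'_def mat_vec outer_mult_vec w_def)
      have sB: "transpose B = B" using psd_sym[OF B] by (simp add: sym_mats_def)
      have B': "B' \<in> psd_mats"
        unfolding psd_mats_def sym_mats_def
      proof (intro CollectI conjI allI)
        show "transpose B' = B'" by (simp add: B'_def tp_simps tp_simps sB)
        fix u
        have "inner u (B' *v u) = inner u (B *v u) - (inner w u)^2 / \<beta>"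
          by (simp add: B'_def mat_vec outer_mult_vec inner_simps power2_eq_square inner_commute)
        moreover have "(inner w u)^2 \<le> inner u (B *v u) * \<beta>"
          using psd_Cauchy_Schwarz[OF B, of u v] by (simp add: \<beta>_def w_def inner_commute)
        moreover from this have "(inner w u)^2 / \<beta> \<le> inner u (B *v u)" using \<beta> by (simp add: divide_le_eq)
        ultimately show "0 \<le> inner u (B' *v u)" by simp
      qed
      \<comment> \<open>The range shrinks strictly: all of the range of \<open>B'\<close> is
        orthogonal to v, while \<open>w = B *v v\<close> has inner product
        \<open>\<beta> > 0\<close> with v.\<close>
      have "rank B' < rank B"
        unfolding rank_dim_range
      proof (rule dim_psubset)
        have s: "subspace (range ((*v) X))" for X :: "real^'m^'m"
          by (rule linear_subspace_image) (auto simp: matrix_vector_mul_linear)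
        have "B' *v v = 0" using \<beta> by (simp add: B'v \<beta>_def w_def inner_commute mat_vec)
        then have "inner v (B' *v u) = 0" for u using sym_inner[OF psd_sym[OF B'], of v u] by simp
        then have "w \<notin> range ((*v) B')" using \<beta> by (auto simp: \<beta>_def w_def)
        moreover have "w \<in> range ((*v) B)" by (simp add: w_def)
        moreover have "range ((*v) B') \<subseteq> range ((*v) B)" using B'v by auto
        ultimately show "span (range ((*v) B')) \<subset> span (range ((*v) B))"
          by (auto simp: span_eq_iff[THEN iffD2, OF s])
      qed
      from less(1)[OF this B'] have IH: "0 \<le> trace (A ** B')" "trace (A ** B') = 0 \<longrightarrow> A ** B' = 0" by auto
      have "B = B' + (1/\<beta>) *\<^sub>R outer w w" by (simp add: B'_def)
      then have AB: "A ** B = A ** B' + (1/\<beta>) *\<^sub>R outer (A *v w) w"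
        by (simp add: mat_distrib matrix_mult_outer)
      then have t: "trace (A ** B) = trace (A ** B') + inner w (A *v w) / \<beta>"
        by (simp add: tr_simps tr_simps trace_outer inner_commute)
      have "0 \<le> inner w (A *v w) / \<beta>" using psd_ge[OF A] \<beta> by simp
      moreover have "A ** B = 0" if "trace (A ** B') = 0" "inner w (A *v w) / \<beta> = 0"
      proof -
        have "A *v w = 0" using psd_null[OF A] that(2) \<beta> by simp
        then show ?thesis using IH that by (simp add: AB outer_def vec_eq_iff)
      qed
      ultimately show ?thesis using IH t by (auto simp: add_nonneg_eq_0_iff)
    qed
  qed
  then show "0 \<le> trace (A ** B)" "trace (A ** B) = 0 \<Longrightarrow> A ** B = 0" by auto
qed

lemma pd_lower_bound:
  assumes A: "A \<in> pd_mats"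
  obtains c where "c > 0" "\<And>v. c * (norm v)^2 \<le> inner v (A *v v)"
proof -
  have "compact (sphere 0 1 :: (real^'a) set)" by (rule compact_sphere)
  moreover have "axis undefined 1 \<in> (sphere 0 1 :: (real^'a) set)" by simp
  moreover have "continuous_on (sphere 0 1) (\<lambda>v. inner v (A *v v))"
    by (intro continuous_intros mv.continuous_on)
  ultimately obtain x where x: "x \<in> sphere 0 1" "\<And>y. y \<in> sphere 0 1 \<Longrightarrow> inner x (A *v x) \<le> inner y (A *v y)"
    using continuous_attains_inf[of "sphere 0 1" "\<lambda>v. inner v (A *v v)"] by blast
  have "inner x (A *v x) * (norm v)^2 \<le> inner v (A *v v)" for v
  proof (cases "v = 0")
    case False
    have "inner x (A *v x) * (norm v)^2 \<le> inner (v /\<^sub>R norm v) (A *v (v /\<^sub>R norm v)) * (norm v)^2"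
      using x(2)[of "v /\<^sub>R norm v"] False by (intro mult_right_mono) auto
    also have "\<dots> = inner v (A *v v)" using False by (simp add: mat_vec power2_eq_square field_simps)
    finally show ?thesis .
  qed (simp add: mat_vec)
  moreover have "inner x (A *v x) > 0" using A x(1) by (cases "x = 0") (auto simp: pd_mats_def)
  ultimately show thesis using that by blast
qed

lemma pd_open:
  assumes A: "A \<in> pd_mats"
  obtains \<epsilon> where "\<epsilon> > 0" "\<And>B. B \<in> sym_mats \<Longrightarrow> norm (B - A) < \<epsilon> \<Longrightarrow> B \<in> pd_mats"
proof -
  obtain c where c: "c > 0" "\<And>v. c * (norm v)^2 \<le> inner v (A *v v)" using pd_lower_bound[OF A] by blast
  obtain K where K: "K > 0" "\<And>X v. norm (X *v v) \<le> norm (X :: real^'a^'a) * norm v * K" using mv.pos_bounded by blast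
  show thesis
  proof (rule that[of "c / K"])
    show "c / K > 0" using c K by simp
    fix B assume B: "B \<in> sym_mats" "norm (B - A) < c / K"
    have "inner v (B *v v) > 0" if "v \<noteq> 0" for v
    proof -
      have "\<bar>inner v ((B - A) *v v)\<bar> \<le> norm v * (norm (B - A) * norm v * K)"
        using Cauchy_Schwarz_ineq2[of v "(B - A) *v v"] K(2)[of "B - A" v]
        by (meson mult_left_mono norm_ge_zero order_trans)
      also have "\<dots> = norm (B - A) * K * (norm v)^2" by (simp add: power2_eq_square)
      also have "\<dots> < c * (norm v)^2"
        using B(2) K(1) that by (intro mult_strict_right_mono) (auto simp: field_simps)
      also have "\<dots> \<le> inner v (A *v v)" by (rule c)
      finally show ?thesis by (simp add: mat_vec inner_simps)
    qed
    then show "B \<in> pd_mats" using B(1) by (simp add: pd_mats_def)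
  qed
qed

lemma eventually_pd:
  assumes "A \<in> pd_mats" and "(X \<longlongrightarrow> A) F" and "\<And>t. X t \<in> sym_mats"
  shows "\<forall>\<^sub>F t in F. X t \<in> pd_mats"
proof -
  obtain \<epsilon> where \<epsilon>: "\<epsilon> > 0" "\<And>B. B \<in> sym_mats \<Longrightarrow> norm (B - A) < \<epsilon> \<Longrightarrow> B \<in> pd_mats"
    using pd_open[OF assms(1)] by blast
  have "\<forall>\<^sub>F t in F. dist (X t) A < \<epsilon>" by (rule tendstoD[OF assms(2) \<epsilon>(1)])
  then show ?thesis by eventually_elim (use \<epsilon>(2) assms(3) in \<open>auto simp: dist_norm\<close>)
qed

lemma pd_congruence:
  assumes B: "B \<in> pd_mats" and T: "transpose T = T" and inj: "\<And>v. T *v v = 0 \<Longrightarrow> v = 0"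
  shows "T ** B ** T \<in> pd_mats"
proof -
  have "transpose B = B" using B by (simp add: pd_mats_def sym_mats_def)
  then have "transpose (T ** B ** T) = T ** B ** T"
    by (simp add: matrix_transpose_mul T matrix_mul_assoc)
  moreover have "inner v ((T ** B ** T) *v v) > 0" if "v \<noteq> 0" for v
  proof -
    have "inner v ((T ** B ** T) *v v) = inner (T *v v) (B *v (T *v v))"
      using inner_matrix_vector_mult[of v T "B *v (T *v v)"] T by (simp add: matrix_vector_mul_assoc matrix_mul_assoc)
    then show ?thesis using B inj[of v] that by (auto simp: pd_mats_def)
  qed
  ultimately show ?thesis by (simp add: pd_mats_def sym_mats_def)
qed

section \<open>Block scaling along a projection\<close>

lemma scaled_projection_injective:
  fixes P :: "real^'m^'m"
  assumes PP: "P ** P = P" and "\<sigma> \<noteq> (0::real)" and "(\<sigma> *\<^sub>R P + (mat 1 - P)) *v v = 0"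
  shows "v = 0"
proof -
  have "(\<sigma> *\<^sub>R P + (mat 1 - P)) *v v = \<sigma> *\<^sub>R (P *v v) + (v - P *v v)"
    by (simp only: mat_vec matrix_vector_mul_lid)
  then have 0: "\<sigma> *\<^sub>R (P *v v) + (v - P *v v) = 0" using assms(3) by simp
  then have "P *v (\<sigma> *\<^sub>R (P *v v) + (v - P *v v)) = 0" by (simp add: mat_vec)
  then have "\<sigma> *\<^sub>R (P *v v) = 0"
    by (simp only: mat_vec matrix_vector_mul_assoc PP diff_self add_0_right)
  then show ?thesis using 0 assms(2) by simp
qed

lemma pd_subset_psd: "pd_mats \<subseteq> psd_mats"
proof
  fix A :: "real^'a^'a" assume "A \<in> pd_mats"
  then have "0 \<le> inner v (A *v v)" for v by (cases "v = 0") (auto simp: pd_mats_def intro: less_imp_le)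
  then show "A \<in> psd_mats" using \<open>A \<in> pd_mats\<close> by (simp add: pd_mats_def psd_mats_def)
qed

text \<open>Either the form of D is positive at v, or v lies in the kernel of D and P fixes
  it.\<close>

lemma psd_plus_projection_pd:
  assumes D: "D \<in> psd_mats" and P: "transpose P = P" "P ** P = P"
    and ker: "\<And>v. D *v v = 0 \<Longrightarrow> P *v v = v"
  shows "D + P \<in> pd_mats"
proof -
  have "0 < inner v ((D + P) *v v)" if "v \<noteq> 0" for v
  proof -
    have "inner v (P *v v) = inner (P *v v) (P *v v)"
      using inner_matrix_vector_mult[of v P "P *v v"] P by (simp add: matrix_vector_mul_assoc)
    then have s: "inner v ((D + P) *v v) = inner v (D *v v) + inner (P *v v) (P *v v)"
      by (simp add: mat_vec inner_add_right)
    have "inner v (D *v v) \<noteq> 0 \<or> P *v v \<noteq> 0"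
      using psd_null[OF D, of v] ker[of v] that by auto
    then show ?thesis using psd_ge[OF D, of v] unfolding s by (auto intro: add_pos_nonneg add_nonneg_pos)
  qed
  then show ?thesis using psd_sym[OF D] P by (simp add: pd_mats_def sym_mats_def tp_simps)
qed

text \<open>In blocks with respect to P and \<open>mat 1 - P\<close>, this congruence multiplies the
  kernel block by \<open>\<sigma>\<^sup>2\<close> and the mixed blocks by \<sigma> and keeps the
  rest. It exhibits nearly singular matrices as congruent to perturbations of a fixed positive
  definite one, with \<open>\<sigma> = sqrt \<mu>\<close> for \<open>G x\<close> and
  \<open>\<sigma> = \<tau>^3\<close> for the tangent cone.\<close>

lemma block_scaling:
  fixes P D X :: "real^'m^'m"
  assumes "P ** P = P" "D ** P = 0" "P ** D = 0"
  shows "(\<sigma> *\<^sub>R P + (mat 1 - P)) ** (D + P ** Z ** P + \<beta> *\<^sub>R (P ** X ** (mat 1 - P) + (mat 1 - P) ** X ** P)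
      + \<gamma> *\<^sub>R ((mat 1 - P) ** X ** (mat 1 - P))) ** (\<sigma> *\<^sub>R P + (mat 1 - P))
    = D + \<sigma>\<^sup>2 *\<^sub>R (P ** Z ** P) + (\<sigma> * \<beta>) *\<^sub>R (P ** X ** (mat 1 - P) + (mat 1 - P) ** X ** P)
      + \<gamma> *\<^sub>R ((mat 1 - P) ** X ** (mat 1 - P))"
proof -
  let ?Q = "mat 1 - P" and ?T = "\<sigma> *\<^sub>R P + (mat 1 - P)"
  note pull = assms[THEN matrix_mul_pull]
  have T: "?T ** P = \<sigma> *\<^sub>R P" "P ** ?T = \<sigma> *\<^sub>R P" "?T ** ?Q = ?Q" "?Q ** ?T = ?Q" "?T ** D = D" "D ** ?T = D"
    by (simp_all add: mat_distrib assms)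
  have b: "?T ** (A ** W ** C) ** ?T = (?T ** A) ** W ** (C ** ?T)" for A W C :: "real^'m^'m"
    by (simp only: matrix_mul_assoc)
  have d: "?T ** D ** ?T = D" by (simp only: T)
  show ?thesis
    unfolding mm.add_right[of ?T] mm.add_left[of _ _ ?T] mm.scaleR_right[of ?T] mm.scaleR_left[of _ _ ?T] b d T
    by (simp add: mm.scaleR_left mm.scaleR_right scaleR_add_right power2_eq_square mult_ac)
qed

section \<open>Trace inner product, pseudoinverses and projections\<close>

lemma inner_matrix_eq_trace: "inner A B = trace (transpose A ** B)" for A B :: "real^'n^'m"
proof -
  have "inner A B = (\<Sum>i\<in>UNIV. \<Sum>j\<in>UNIV. A $ i $ j * B $ i $ j)" by (simp add: inner_vec_def)
  also have "\<dots> = (\<Sum>j\<in>UNIV. \<Sum>i\<in>UNIV. A $ i $ j * B $ i $ j)" by (rule sum.swap)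
  finally show ?thesis by (simp add: trace_def transpose_def matrix_matrix_mult_def)
qed

text \<open>\<open>D + P\<close> is invertible with symmetric inverse M, and both fix the range of
  P; so \<open>M - P\<close> inverts D off the kernel and vanishes on it.\<close>

lemma sym_pseudo_inverse:
  fixes D P :: "real^'m^'m"
  assumes D: "transpose D = D" and P: "transpose P = P" "P ** P = P" and DP: "D ** P = 0"
    and ker: "\<And>v. D *v v = 0 \<Longrightarrow> P *v v = v"
  obtains J where "transpose J = J" "J ** P = 0" "P ** J = 0" "D ** J = mat 1 - P" "J ** D = mat 1 - P"
proof -
  have PD: "P ** D = 0"
    using arg_cong[OF DP, of transpose] by (simp add: matrix_transpose_mul D P tp_simps)
  have "v = 0" if "(D + P) *v v = 0" for v
  proof -
    have "P *v ((D + P) *v v) = 0" using that by (simp add: mat_vec)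
    then have Pv: "P *v v = 0" by (simp add: matrix_vector_mul_assoc mat_distrib PD P)
    then have "D *v v = 0" using that by (simp add: mat_vec)
    then show "v = 0" using ker[of v] Pv by simp
  qed
  then have "\<exists>B. B ** (D + P) = mat 1"
    unfolding matrix_left_invertible_ker by blast
  then obtain M where M1: "M ** (D + P) = mat 1" by blast
  then have M2: "(D + P) ** M = mat 1" by (simp add: matrix_left_right_inverse)
  have "(D + P) ** transpose M = mat 1"
    using arg_cong[OF M1, of transpose] by (simp add: matrix_transpose_mul tp_simps D P transpose_mat)
  then have MT: "transpose M = M" by (metis M1 matrix_mul_assoc matrix_mul_lid matrix_mul_rid)
  have "M ** P = M ** ((D + P) ** P)" by (simp add: mat_distrib DP P)
  also have "\<dots> = P" by (simp add: matrix_mul_assoc M1)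
  finally have MP: "M ** P = P" .
  have PM: "P ** M = P" using arg_cong[OF MP, of transpose] by (simp add: matrix_transpose_mul MT P)
  show thesis
  proof (rule that[of "M - P"])
    show "transpose (M - P) = M - P" by (simp add: tp_simps MT P)
    show "(M - P) ** P = 0" "P ** (M - P) = 0" by (simp_all add: mat_distrib MP PM P)
    show "D ** (M - P) = mat 1 - P" using M2 by (simp add: mat_distrib DP PM algebra_simps)
    show "(M - P) ** D = mat 1 - P" using M1 by (simp add: mat_distrib PD MP algebra_simps)
  qed
qed

text \<open>For two Moore-Penrose inverses B and C the symmetric projections \<open>A ** B\<close>
  and \<open>A ** C\<close> coincide, and so do \<open>B ** A\<close> and \<open>C ** A\<close>;
  then \<open>B = B ** A ** B\<close> can be rewritten into C.\<close>

lemma pinv_eqI: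
  assumes B: "is_moore_penrose A B"
  shows "pinv A = B"
  unfolding pinv_def
proof (rule the_equality[where P = "is_moore_penrose A", OF B])
  fix C assume C: "is_moore_penrose A C"
  have b: "A ** B ** A = A" "B ** A ** B = B" "transpose (A ** B) = A ** B" "transpose (B ** A) = B ** A"
    and c: "A ** C ** A = A" "C ** A ** C = C" "transpose (A ** C) = A ** C" "transpose (C ** A) = C ** A"
    using B C unfolding is_moore_penrose_def by auto
  have "A ** B = transpose (A ** C ** A ** B)" using b c by simp
  also have "\<dots> = transpose (A ** B) ** transpose (A ** C)"
    by (simp only: matrix_transpose_mul matrix_mul_assoc)
  also have "\<dots> = A ** C" using b c by (simp add: matrix_mul_assoc)
  finally have 1: "A ** B = A ** C" .
  have "B ** A = transpose (B ** (A ** C ** A))" using b c by simp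
  also have "\<dots> = transpose (C ** A) ** transpose (B ** A)"
    by (simp only: matrix_transpose_mul matrix_mul_assoc)
  also have "\<dots> = C ** (A ** B ** A)" unfolding b(4) c(4) by (simp only: matrix_mul_assoc)
  finally have 2: "B ** A = C ** A" by (simp only: b)
  show "C = B" by (metis 1 2 b(2) c(2) matrix_mul_assoc)
qed

lemma orthogonal_projection_exists:
  fixes U :: "'a::euclidean_space set"
  assumes U: "subspace U"
  obtains \<pi> where "linear \<pi>" "\<And>x. \<pi> x \<in> U" "\<And>x u. u \<in> U \<Longrightarrow> inner u (x - \<pi> x) = 0"
proof -
  obtain B where B: "B \<subseteq> U" "pairwise orthogonal B" "\<And>x. x \<in> B \<Longrightarrow> norm x = 1" "independent B" "span B = U"
    using orthonormal_basis_subspace[OF U] by metis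
  have fin: "finite B" using B(4) independent_imp_finite by blast
  define \<pi> where "\<pi> x = (\<Sum>b\<in>B. inner b x *\<^sub>R b)" for x
  have b: "inner c (x - \<pi> x) = 0" if c: "c \<in> B" for c x
  proof -
    have "inner c (\<pi> x) = (\<Sum>b\<in>B. inner b x * inner c b)" by (simp add: \<pi>_def inner_sum_right)
    also have "\<dots> = (\<Sum>b\<in>B. if b = c then inner c x else 0)"
      using B(2,3) c by (intro sum.cong refl) (auto simp: pairwise_def orthogonal_def norm_eq_1)
    also have "\<dots> = inner c x" using fin c by simp
    finally show ?thesis by (simp add: inner_diff_right)
  qed
  show thesis
  proof (rule that[of \<pi>])
    show "linear \<pi>" by (auto simp: linear_iff \<pi>_def inner_add_right scaleR_add_left sum.distrib scaleR_sum_right)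
    show "\<pi> x \<in> U" for x unfolding \<pi>_def using U B(1) by (intro subspace_sum subspace_mul) auto
    show "inner u (x - \<pi> x) = 0" if "u \<in> U" for u x
    proof -
      have "u \<in> span B" using that B by simp
      then show ?thesis
        by (induction rule: span_induct_alt) (auto simp: inner_add_left b)
    qed
  qed
qed

section \<open>Implicit functions with a one-sided parameter\<close>

lemma bounded_linear_Blinfun_left:
  assumes "bounded_bilinear p"
  shows "bounded_linear (\<lambda>x. Blinfun (p x))"
proof -
  have "p = (\<lambda>i x. blinfun_apply (Blinfun (p i)) x)"
    using bounded_bilinear.bounded_linear_right[OF assms] by (auto simp: bounded_linear_Blinfun_apply)
  from transfer_bounded_bilinear_bounded_linearI[OF this] assms show ?thesis by blast
qed

text \<open>
  Regularity of the blown-up system: it is \<open>C\<^sup>1\<close> in the unknown \<open>y\<close> up to \<open>\<mu> = 0\<close>, but in \<open>\<mu>\<close>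
  only for \<open>\<mu> > 0\<close>, because difference quotients of \<open>C\<^sup>1\<close> maps are merely continuous at \<open>\<mu> = 0\<close>.
\<close>

definition param_C1 ::
  "(real \<times> 'a::real_normed_vector \<Rightarrow> 'b::real_normed_vector) \<Rightarrow> bool" where
  "param_C1 F \<longleftrightarrow> (\<exists>(F1 :: real \<times> 'a \<Rightarrow> 'a \<Rightarrow>\<^sub>L 'b) F2.
    (\<forall>\<mu>\<ge>0. \<forall>y. ((\<lambda>y. F (\<mu>, y)) has_derivative blinfun_apply (F1 (\<mu>, y))) (at y)) \<and>
    continuous_on ({0..} \<times> UNIV) F \<and> continuous_on ({0..} \<times> UNIV) F1 \<and>
    (\<forall>\<mu>>0. \<forall>y. ((\<lambda>\<mu>. F (\<mu>, y)) has_vector_derivative F2 (\<mu>, y)) (at \<mu>)) \<and>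
    continuous_on ({0<..} \<times> UNIV) F2)"

lemma param_C1I:
  assumes "\<And>\<mu> y. \<mu> \<ge> 0 \<Longrightarrow> ((\<lambda>y. F (\<mu>, y)) has_derivative blinfun_apply (F1 (\<mu>, y))) (at y)"
    and "continuous_on ({0..} \<times> UNIV) F" and "continuous_on ({0..} \<times> UNIV) F1"
    and "\<And>\<mu> y. \<mu> > 0 \<Longrightarrow> ((\<lambda>\<mu>. F (\<mu>, y)) has_vector_derivative F2 (\<mu>, y)) (at \<mu>)"
    and "continuous_on ({0<..} \<times> UNIV) F2"
  shows "param_C1 F"
  unfolding param_C1_def using assms by blast

section \<open>Closure properties of the one-sided regularity class\<close>

lemma param_C1_const: "param_C1 (\<lambda>_. c)"
  by (rule param_C1I[where ?F1.0="\<lambda>_. 0" and ?F2.0="\<lambda>_. 0"])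
    (auto intro!: derivative_eq_intros)

lemma param_C1_fst: "param_C1 fst"
  by (rule param_C1I[where ?F1.0="\<lambda>_. 0" and ?F2.0="\<lambda>_. 1"])
    (auto intro!: derivative_eq_intros continuous_intros)

lemma param_C1_snd: "param_C1 snd"
  by (rule param_C1I[where ?F1.0="\<lambda>_. id_blinfun" and ?F2.0="\<lambda>_. 0"])
    (auto intro!: derivative_eq_intros continuous_intros)

lemma param_C1_bilinear:
  fixes a :: "real \<times> 'd::real_normed_vector \<Rightarrow> 'a::real_normed_vector"
    and b :: "real \<times> 'd \<Rightarrow> 'b::real_normed_vector"
    and p :: "'a \<Rightarrow> 'b \<Rightarrow> 'c::real_normed_vector"
  assumes p: "bounded_bilinear p" and a: "param_C1 a" and b: "param_C1 b"
  shows "param_C1 (\<lambda>q. p (a q) (b q))"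
proof -
  obtain A1 A2 where A: "\<And>\<mu> y. \<mu> \<ge> 0 \<Longrightarrow> ((\<lambda>y. a (\<mu>, y)) has_derivative blinfun_apply (A1 (\<mu>, y))) (at y)"
    "continuous_on ({0..} \<times> UNIV) a" "continuous_on ({0..} \<times> UNIV) A1"
    "\<And>\<mu> y. \<mu> > 0 \<Longrightarrow> ((\<lambda>\<mu>. a (\<mu>, y)) has_vector_derivative A2 (\<mu>, y)) (at \<mu>)"
    "continuous_on ({0<..} \<times> UNIV) A2" using a unfolding param_C1_def by blast
  obtain B1 B2 where B: "\<And>\<mu> y. \<mu> \<ge> 0 \<Longrightarrow> ((\<lambda>y. b (\<mu>, y)) has_derivative blinfun_apply (B1 (\<mu>, y))) (at y)"
    "continuous_on ({0..} \<times> UNIV) b" "continuous_on ({0..} \<times> UNIV) B1"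
    "\<And>\<mu> y. \<mu> > 0 \<Longrightarrow> ((\<lambda>\<mu>. b (\<mu>, y)) has_vector_derivative B2 (\<mu>, y)) (at \<mu>)"
    "continuous_on ({0<..} \<times> UNIV) B2" using b unfolding param_C1_def by blast
  interpret p: bounded_bilinear p by fact
  let ?L = "\<lambda>x. Blinfun (p x)" and ?R = "\<lambda>y. Blinfun (\<lambda>x. p x y)"
  have L: "bounded_linear ?L" by (rule bounded_linear_Blinfun_left[OF p])
  have R: "bounded_linear ?R"
    by (rule bounded_linear_Blinfun_left[OF bounded_bilinear.flip[OF p]])
  have [simp]: "blinfun_apply (?L x) = p x" "blinfun_apply (?R y) = (\<lambda>x. p x y)" for x y
    by (auto simp: bounded_linear_Blinfun_apply p.bounded_linear_left p.bounded_linear_right)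
  have sub: "({0<..} \<times> UNIV :: (real \<times> 'd) set) \<subseteq> {0..} \<times> UNIV" by auto
  show ?thesis
  proof (rule param_C1I[where ?F1.0="\<lambda>q. (?L (a q) o\<^sub>L B1 q) + (?R (b q) o\<^sub>L A1 q)"
        and ?F2.0="\<lambda>q. p (a q) (B2 q) + p (A2 q) (b q)"])
    fix \<mu> :: real and y :: 'd assume "\<mu> \<ge> 0"
    from p.FDERIV[OF A(1)[OF this] B(1)[OF this]]
    show "((\<lambda>y. p (a (\<mu>, y)) (b (\<mu>, y))) has_derivative
       blinfun_apply ((?L (a (\<mu>, y)) o\<^sub>L B1 (\<mu>, y)) + (?R (b (\<mu>, y)) o\<^sub>L A1 (\<mu>, y)))) (at y)"
      by (simp add: blinfun.bilinear_simps plus_blinfun.rep_eq)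
  next
    show "continuous_on ({0..} \<times> UNIV) (\<lambda>q. p (a q) (b q))"
      by (rule p.continuous_on[OF A(2) B(2)])
    show "continuous_on ({0..} \<times> UNIV) (\<lambda>q. (?L (a q) o\<^sub>L B1 q) + (?R (b q) o\<^sub>L A1 q))"
      by (intro continuous_on_add bounded_bilinear.continuous_on[OF bounded_bilinear_blinfun_compose]
          bounded_linear.continuous_on[OF L] bounded_linear.continuous_on[OF R] A B)
    show "continuous_on ({0<..} \<times> UNIV) (\<lambda>q. p (a q) (B2 q) + p (A2 q) (b q))"
      by (intro continuous_on_add p.continuous_on A B continuous_on_subset[OF A(2) sub]
          continuous_on_subset[OF B(2) sub])
  next
    fix \<mu> :: real and y :: 'd assume "\<mu> > 0"
    from p.has_vector_derivative[OF A(4)[OF this] B(4)[OF this]]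
    show "((\<lambda>\<mu>. p (a (\<mu>, y)) (b (\<mu>, y))) has_vector_derivative
        p (a (\<mu>, y)) (B2 (\<mu>, y)) + p (A2 (\<mu>, y)) (b (\<mu>, y))) (at \<mu>)" by simp
  qed
qed

lemma param_C1_linear:
  assumes T: "bounded_linear T" and a: "param_C1 a"
  shows "param_C1 (\<lambda>q. T (a q))"
proof -
  have "bounded_bilinear (\<lambda>(x::real) y. x *\<^sub>R T y)"
    by (rule bounded_bilinear.comp[OF bounded_bilinear_scaleR bounded_linear_ident T])
  from param_C1_bilinear[OF this param_C1_const[of 1] a] show ?thesis by simp
qed

lemma param_C1_add:
  assumes a: "param_C1 a" and b: "param_C1 b"
  shows "param_C1 (\<lambda>q. a q + b q)"
proof -
  obtain A1 A2 where A: "\<And>\<mu> y. \<mu> \<ge> 0 \<Longrightarrow> ((\<lambda>y. a (\<mu>, y)) has_derivative blinfun_apply (A1 (\<mu>, y))) (at y)"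
    "continuous_on ({0..} \<times> UNIV) a" "continuous_on ({0..} \<times> UNIV) A1"
    "\<And>\<mu> y. \<mu> > 0 \<Longrightarrow> ((\<lambda>\<mu>. a (\<mu>, y)) has_vector_derivative A2 (\<mu>, y)) (at \<mu>)"
    "continuous_on ({0<..} \<times> UNIV) A2" using a unfolding param_C1_def by blast
  obtain B1 B2 where B: "\<And>\<mu> y. \<mu> \<ge> 0 \<Longrightarrow> ((\<lambda>y. b (\<mu>, y)) has_derivative blinfun_apply (B1 (\<mu>, y))) (at y)"
    "continuous_on ({0..} \<times> UNIV) b" "continuous_on ({0..} \<times> UNIV) B1"
    "\<And>\<mu> y. \<mu> > 0 \<Longrightarrow> ((\<lambda>\<mu>. b (\<mu>, y)) has_vector_derivative B2 (\<mu>, y)) (at \<mu>)"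
    "continuous_on ({0<..} \<times> UNIV) B2" using b unfolding param_C1_def by blast
  show ?thesis
    by (rule param_C1I[where ?F1.0="\<lambda>q. A1 q + B1 q" and ?F2.0="\<lambda>q. A2 q + B2 q"])
      (auto intro!: derivative_intros continuous_intros A B simp: plus_blinfun.rep_eq)
qed

lemma param_C1_minus:
  assumes a: "param_C1 a" and b: "param_C1 b"
  shows "param_C1 (\<lambda>q. a q - b q)"
  using param_C1_add[OF a param_C1_linear[OF bounded_linear_minus[OF bounded_linear_ident] b]] by simp

lemma param_C1_sum:
  assumes "\<And>i. i \<in> I \<Longrightarrow> param_C1 (a i)"
  shows "param_C1 (\<lambda>q. \<Sum>i\<in>I. a i q)"
  using assms by (induction I rule: infinite_finite_induct) (auto intro: param_C1_const param_C1_add)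

lemma param_C1_vec:
  fixes a :: "'i::finite \<Rightarrow> real \<times> 'a::real_normed_vector \<Rightarrow> real"
  assumes "\<And>i. param_C1 (a i)"
  shows "param_C1 (\<lambda>q. \<chi> i. a i q)"
proof -
  have *: "(\<lambda>q. \<chi> i. a i q) = (\<lambda>q. \<Sum>i\<in>UNIV. a i q *\<^sub>R axis i 1)"
    by (auto simp: vec_eq_iff axis_def if_distrib if_distribR cong: if_cong)
  show ?thesis unfolding *
    by (intro param_C1_sum param_C1_bilinear[OF bounded_bilinear_scaleR] assms param_C1_const)
qed

lemma param_C1_Pair:
  fixes a :: "_ \<Rightarrow> 'c::real_normed_vector" and b :: "_ \<Rightarrow> 'd::real_normed_vector"
  assumes a: "param_C1 a" and b: "param_C1 b"
  shows "param_C1 (\<lambda>q. (a q, b q))"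
proof -
  have "bounded_linear (\<lambda>x::'c. (x, 0::'d))" "bounded_linear (\<lambda>x::'d. (0::'c, x))"
    by (auto intro!: bounded_linear_Pair bounded_linear_ident bounded_linear_zero)
  from param_C1_add[OF param_C1_linear[OF this(1) a] param_C1_linear[OF this(2) b]]
  show ?thesis by simp
qed

text \<open>Lets difference quotients, which depend on \<open>(\<mu>, \<xi>)\<close> only, be read
  as functions of the whole unknown.\<close>

lemma param_C1_comp_linear:
  assumes T: "bounded_linear T" and a: "param_C1 a"
  shows "param_C1 (\<lambda>q. a (fst q, T (snd q)))"
proof -
  obtain A1 A2 where A: "\<And>\<mu> y. \<mu> \<ge> 0 \<Longrightarrow> ((\<lambda>y. a (\<mu>, y)) has_derivative blinfun_apply (A1 (\<mu>, y))) (at y)"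
    "continuous_on ({0..} \<times> UNIV) a" "continuous_on ({0..} \<times> UNIV) A1"
    "\<And>\<mu> y. \<mu> > 0 \<Longrightarrow> ((\<lambda>\<mu>. a (\<mu>, y)) has_vector_derivative A2 (\<mu>, y)) (at \<mu>)"
    "continuous_on ({0<..} \<times> UNIV) A2" using a unfolding param_C1_def by blast
  have c: "continuous_on S (\<lambda>q. (fst q, T (snd q)))" for S :: "(real \<times> _) set"
    by (intro continuous_intros bounded_linear.continuous_on[OF T])
  have [simp]: "blinfun_apply (Blinfun T) = T" by (simp add: T bounded_linear_Blinfun_apply)
  show ?thesis
  proof (rule param_C1I[where ?F1.0="\<lambda>q. A1 (fst q, T (snd q)) o\<^sub>L Blinfun T"
        and ?F2.0="\<lambda>q. A2 (fst q, T (snd q))"])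
    fix \<mu> :: real and y assume "\<mu> \<ge> 0"
    have "(T has_derivative T) (at y)" by (rule bounded_linear_imp_has_derivative[OF T])
    from has_derivative_compose[OF this A(1)[OF \<open>\<mu> \<ge> 0\<close>]]
    show "((\<lambda>y. a (fst (\<mu>, y), T (snd (\<mu>, y)))) has_derivative
          blinfun_apply (A1 (fst (\<mu>, y), T (snd (\<mu>, y))) o\<^sub>L Blinfun T)) (at y)"
      by (simp add: blinfun_compose.rep_eq o_def)
  next
    show "continuous_on ({0..} \<times> UNIV) (\<lambda>q. a (fst q, T (snd q)))"
      by (rule continuous_on_compose2[OF A(2) c]) auto
    show "continuous_on ({0..} \<times> UNIV) (\<lambda>q. A1 (fst q, T (snd q)) o\<^sub>L Blinfun T)"
      by (intro bounded_bilinear.continuous_on[OF bounded_bilinear_blinfun_compose]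
          continuous_on_const continuous_on_compose2[OF A(3) c]) auto
    show "continuous_on ({0<..} \<times> UNIV) (\<lambda>q. A2 (fst q, T (snd q)))"
      by (rule continuous_on_compose2[OF A(5) c]) auto
  next
    fix \<mu> :: real and y assume "\<mu> > 0"
    from A(4)[OF this, of "T y"]
    show "((\<lambda>\<mu>. a (fst (\<mu>, y), T (snd (\<mu>, y)))) has_vector_derivative
          A2 (fst (\<mu>, y), T (snd (\<mu>, y)))) (at \<mu>)" by simp
  qed
qed

section \<open>Difference quotients extended to \<mu> = 0\<close>

definition C1_map :: "('a::real_normed_vector \<Rightarrow> 'b::real_normed_vector) \<Rightarrow> bool" where
  "C1_map \<phi> \<longleftrightarrow> (\<exists>\<phi>'. (\<forall>x. (\<phi> has_derivative blinfun_apply (\<phi>' x)) (at x)) \<and> continuous_on UNIV \<phi>')"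

definition divdiff :: "('a::real_normed_vector \<Rightarrow> 'b::real_normed_vector) \<Rightarrow> 'a \<Rightarrow> real \<times> 'a \<Rightarrow> 'b" where
  "divdiff \<phi> p = (\<lambda>(\<mu>, \<xi>). if \<mu> = 0 then frechet_derivative \<phi> (at p) \<xi>
     else (\<phi> (p + \<mu> *\<^sub>R \<xi>) - \<phi> p) /\<^sub>R \<mu>)"

lemma divdiff_eq: "\<mu> *\<^sub>R divdiff \<phi> p (\<mu>, \<xi>) = \<phi> (p + \<mu> *\<^sub>R \<xi>) - \<phi> p"
  by (simp add: divdiff_def)

lemma divdiff_0 [simp]: "divdiff \<phi> p (0, \<xi>) = frechet_derivative \<phi> (at p) \<xi>"
  by (simp add: divdiff_def)

text \<open>Differentiating the quotient in \<xi> produces a factor \<mu> that cancels the division,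
  so the derivative is \<open>\<phi>' (p + \<mu> \<xi>)\<close> and extends continuously to \<mu> =
  0. Joint continuity of the quotient at \<open>(0, \<xi>)\<close> comes from differentiability at
  p: after division by \<mu> the remainder is at most a small multiple of the norm of the direction,
  which stays bounded.\<close>

lemma param_C1_divdiff:
  assumes "C1_map \<phi>"
  shows "param_C1 (divdiff \<phi> p)"
proof -
  obtain \<phi>' where d: "\<And>x. (\<phi> has_derivative blinfun_apply (\<phi>' x)) (at x)" and c: "continuous_on UNIV \<phi>'"
    using assms by (auto simp: C1_map_def)
  have fd: "frechet_derivative \<phi> (at p) = blinfun_apply (\<phi>' p)"
    using frechet_derivative_at[OF d] by simp
  have c\<phi>: "continuous_on UNIV \<phi>"
    using d by (meson continuous_at_imp_continuous_on has_derivative_continuous)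
  have sub: "({0<..} \<times> UNIV :: (real \<times> 'a) set) \<subseteq> {0..} \<times> UNIV" by auto
  let ?q = "\<lambda>q::real \<times> 'a. (\<phi> (p + fst q *\<^sub>R snd q) - \<phi> p) /\<^sub>R fst q"
  have pos: "continuous_on ({0<..} \<times> UNIV) ?q"
    by (intro continuous_intros continuous_on_compose2[OF c\<phi>]) auto
  have posd: "continuous_on ({0<..} \<times> UNIV) (divdiff \<phi> p)"
    by (rule continuous_on_eq[OF pos]) (auto simp: divdiff_def)
  have opn: "open ({0<..} \<times> UNIV :: (real \<times> 'a) set)" by (intro open_Times) auto
  show ?thesis
  proof (rule param_C1I[where ?F1.0="\<lambda>q. \<phi>' (p + fst q *\<^sub>R snd q)"
        and ?F2.0="\<lambda>q. (blinfun_apply (\<phi>' (p + fst q *\<^sub>R snd q)) (snd q)) /\<^sub>R fst q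
            - (\<phi> (p + fst q *\<^sub>R snd q) - \<phi> p) /\<^sub>R (fst q)^2"])
    fix \<mu> :: real and y :: 'a assume "\<mu> \<ge> 0"
    show "((\<lambda>y. divdiff \<phi> p (\<mu>, y)) has_derivative
       blinfun_apply (\<phi>' (p + fst (\<mu>, y) *\<^sub>R snd (\<mu>, y)))) (at y)"
    proof (cases "\<mu> = 0")
      case True
      then show ?thesis
        by (simp add: divdiff_def fd bounded_linear_imp_has_derivative blinfun.bounded_linear_right)
    next
      case False
      have "((\<lambda>y. p + \<mu> *\<^sub>R y) has_derivative (\<lambda>v. \<mu> *\<^sub>R v)) (at y)"
        by (auto intro!: derivative_eq_intros)
      from has_derivative_compose[OF this d]
      have "((\<lambda>y. \<phi> (p + \<mu> *\<^sub>R y)) has_derivative (\<lambda>v. blinfun_apply (\<phi>' (p + \<mu> *\<^sub>R y)) (\<mu> *\<^sub>R v))) (at y)" .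
      then have "((\<lambda>y. (\<phi> (p + \<mu> *\<^sub>R y) - \<phi> p) /\<^sub>R \<mu>) has_derivative
          (\<lambda>v. (blinfun_apply (\<phi>' (p + \<mu> *\<^sub>R y)) (\<mu> *\<^sub>R v) - 0) /\<^sub>R \<mu>)) (at y)"
        by (intro derivative_intros)
      with False show ?thesis by (simp add: divdiff_def blinfun.bilinear_simps)
    qed
  next
    show "continuous_on ({0..} \<times> UNIV) (divdiff \<phi> p)"
      unfolding continuous_on_eq_continuous_within
    proof
      fix q :: "real \<times> 'a" assume q: "q \<in> {0..} \<times> UNIV"
      obtain \<mu> \<xi> where [simp]: "q = (\<mu>, \<xi>)" by force
      show "continuous (at q within {0..} \<times> UNIV) (divdiff \<phi> p)"
      proof (cases "\<mu> = 0")
        case False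
        then have "q \<in> {0<..} \<times> UNIV" using q by auto
        then have "continuous (at q) (divdiff \<phi> p)"
          using posd opn by (simp add: continuous_on_eq_continuous_at)
        then show ?thesis using continuous_at_imp_continuous_at_within by blast
      next
        case [simp]: True
        have b: "norm (divdiff \<phi> p q' - blinfun_apply (\<phi>' p) (snd q')) \<le> e * norm (snd q')"
          if "norm (fst q' *\<^sub>R snd q') < dl"
            "\<And>v. norm v < dl \<Longrightarrow> norm (\<phi> (p + v) - \<phi> p - blinfun_apply (\<phi>' p) v) \<le> e * norm v"
            "e \<ge> 0" for q' dl e
        proof (cases "fst q' = 0")
          case True then show ?thesis using that by (cases q') (simp add: fd)
        next
          case False
          have "fst q' *\<^sub>R (divdiff \<phi> p q' - blinfun_apply (\<phi>' p) (snd q'))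
              = \<phi> (p + fst q' *\<^sub>R snd q') - \<phi> p - blinfun_apply (\<phi>' p) (fst q' *\<^sub>R snd q')"
            using divdiff_eq[of "fst q'" \<phi> p "snd q'"] by (simp add: algebra_simps blinfun.bilinear_simps)
          then have "\<bar>fst q'\<bar> * norm (divdiff \<phi> p q' - blinfun_apply (\<phi>' p) (snd q')) \<le> e * norm (fst q' *\<^sub>R snd q')"
            using that(2)[OF that(1)] by (metis norm_scaleR)
          then have "\<bar>fst q'\<bar> * norm (divdiff \<phi> p q' - blinfun_apply (\<phi>' p) (snd q')) \<le> \<bar>fst q'\<bar> * (e * norm (snd q'))"
            by (simp add: mult.left_commute)
          then show ?thesis using False by simp
        qed
        let ?F = "at q within {0..} \<times> UNIV"
        have lin: "((\<lambda>q'. blinfun_apply (\<phi>' p) (snd q')) \<longlongrightarrow> blinfun_apply (\<phi>' p) \<xi>) ?F"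
          by (auto intro!: tendsto_eq_intros)
        have "((\<lambda>q'. divdiff \<phi> p q' - blinfun_apply (\<phi>' p) (snd q')) \<longlongrightarrow> 0) ?F"
        proof (rule tendstoI)
          fix \<epsilon> :: real assume "\<epsilon> > 0"
          \<comment> \<open>Directions near \<xi> have norm below \<open>norm \<xi> + 1\<close>, so
            the error stays below \<open>e * (norm \<xi> + 1) = \<epsilon>\<close>.\<close>
          define e where "e = \<epsilon> / (norm \<xi> + 1)"
          have e: "e > 0" unfolding e_def using \<open>\<epsilon> > 0\<close> by (simp add: add_nonneg_pos)
          obtain dl where dl: "dl > 0" "\<And>v. norm v < dl \<Longrightarrow> norm (\<phi> (p + v) - \<phi> p - blinfun_apply (\<phi>' p) v) \<le> e * norm v"
          proof -
            obtain dl where "dl > 0" and 1: "\<And>y. norm (y - p) < dl \<Longrightarrow> norm (\<phi> y - \<phi> p - blinfun_apply (\<phi>' p) (y - p)) \<le> e * norm (y - p)"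
              using d[of p] e unfolding has_derivative_at_alt by meson
            show thesis by (rule that[OF \<open>dl > 0\<close>]) (use 1[of "p + _"] in simp)
          qed
          have "((\<lambda>q'. norm (fst q' *\<^sub>R snd q')) \<longlongrightarrow> 0) ?F" "((\<lambda>q'. norm (snd q')) \<longlongrightarrow> norm \<xi>) ?F"
            by (auto intro!: tendsto_eq_intros)
          from order_tendstoD(2)[OF this(1) dl(1)] order_tendstoD(2)[OF this(2), of "norm \<xi> + 1"]
          have "\<forall>\<^sub>F q' in ?F. norm (fst q' *\<^sub>R snd q') < dl \<and> norm (snd q') < norm \<xi> + 1"
            by (auto elim: eventually_elim2)
          then show "\<forall>\<^sub>F q' in ?F. dist (divdiff \<phi> p q' - blinfun_apply (\<phi>' p) (snd q')) 0 < \<epsilon>"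
          proof eventually_elim
            case (elim q')
            have "norm (divdiff \<phi> p q' - blinfun_apply (\<phi>' p) (snd q')) \<le> e * norm (snd q')"
              by (rule b[of q' dl e, OF _ dl(2)]) (use elim e in auto)
            also have "\<dots> < e * (norm \<xi> + 1)" using elim e by simp
            also have "\<dots> = \<epsilon>" unfolding e_def using norm_ge_zero[of \<xi>] by (simp add: add_nonneg_eq_0_iff)
            finally show ?case by simp
          qed
        qed
        from tendsto_add[OF this lin] have "(divdiff \<phi> p \<longlongrightarrow> blinfun_apply (\<phi>' p) \<xi>) ?F" by simp
        then show ?thesis by (simp add: continuous_within fd)
      qed
    qed
  next
    show "continuous_on ({0..} \<times> UNIV) (\<lambda>q. \<phi>' (p + fst q *\<^sub>R snd q))"
      by (intro continuous_intros continuous_on_compose2[OF c]) auto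
    show "continuous_on ({0<..} \<times> UNIV) (\<lambda>q. (blinfun_apply (\<phi>' (p + fst q *\<^sub>R snd q)) (snd q)) /\<^sub>R fst q
            - (\<phi> (p + fst q *\<^sub>R snd q) - \<phi> p) /\<^sub>R (fst q)^2)"
      by (intro continuous_intros continuous_on_compose2[OF c] continuous_on_compose2[OF c\<phi>]
          bounded_bilinear.continuous_on[OF bounded_bilinear_blinfun_apply]) auto
  next
    fix \<mu> :: real and y :: 'a assume m: "\<mu> > 0"
    have "((\<lambda>\<mu>. p + \<mu> *\<^sub>R y) has_derivative (\<lambda>t. t *\<^sub>R y)) (at \<mu>)"
      by (auto intro!: derivative_eq_intros)
    from has_derivative_compose[OF this d]
    have 1: "((\<lambda>\<mu>. \<phi> (p + \<mu> *\<^sub>R y)) has_vector_derivative (blinfun_apply (\<phi>' (p + \<mu> *\<^sub>R y)) y)) (at \<mu>)"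
      by (simp add: has_vector_derivative_def blinfun.bilinear_simps)
    have 2: "(inverse has_field_derivative (- (inverse \<mu> ^ Suc (Suc 0)))) (at \<mu>)"
      using m by (intro DERIV_inverse) simp
    have "((\<lambda>\<mu>. inverse \<mu> *\<^sub>R (\<phi> (p + \<mu> *\<^sub>R y) - \<phi> p)) has_vector_derivative
        inverse \<mu> *\<^sub>R (blinfun_apply (\<phi>' (p + \<mu> *\<^sub>R y)) y - 0) +
        (- (inverse \<mu> ^ Suc (Suc 0))) *\<^sub>R (\<phi> (p + \<mu> *\<^sub>R y) - \<phi> p)) (at \<mu>)"
      by (intro has_vector_derivative_scaleR 2 has_vector_derivative_diff 1 has_vector_derivative_const)
    then have 3: "((\<lambda>\<mu>. inverse \<mu> *\<^sub>R (\<phi> (p + \<mu> *\<^sub>R y) - \<phi> p)) has_vector_derivative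
         (blinfun_apply (\<phi>' (p + fst (\<mu>, y) *\<^sub>R snd (\<mu>, y))) (snd (\<mu>, y))) /\<^sub>R fst (\<mu>, y)
            - (\<phi> (p + fst (\<mu>, y) *\<^sub>R snd (\<mu>, y)) - \<phi> p) /\<^sub>R (fst (\<mu>, y))^2) (at \<mu>)"
      by (simp add: power2_eq_square power_inverse)
    show "((\<lambda>\<mu>. divdiff \<phi> p (\<mu>, y)) has_vector_derivative
         (blinfun_apply (\<phi>' (p + fst (\<mu>, y) *\<^sub>R snd (\<mu>, y))) (snd (\<mu>, y))) /\<^sub>R fst (\<mu>, y)
            - (\<phi> (p + fst (\<mu>, y) *\<^sub>R snd (\<mu>, y)) - \<phi> p) /\<^sub>R (fst (\<mu>, y))^2) (at \<mu>)"
      by (rule has_vector_derivative_transform_within_open[OF 3, of "{0<..}"])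
        (use m in \<open>auto simp: divdiff_def\<close>)
  qed
qed

lemma param_C1_shift:
  assumes "C1_map \<phi>"
  shows "param_C1 (\<lambda>q. \<phi> (p + fst q *\<^sub>R snd q))"
proof -
  have "param_C1 (\<lambda>q. \<phi> p + fst q *\<^sub>R divdiff \<phi> p q)"
    by (intro param_C1_add param_C1_const param_C1_bilinear[OF bounded_bilinear_scaleR] param_C1_fst
        param_C1_divdiff assms)
  moreover have "\<phi> p + fst q *\<^sub>R divdiff \<phi> p q = \<phi> (p + fst q *\<^sub>R snd q)" for q
    using divdiff_eq[of "fst q" \<phi> p "snd q"] by simp
  ultimately show ?thesis by simp
qed

text \<open>The fixed points of \<open>v - B (F (\<mu>, v))\<close>, with B inverse to
  \<open>dF\<close>, are the zeros of F. Continuity of the y-derivative up to \<mu> = 0 makes these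
  maps contractions on one ball of radius r for all small \<mu> at once, so uniqueness holds in a
  ball that does not shrink with \<mu>. Differentiability of y in \<mu> is claimed, and proved, only
  for \<mu> > 0.\<close>

lemma param_implicit_function:
  fixes F :: "real \<times> 'a::euclidean_space \<Rightarrow> 'a"
  assumes F: "param_C1 F" and F0: "F (0, y0) = 0"
    and dF: "((\<lambda>y. F (0, y)) has_derivative dF) (at y0)"
    and inj: "\<And>v. dF v = 0 \<Longrightarrow> v = 0"
  obtains \<delta> r y where "\<delta> > 0" "r > 0"
    "\<And>\<mu>. \<mu> \<in> {0<..<\<delta>} \<Longrightarrow> F (\<mu>, y \<mu>) = 0"
    "\<And>\<mu> v. \<lbrakk>\<mu> \<in> {0<..<\<delta>}; v \<in> cball y0 r; F (\<mu>, v) = 0\<rbrakk> \<Longrightarrow> v = y \<mu>"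
    "y C1_differentiable_on {0<..<\<delta>}" "(y \<longlongrightarrow> y0) (at_right 0)"
proof -
  obtain F1 F2 where Fd: "\<And>\<mu> y. \<mu> \<ge> 0 \<Longrightarrow> ((\<lambda>y. F (\<mu>, y)) has_derivative blinfun_apply (F1 (\<mu>, y))) (at y)"
    and Fc: "continuous_on ({0..} \<times> UNIV) F" and F1c: "continuous_on ({0..} \<times> UNIV) F1"
    and F\<mu>: "\<And>\<mu> y. \<mu> > 0 \<Longrightarrow> ((\<lambda>\<mu>. F (\<mu>, y)) has_vector_derivative F2 (\<mu>, y)) (at \<mu>)"
    and F2c: "continuous_on ({0<..} \<times> UNIV) F2" using F unfolding param_C1_def by blast
  have F10: "blinfun_apply (F1 (0, y0)) = dF"
    using has_derivative_unique[OF Fd[of 0 y0] dF] by simp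
  have lin: "linear dF" using dF by (simp add: has_derivative_linear)
  have injd: "inj dF" using lin inj by (simp add: linear_injective_0)
  obtain B0 where B0: "linear B0" "B0 \<circ> dF = id"
    using linear_injective_left_inverse[OF lin injd] by blast
  define B where "B = Blinfun B0"
  have Bap: "blinfun_apply B = B0"
    unfolding B_def using B0(1) by (simp add: bounded_linear_Blinfun_apply linear_conv_bounded_linear)
  have BF: "blinfun_apply B (dF v) = v" for v
    using fun_cong[OF B0(2), of v] by (simp add: Bap)
  have B_inj: "x = 0" if "blinfun_apply B x = 0" for x
  proof -
    obtain v where v: "x = dF v" using linear_injective_imp_surjective[OF lin injd refl] by (rule surjE)
    then have "v = 0" using that BF[of v] by simp
    then show ?thesis using v linear_0[OF lin] by simp
  qed
  \<comment> \<open>The bound 1/2 on K serves twice: it is the contraction constant, and it makes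
    \<open>F1\<close> injective with a uniform estimate (\<open>inv1\<close>).\<close>
  define K where "K q = id_blinfun - (B o\<^sub>L F1 q)" for q
  have Kc: "continuous_on ({0..} \<times> UNIV) K"
    unfolding K_def by (intro continuous_intros F1c bounded_bilinear.continuous_on[OF bounded_bilinear_blinfun_compose])
  have K0: "K (0, y0) = 0"
    unfolding K_def by (rule blinfun_eqI) (simp add: blinfun.bilinear_simps F10 BF)
  obtain d where d: "d > 0" "\<And>q. q \<in> {0..} \<times> UNIV \<Longrightarrow> dist q (0, y0) < d \<Longrightarrow> norm (K q) < 1/2"
    using Kc[unfolded continuous_on_iff, rule_format, of "(0, y0)" "1/2"] K0 by auto
  define r where "r = d/2"
  have r: "r > 0" using d by (simp add: r_def)
  have "((\<lambda>\<mu>. F (\<mu>, y0)) \<longlongrightarrow> F (0, y0)) (at 0 within {0..})"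
  proof -
    have "continuous_on {0..} (\<lambda>\<mu>. F (\<mu>, y0))"
      by (rule continuous_on_compose2[OF Fc]) (auto intro!: continuous_intros)
    then show ?thesis by (simp add: continuous_on_def)
  qed
  then have BF0: "((\<lambda>\<mu>. blinfun_apply B (F (\<mu>, y0))) \<longlongrightarrow> 0) (at 0 within {0..})"
    by (auto intro!: tendsto_eq_intros simp: F0)
  have "\<forall>\<^sub>F \<mu> in at 0 within {0..}. dist (blinfun_apply B (F (\<mu>, y0))) 0 < r/2"
    by (rule tendstoD[OF BF0]) (use r in simp)
  then obtain d' where d': "d' > 0" "\<And>\<mu>. \<mu> > 0 \<Longrightarrow> \<mu> < d' \<Longrightarrow> norm (blinfun_apply B (F (\<mu>, y0))) < r/2"
    unfolding eventually_at by (auto simp: dist_real_def)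
  define \<delta> where "\<delta> = min d' (d/2)"
  have \<delta>: "\<delta> > 0" using d d' by (simp add: \<delta>_def)
  have Kb: "norm (K (\<mu>, v)) < 1/2" if "0 \<le> \<mu>" "\<mu> < \<delta>" "v \<in> cball y0 r" for \<mu> v
  proof (rule d(2))
    have "dist (\<mu>, v) (0, y0) \<le> norm (\<mu> - 0) + norm (v - y0)"
      using norm_Pair_le[of "\<mu> - 0" "v - y0"] by (simp add: dist_norm)
    also have "\<dots> < d" using that by (auto simp: \<delta>_def r_def dist_norm norm_minus_commute)
    finally show "dist (\<mu>, v) (0, y0) < d" .
  qed (use that in auto)
  have inv1: "norm u \<le> 2 * norm (blinfun_apply B (blinfun_apply (F1 (\<mu>, v)) u))"
    if "0 \<le> \<mu>" "\<mu> < \<delta>" "v \<in> cball y0 r" for \<mu> v u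
  proof -
    have "norm (u - blinfun_apply B (blinfun_apply (F1 (\<mu>, v)) u)) = norm (blinfun_apply (K (\<mu>, v)) u)"
      by (simp add: K_def blinfun.bilinear_simps)
    also have "\<dots> \<le> norm (K (\<mu>, v)) * norm u" by (rule norm_blinfun)
    also have "\<dots> \<le> 1/2 * norm u" using Kb[OF that] by (intro mult_right_mono) auto
    finally show ?thesis using norm_triangle_sub[of u "blinfun_apply B (blinfun_apply (F1 (\<mu>, v)) u)"] by linarith
  qed
  let ?T = "\<lambda>\<mu> v. v - blinfun_apply B (F (\<mu>, v))"
  have lip: "norm (?T \<mu> u - ?T \<mu> v) \<le> 1/2 * norm (u - v)"
    if m: "0 \<le> \<mu>" "\<mu> < \<delta>" and "u \<in> cball y0 r" "v \<in> cball y0 r" for \<mu> u v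
  proof (rule differentiable_bound[OF convex_cball])
    fix x assume x: "x \<in> cball y0 r"
    have "((\<lambda>v. v - blinfun_apply B (F (\<mu>, v))) has_derivative
        (\<lambda>u. u - blinfun_apply B (blinfun_apply (F1 (\<mu>, x)) u))) (at x)"
      by (intro derivative_intros bounded_linear.has_derivative[OF blinfun.bounded_linear_right] Fd m)
    then show "(?T \<mu> has_derivative blinfun_apply (K (\<mu>, x))) (at x within cball y0 r)"
      by (simp add: K_def minus_blinfun.rep_eq has_derivative_at_withinI)
    show "onorm (blinfun_apply (K (\<mu>, x))) \<le> 1/2"
      using Kb[OF m x] by (simp add: norm_blinfun.rep_eq)
  qed (use that in auto)
  \<comment> \<open>The contraction read backwards: \<open>B \<circ> F\<close> shrinks distances at
    most by the factor 1/2. Uniqueness, the limit at 0 and continuity of y all follow from this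
    inequality.\<close>
  have E: "norm (u - v) \<le> 2 * norm (blinfun_apply B (F (\<mu>, u)) - blinfun_apply B (F (\<mu>, v)))"
    if "0 \<le> \<mu>" "\<mu> < \<delta>" "u \<in> cball y0 r" "v \<in> cball y0 r" for \<mu> u v
  proof -
    have "norm ((u - v) - (blinfun_apply B (F (\<mu>, u)) - blinfun_apply B (F (\<mu>, v)))) \<le> 1/2 * norm (u - v)"
      using lip[OF that] by (simp add: algebra_simps)
    then show ?thesis
      using norm_triangle_sub[of "u - v" "blinfun_apply B (F (\<mu>, u)) - blinfun_apply B (F (\<mu>, v))"] by linarith
  qed
  have ex: "\<exists>v. v \<in> cball y0 r \<and> F (\<mu>, v) = 0" if m: "0 < \<mu>" "\<mu> < \<delta>" for \<mu>
  proof -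
    have "\<exists>!v\<in>cball y0 r. ?T \<mu> v = v"
    proof (rule Banach_fix[where c="1/2"])
      show "complete (cball y0 r)" by (simp add: complete_eq_closed)
      show "cball y0 r \<noteq> {}" using r by auto
      show "dist (?T \<mu> u) (?T \<mu> v) \<le> 1/2 * dist u v" if "u \<in> cball y0 r" "v \<in> cball y0 r" for u v
        using lip[of \<mu> u v] m that by (simp add: dist_norm)
      show "?T \<mu> ` cball y0 r \<subseteq> cball y0 r"
      proof (rule image_subsetI)
        fix v assume v: "v \<in> cball y0 r"
        have "norm (?T \<mu> v - ?T \<mu> y0) \<le> 1/2 * norm (v - y0)"
          using lip[of \<mu> v y0] m v r by auto
        moreover have "norm (?T \<mu> y0 - y0) < r/2"
          using d'(2)[of \<mu>] m by (simp add: \<delta>_def)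
        moreover have "norm (v - y0) \<le> r" using v by (simp add: dist_norm norm_minus_commute)
        ultimately have "norm (?T \<mu> v - y0) \<le> r"
          using norm_triangle_ineq[of "?T \<mu> v - ?T \<mu> y0" "?T \<mu> y0 - y0"] by (simp add: algebra_simps)
        then show "?T \<mu> v \<in> cball y0 r" by (simp add: dist_norm norm_minus_commute)
      qed
    qed auto
    then obtain v where "v \<in> cball y0 r" "?T \<mu> v = v" by auto
    then show ?thesis using B_inj[of "F (\<mu>, v)"] by auto
  qed
  define y where "y \<mu> = (SOME v. v \<in> cball y0 r \<and> F (\<mu>, v) = 0)" for \<mu>
  have y: "y \<mu> \<in> cball y0 r" "F (\<mu>, y \<mu>) = 0" if "0 < \<mu>" "\<mu> < \<delta>" for \<mu>
    using someI_ex[OF ex[OF that]] by (auto simp: y_def)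
  have uniq: "v = y \<mu>" if "0 < \<mu>" "\<mu> < \<delta>" "v \<in> cball y0 r" "F (\<mu>, v) = 0" for \<mu> v
    using E[of \<mu> v "y \<mu>"] y[of \<mu>] that by auto
  have ylim: "(y \<longlongrightarrow> y0) (at_right 0)"
  proof -
    have "((\<lambda>\<mu>. 2 * norm (blinfun_apply B (F (\<mu>, y0)))) \<longlongrightarrow> 0) (at_right 0)"
    proof -
      have "((\<lambda>\<mu>. blinfun_apply B (F (\<mu>, y0))) \<longlongrightarrow> 0) (at_right 0)"
        by (rule tendsto_within_subset[OF BF0]) auto
      from tendsto_mult[OF tendsto_const[of 2] tendsto_norm[OF this]] show ?thesis by simp
    qed
    moreover have "\<forall>\<^sub>F \<mu> in at_right 0. norm (y \<mu> - y0) \<le> 2 * norm (blinfun_apply B (F (\<mu>, y0)))"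
      unfolding eventually_at_right_field
    proof (intro exI[of _ \<delta>] conjI allI impI \<delta>)
      fix \<mu> assume "0 < \<mu>" "\<mu> < \<delta>"
      then show "norm (y \<mu> - y0) \<le> 2 * norm (blinfun_apply B (F (\<mu>, y0)))"
        using E[of \<mu> "y \<mu>" y0] y[of \<mu>] r by simp
    qed
    ultimately have "((\<lambda>\<mu>. y \<mu> - y0) \<longlongrightarrow> 0) (at_right 0)"
      by (rule Lim_null_comparison[rotated])
    then show ?thesis by (simp add: LIM_zero_iff)
  qed
  have yc: "(y \<longlongrightarrow> y \<nu>) (at \<nu>)" if \<nu>: "0 < \<nu>" "\<nu> < \<delta>" for \<nu>
  proof -
    have "isCont (\<lambda>\<mu>. F (\<mu>, y \<nu>)) \<nu>"
      using F\<mu>[OF \<nu>(1)] has_vector_derivative_continuous by blast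
    then have "((\<lambda>\<mu>. F (\<mu>, y \<nu>)) \<longlongrightarrow> F (\<nu>, y \<nu>)) (at \<nu>)" by (simp add: isCont_def)
    then have "((\<lambda>\<mu>. 2 * norm (blinfun_apply B (F (\<mu>, y \<nu>)))) \<longlongrightarrow> 0) (at \<nu>)"
      by (auto intro!: tendsto_eq_intros simp: y \<nu>)
    moreover have "\<forall>\<^sub>F \<mu> in at \<nu>. norm (y \<mu> - y \<nu>) \<le> 2 * norm (blinfun_apply B (F (\<mu>, y \<nu>)))"
    proof -
      have "\<forall>\<^sub>F \<mu> in at \<nu>. \<mu> \<in> {0<..<\<delta>}" by (rule eventually_at_in_open') (use \<nu> in auto)
      then show ?thesis
      proof eventually_elim
        case (elim \<mu>)
        then show ?case using E[of \<mu> "y \<mu>" "y \<nu>"] y[of \<mu>] y[of \<nu>] \<nu> by simp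
      qed
    qed
    ultimately have "((\<lambda>\<mu>. y \<mu> - y \<nu>) \<longlongrightarrow> 0) (at \<nu>)"
      by (rule Lim_null_comparison[rotated])
    then show ?thesis by (simp add: LIM_zero_iff)
  qed
  have "\<exists>v. blinfun_apply (F1 (\<mu>, y \<mu>)) v = - F2 (\<mu>, y \<mu>)" if "0 < \<mu>" "\<mu> < \<delta>" for \<mu>
  proof -
    have "inj (blinfun_apply (F1 (\<mu>, y \<mu>)))"
      unfolding linear_injective_0[OF bounded_linear.linear[OF blinfun.bounded_linear_right]]
    proof (intro allI impI)
      fix u assume "blinfun_apply (F1 (\<mu>, y \<mu>)) u = 0"
      then show "u = 0" using inv1[of \<mu> "y \<mu>" u] that y[OF that] by simp
    qed
    from linear_injective_imp_surjective[OF bounded_linear.linear[OF blinfun.bounded_linear_right] this refl] show ?thesis by (metis surjE)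
  qed
  \<comment> \<open>The candidate derivative, from differentiating
    \<open>F (\<mu>, y \<mu>) = 0\<close>.\<close>
  then obtain D where D: "\<And>\<mu>. 0 < \<mu> \<Longrightarrow> \<mu> < \<delta> \<Longrightarrow> blinfun_apply (F1 (\<mu>, y \<mu>)) (D \<mu>) = - F2 (\<mu>, y \<mu>)"
    by metis
  have sub: "({0<..} \<times> UNIV :: (real \<times> 'a) set) \<subseteq> {0..} \<times> UNIV" by auto
  have opn: "open ({0<..} \<times> UNIV :: (real \<times> 'a) set)" by (intro open_Times) auto
  have F1i: "isCont F1 (\<nu>, v)" if "0 < \<nu>" for \<nu> v
    using continuous_on_subset[OF F1c sub] opn that by (simp add: continuous_on_eq_continuous_at)
  have F2i: "isCont F2 (\<nu>, v)" if "0 < \<nu>" for \<nu> v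
    using F2c opn that by (simp add: continuous_on_eq_continuous_at)
  have der: "(y has_vector_derivative D \<nu>) (at \<nu>)" if \<nu>: "0 < \<nu>" "\<nu> < \<delta>" for \<nu>
  proof -
    let ?f = "blinfun_apply (F1 (\<nu>, y \<nu>))"
    have J: "((\<lambda>(s, v). F (s, v)) has_derivative (\<lambda>(ts, tv). ts *\<^sub>R F2 (\<nu>, y \<nu>) + ?f tv))
        (at (\<nu>, y \<nu>) within {0<..} \<times> UNIV)"
    proof (rule has_derivative_partialsI[where fy="\<lambda>s v. F1 (s, v)"])
      show "((\<lambda>s. F (s, y \<nu>)) has_derivative (\<lambda>ts. ts *\<^sub>R F2 (\<nu>, y \<nu>))) (at \<nu> within {0<..})"
        using F\<mu>[OF \<nu>(1), of "y \<nu>"] by (simp add: has_vector_derivative_def has_derivative_at_withinI)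
      show "((\<lambda>v. F (s, v)) has_derivative blinfun_apply (F1 (s, v))) (at v within UNIV)"
        if "s \<in> {0<..}" for s v using Fd[of s v] that by simp
      have "(F1 \<longlongrightarrow> F1 (\<nu>, y \<nu>)) (at (\<nu>, y \<nu>) within {0<..} \<times> UNIV)"
        using F1i[OF \<nu>(1), of "y \<nu>"] tendsto_within_subset by (fastforce simp: isCont_def)
      then show "continuous (at (\<nu>, y \<nu>) within {0<..} \<times> UNIV) (\<lambda>(s, v). F1 (s, v))"
        by (simp add: continuous_within)
    qed auto
    then have J: "(F has_derivative (\<lambda>(ts, tv). ts *\<^sub>R F2 (\<nu>, y \<nu>) + ?f tv)) (at (\<nu>, y \<nu>))"
      using at_within_open[OF _ opn, of "(\<nu>, y \<nu>)"] \<nu> by simp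
    define b where "b = norm B"
    have b: "b \<ge> 0" by (simp add: b_def)
    have "(y has_derivative (\<lambda>t. t *\<^sub>R D \<nu>)) (at \<nu>)"
      unfolding has_derivative_at_alt
    proof (intro conjI allI impI)
      show "bounded_linear (\<lambda>t. t *\<^sub>R D \<nu>)" by (rule bounded_linear_scaleR_left)
      fix \<epsilon> :: real assume \<epsilon>: "\<epsilon> > 0"
      \<comment> \<open>Large enough to dominate both \<open>2 * b\<close> and
        \<open>2 * b * (1 + norm (D \<nu>))\<close>; the summand 1 keeps it positive when
        \<open>b = 0\<close>.\<close>
      define c where "c = 2 * b * (2 + norm (D \<nu>)) + 1"
      have c: "c \<ge> 1" using b by (simp add: c_def)
      define e where "e = min (1/2) (\<epsilon>/2) / c"
      have e: "e > 0" using \<epsilon> c by (simp add: e_def)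
      \<comment> \<open>The first bound absorbs half of \<open>norm z\<close> into the left-hand
        side, the second leaves \<open>\<epsilon>/2 * t\<close> on the right; together they give
        \<open>norm z \<le> \<epsilon> * t\<close>.\<close>
      have ec: "e * c \<le> 1/2" "e * c \<le> \<epsilon>/2" using c by (auto simp: e_def)
      obtain d1 where d1: "d1 > 0" "\<And>q. norm (q - (\<nu>, y \<nu>)) < d1 \<Longrightarrow>
          norm (F q - F (\<nu>, y \<nu>) - (case q - (\<nu>, y \<nu>) of (ts, tv) \<Rightarrow> ts *\<^sub>R F2 (\<nu>, y \<nu>) + ?f tv))
            \<le> e * norm (q - (\<nu>, y \<nu>))"
        using J[unfolded has_derivative_at_alt, THEN conjunct2, rule_format, OF e] by blast
      have "\<forall>\<^sub>F \<mu> in at \<nu>. dist (y \<mu>) (y \<nu>) < d1/2"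
        by (rule tendstoD[OF yc[OF \<nu>]]) (use d1 in simp)
      then obtain d2 where d2: "d2 > 0" "\<And>\<mu>. \<mu> \<noteq> \<nu> \<Longrightarrow> dist \<mu> \<nu> < d2 \<Longrightarrow> dist (y \<mu>) (y \<nu>) < d1/2"
        unfolding eventually_at by auto
      define d3 where "d3 = Min {d1/2, d2, \<nu>, \<delta> - \<nu>}"
      have d3: "d3 > 0" "d3 \<le> d1/2" "d3 \<le> d2" "d3 \<le> \<nu>" "d3 \<le> \<delta> - \<nu>"
        using d1(1) d2(1) \<nu> by (auto simp: d3_def min_def)
      show "\<exists>d>0. \<forall>\<mu>. norm (\<mu> - \<nu>) < d \<longrightarrow> norm (y \<mu> - y \<nu> - (\<mu> - \<nu>) *\<^sub>R D \<nu>) \<le> \<epsilon> * norm (\<mu> - \<nu>)"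
      proof (intro exI[of _ d3] conjI allI impI d3)
        fix \<mu> :: real assume m: "norm (\<mu> - \<nu>) < d3"
        have m': "0 < \<mu>" "\<mu> < \<delta>" using m d3 by auto
        define t where "t = norm (\<mu> - \<nu>)"
        define z where "z = y \<mu> - y \<nu> - (\<mu> - \<nu>) *\<^sub>R D \<nu>"
        have "norm (y \<mu> - y \<nu>) < d1/2"
          using d2(2)[of \<mu>] m d3 d1 by (cases "\<mu> = \<nu>") (auto simp: dist_norm)
        then have "norm ((\<mu>, y \<mu>) - (\<nu>, y \<nu>)) < d1"
          using m d3 norm_Pair_le[of "\<mu> - \<nu>" "y \<mu> - y \<nu>"] by auto
        from d1(2)[OF this] have "norm ((\<mu> - \<nu>) *\<^sub>R F2 (\<nu>, y \<nu>) + ?f (y \<mu> - y \<nu>))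
            \<le> e * norm (\<mu> - \<nu>, y \<mu> - y \<nu>)"
          using y(2)[OF m'] y(2)[OF \<nu>]
            norm_minus_cancel[of "(\<mu> - \<nu>) *\<^sub>R F2 (\<nu>, y \<nu>) + ?f (y \<mu> - y \<nu>)"] by simp
        also have "(\<mu> - \<nu>) *\<^sub>R F2 (\<nu>, y \<nu>) + ?f (y \<mu> - y \<nu>) = ?f z"
          using D[OF \<nu>] by (simp add: z_def blinfun.bilinear_simps)
        also have "e * norm (\<mu> - \<nu>, y \<mu> - y \<nu>) \<le> e * (t + norm (y \<mu> - y \<nu>))"
          using e norm_Pair_le[of "\<mu> - \<nu>" "y \<mu> - y \<nu>"] by (simp add: t_def)
        also have "norm (y \<mu> - y \<nu>) \<le> norm z + t * norm (D \<nu>)"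
          using norm_triangle_ineq[of z "(\<mu> - \<nu>) *\<^sub>R D \<nu>"] by (simp add: z_def t_def)
        finally have f: "norm (?f z) \<le> e * (t + (norm z + t * norm (D \<nu>)))" using e by simp
        have "norm z \<le> 2 * norm (blinfun_apply B (?f z))"
          by (rule inv1) (use \<nu> y in auto)
        also have "norm (blinfun_apply B (?f z)) \<le> b * norm (?f z)"
          unfolding b_def by (rule norm_blinfun)
        also have "\<dots> \<le> b * (e * (t + (norm z + t * norm (D \<nu>))))"
          using f b by (rule mult_left_mono)
        finally have "norm z \<le> (e * (2 * b)) * norm z + (e * (2 * b * (1 + norm (D \<nu>)))) * t"
          by (simp add: algebra_simps)
        moreover have "e * (2 * b) \<le> 1/2"
        proof -
          have "2 * b \<le> c" using mult_left_mono[of 1 "2 + norm (D \<nu>)" "2*b"] b by (simp add: c_def)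
          then show ?thesis using ec(1) e mult_left_mono[of "2 * b" c e] by linarith
        qed
        then have "(e * (2 * b)) * norm z \<le> 1/2 * norm z" by (rule mult_right_mono) simp
        moreover have "e * (2 * b * (1 + norm (D \<nu>))) \<le> \<epsilon>/2"
        proof -
          have "2 * b * (1 + norm (D \<nu>)) \<le> c" using b by (simp add: c_def algebra_simps)
          then show ?thesis using ec(2) e mult_left_mono[of "2 * b * (1 + norm (D \<nu>))" c e] by linarith
        qed
        then have "(e * (2 * b * (1 + norm (D \<nu>)))) * t \<le> \<epsilon>/2 * t" by (rule mult_right_mono) (simp add: t_def)
        ultimately have "norm z \<le> \<epsilon> * t" by linarith
        then show "norm (y \<mu> - y \<nu> - (\<mu> - \<nu>) *\<^sub>R D \<nu>) \<le> \<epsilon> * norm (\<mu> - \<nu>)" by (simp add: z_def t_def)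
      qed
    qed
    then show ?thesis by (simp add: has_vector_derivative_def)
  qed
  have Dc: "continuous_on {0<..<\<delta>} D"
  proof (rule continuous_at_imp_continuous_on, rule ballI)
    fix \<nu> assume "\<nu> \<in> {0<..<\<delta>}"
    then have \<nu>: "0 < \<nu>" "\<nu> < \<delta>" by auto
    have yq: "((\<lambda>\<mu>. (\<mu>, y \<mu>)) \<longlongrightarrow> (\<nu>, y \<nu>)) (at \<nu>)" by (intro tendsto_intros yc \<nu>)
    have "((\<lambda>\<mu>. F1 (\<mu>, y \<mu>)) \<longlongrightarrow> F1 (\<nu>, y \<nu>)) (at \<nu>)" "((\<lambda>\<mu>. F2 (\<mu>, y \<mu>)) \<longlongrightarrow> F2 (\<nu>, y \<nu>)) (at \<nu>)"
      using isCont_tendsto_compose[OF F1i yq] isCont_tendsto_compose[OF F2i yq] \<nu> by auto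
    then have "((\<lambda>\<mu>. 2 * norm (blinfun_apply B (- F2 (\<mu>, y \<mu>) - blinfun_apply (F1 (\<mu>, y \<mu>)) (D \<nu>))))
        \<longlongrightarrow> 2 * norm (blinfun_apply B (- F2 (\<nu>, y \<nu>) - blinfun_apply (F1 (\<nu>, y \<nu>)) (D \<nu>)))) (at \<nu>)"
      by (intro tendsto_intros)
    then have "((\<lambda>\<mu>. 2 * norm (blinfun_apply B (- F2 (\<mu>, y \<mu>) - blinfun_apply (F1 (\<mu>, y \<mu>)) (D \<nu>)))) \<longlongrightarrow> 0) (at \<nu>)"
      using D[OF \<nu>] by simp
    moreover have "\<forall>\<^sub>F \<mu> in at \<nu>. norm (D \<mu> - D \<nu>) \<le> 2 * norm (blinfun_apply B (- F2 (\<mu>, y \<mu>) - blinfun_apply (F1 (\<mu>, y \<mu>)) (D \<nu>)))"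
    proof -
      have "\<forall>\<^sub>F \<mu> in at \<nu>. \<mu> \<in> {0<..<\<delta>}" by (rule eventually_at_in_open') (use \<nu> in auto)
      then show ?thesis
      proof eventually_elim
        case (elim \<mu>)
        then show ?case
          using inv1[of \<mu> "y \<mu>" "D \<mu> - D \<nu>"] y[of \<mu>] D[of \<mu>] by (simp add: blinfun.bilinear_simps)
      qed
    qed
    ultimately have "((\<lambda>\<mu>. D \<mu> - D \<nu>) \<longlongrightarrow> 0) (at \<nu>)"
      by (rule Lim_null_comparison[rotated])
    then show "isCont D \<nu>" by (simp add: LIM_zero_iff isCont_def)
  qed
  show thesis
  proof (rule that[OF \<delta> r _ _ _ ylim])
    show "y C1_differentiable_on {0<..<\<delta>}"
      unfolding C1_differentiable_on_def using der Dc by (intro exI[of _ D]) auto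
  qed (use y uniq in auto)
qed

section \<open>The blown-up central path equations\<close>

lemma C1_map_has_derivative:
  "C1_map \<phi> \<Longrightarrow> (\<phi> has_derivative frechet_derivative \<phi> (at x)) (at x)"
  unfolding C1_map_def by (metis frechet_derivative_works differentiableI)

lemma C1_map_bounded_linear: "C1_map \<phi> \<Longrightarrow> bounded_linear (frechet_derivative \<phi> (at x))"
  using C1_map_has_derivative has_derivative_bounded_linear by blast

lemma frechet_partial_sum:
  fixes \<phi> :: "real^'n \<Rightarrow> 'b::real_normed_vector"
  assumes "C1_map \<phi>"
  shows "frechet_derivative \<phi> (at x) d = (\<Sum>i\<in>UNIV. (d $ i) *\<^sub>R partial_deriv i \<phi> x)"
proof -
  interpret bounded_linear "frechet_derivative \<phi> (at x)" by (rule C1_map_bounded_linear[OF assms])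
  have "d = (\<Sum>i\<in>UNIV. d $ i *\<^sub>R axis i 1)"
    by (auto simp: vec_eq_iff axis_def if_distrib if_distribR cong: if_cong)
  then have "frechet_derivative \<phi> (at x) d = frechet_derivative \<phi> (at x) (\<Sum>i\<in>UNIV. d $ i *\<^sub>R axis i 1)" by simp
  then show ?thesis by (simp add: sum scale partial_deriv_def)
qed

lemma frechet_derivative_symmetric:
  fixes G :: "'a::real_normed_vector \<Rightarrow> real^'m^'m"
  assumes G: "C1_map G" and sym: "\<And>x. transpose (G x) = G x"
  shows "transpose (frechet_derivative G (at x) d) = frechet_derivative G (at x) d"
proof -
  have 1: "(G has_derivative frechet_derivative G (at x)) (at x)" by (rule C1_map_has_derivative[OF G])
  have "((\<lambda>x. transpose (G x)) has_derivative (\<lambda>d. transpose (frechet_derivative G (at x) d))) (at x)"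
    by (rule bounded_linear.has_derivative[OF bounded_linear_transpose 1])
  then have "(G has_derivative (\<lambda>d. transpose (frechet_derivative G (at x) d))) (at x)" by (simp add: sym)
  from has_derivative_unique[OF this 1] show ?thesis by (rule fun_cong)
qed

lemma has_derivative_vec:
  fixes a :: "'i::finite \<Rightarrow> 'a::real_normed_vector \<Rightarrow> real"
  assumes "\<And>i. (a i has_derivative a' i) F"
  shows "((\<lambda>y. \<chi> i. a i y) has_derivative (\<lambda>v. \<chi> i. a' i v)) F"
proof -
  have *: "(\<lambda>y. \<chi> i. b i y) = (\<lambda>y. \<Sum>i\<in>UNIV. b i y *\<^sub>R axis i 1)" for b :: "'i \<Rightarrow> 'a \<Rightarrow> real"
    by (auto simp: vec_eq_iff axis_def if_distrib if_distribR cong: if_cong)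
  show ?thesis unfolding *
    by (intro has_derivative_sum has_derivative_scaleR_left assms)
qed

text \<open>The scale \<rho> is not tied to the distance of x from p; the limit \<eta> may be 0, as
  long as the quotients converge.\<close>

lemma difference_quotient_tendsto:
  fixes \<phi> :: "'a::real_normed_vector \<Rightarrow> 'b::real_normed_vector"
  assumes d: "(\<phi> has_derivative \<phi>') (at p)" and x: "x \<longlonglongrightarrow> p" and \<rho>: "\<And>k. \<rho> k > 0"
    and \<eta>: "(\<lambda>k. (x k - p) /\<^sub>R \<rho> k) \<longlonglongrightarrow> \<eta>"
  shows "(\<lambda>k. (\<phi> (x k) - \<phi> p) /\<^sub>R \<rho> k) \<longlonglongrightarrow> \<phi>' \<eta>"
proof -
  interpret bounded_linear \<phi>' using d by (rule has_derivative_bounded_linear)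
  let ?E = "\<lambda>k. (\<phi> (x k) - \<phi> p) /\<^sub>R \<rho> k - \<phi>' ((x k - p) /\<^sub>R \<rho> k)"
  have E: "?E \<longlonglongrightarrow> 0"
  proof (rule tendstoI)
    fix \<epsilon> :: real assume \<epsilon>: "\<epsilon> > 0"
    define e where "e = \<epsilon> / (norm \<eta> + 1)"
    have e: "e > 0" unfolding e_def using \<epsilon> by (simp add: add_nonneg_pos)
    obtain dl where dl: "dl > 0" "\<And>y. norm (y - p) < dl \<Longrightarrow> norm (\<phi> y - \<phi> p - \<phi>' (y - p)) \<le> e * norm (y - p)"
      using d[unfolded has_derivative_at_alt, THEN conjunct2, rule_format, OF e] by blast
    have "\<forall>\<^sub>F k in sequentially. dist (x k) p < dl" by (rule tendstoD[OF x dl(1)])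
    moreover have "\<forall>\<^sub>F k in sequentially. norm ((x k - p) /\<^sub>R \<rho> k) < norm \<eta> + 1"
      by (rule order_tendstoD(2)[OF tendsto_norm[OF \<eta>]]) simp
    ultimately show "\<forall>\<^sub>F k in sequentially. dist (?E k) 0 < \<epsilon>"
    proof eventually_elim
      case (elim k)
      have "?E k = (\<phi> (x k) - \<phi> p - \<phi>' (x k - p)) /\<^sub>R \<rho> k"
        unfolding scale by (simp only: scaleR_diff_right)
      then have "norm (?E k) = norm (\<phi> (x k) - \<phi> p - \<phi>' (x k - p)) / \<rho> k"
        using \<rho>[of k] by (simp add: divide_inverse_commute)
      also have "\<dots> \<le> e * norm (x k - p) / \<rho> k"
        using dl(2)[of "x k"] elim \<rho>[of k] by (intro divide_right_mono) (auto simp: dist_norm)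
      also have "\<dots> = e * norm ((x k - p) /\<^sub>R \<rho> k)"
        using \<rho>[of k] by (simp add: divide_inverse_commute)
      also have "\<dots> < e * (norm \<eta> + 1)" using elim e by simp
      also have "\<dots> = \<epsilon>" unfolding e_def using norm_ge_zero[of \<eta>] by (simp add: add_nonneg_eq_0_iff)
      finally show ?case by simp
    qed
  qed
  from tendsto_add[OF E tendsto[OF \<eta>]] show ?thesis by simp
qed

text \<open>A finite-dimensional Lax-Milgram argument, with no symmetry of q. Instead of restricting
  to U, the operator \<open>\<pi> b \<pi>\<close> is completed by the identity on the orthogonal
  complement; testing with \<open>\<pi> x\<close> shows that the result is injective on the whole
  space, hence onto.\<close>

lemma positive_on_subspace_solvable:
  fixes U :: "'a::euclidean_space set"
  assumes U: "subspace U" and q: "bilinear q" and pos: "\<And>u. u \<in> U \<Longrightarrow> u \<noteq> 0 \<Longrightarrow> 0 < q u u"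
    and c: "linear c"
  obtains u where "u \<in> U" "\<And>v. v \<in> U \<Longrightarrow> q v u = (c v :: real)"
proof -
  obtain \<pi> where \<pi>: "linear \<pi>" "\<And>x. \<pi> x \<in> U" "\<And>x u. u \<in> U \<Longrightarrow> inner u (x - \<pi> x) = 0"
    using orthogonal_projection_exists[OF U] by blast
  have rep: "inner v (\<Sum>i\<in>Basis. \<phi> i *\<^sub>R i) = \<phi> v" if "linear \<phi>" for \<phi> :: "'a \<Rightarrow> real" and v
  proof -
    have "\<phi> v = \<phi> (\<Sum>i\<in>Basis. (v \<bullet> i) *\<^sub>R i)" by (simp add: euclidean_representation)
    also have "\<dots> = (\<Sum>i\<in>Basis. (v \<bullet> i) * \<phi> i)" using that by (simp add: linear_sum linear_scale)
    finally show ?thesis by (simp add: inner_sum_right mult.commute)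
  qed
  define b where "b y = (\<Sum>i\<in>Basis. q i y *\<^sub>R i)" for y
  define c' where "c' = (\<Sum>i\<in>Basis. c i *\<^sub>R i)"
  have b: "inner v (b y) = q v y" for v y
    unfolding b_def by (rule rep) (use q in \<open>auto simp: bilinear_def\<close>)
  have c': "inner v c' = c v" for v unfolding c'_def by (rule rep[OF c])
  have linb: "linear b" unfolding b_def
    using q by (auto simp: bilinear_def linear_iff scaleR_add_left sum.distrib scaleR_sum_right)
  define T where "T x = \<pi> (b (\<pi> x)) + (x - \<pi> x)" for x
  have inner_\<pi>: "inner u (\<pi> x) = inner u x" if "u \<in> U" for u x
    using \<pi>(3)[OF that, of x] by (simp add: inner_diff_right)
  have "linear T" unfolding T_def
    by (intro linear_compose_add linear_compose_sub linear_compose[OF linear_compose[OF \<pi>(1) linb] \<pi>(1), unfolded o_def] linear_id \<pi>(1))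
      (simp_all add: linear_ident)
  moreover have "inj T"
    unfolding linear_injective_0[OF \<open>linear T\<close>]
  proof (intro allI impI)
    fix x assume "T x = 0"
    then have "inner (\<pi> x) (T x) = 0" by simp
    then have "q (\<pi> x) (\<pi> x) = 0" by (simp add: T_def inner_add_right inner_\<pi> b \<pi>)
    then have "\<pi> x = 0" using pos[of "\<pi> x"] \<pi>(2) by force
    then show "x = 0" using \<open>T x = 0\<close> linear_0[OF \<pi>(1)] linear_0[OF linb] by (simp add: T_def)
  qed
  ultimately have "surj T" by (rule linear_injective_imp_surjective) simp
  then obtain x where x: "\<pi> c' = T x" by (rule surjE)
  show thesis
  proof (rule that[of "\<pi> x"])
    fix v assume v: "v \<in> U"
    have "inner v (\<pi> c') = inner v (T x)" using x by simp
    then show "q v (\<pi> x) = c v" by (simp add: T_def inner_add_right inner_\<pi> v b \<pi> c')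
  qed (rule \<pi>)
qed

section \<open>The Lagrangian to second order\<close>

definition gradL :: "(real^'n \<Rightarrow> real) \<Rightarrow> (real^'n \<Rightarrow> real^'m^'m) \<Rightarrow> (real^'n \<Rightarrow> real^'s) \<Rightarrow>
    real^'n \<Rightarrow> real^'m^'m \<Rightarrow> real^'s \<Rightarrow> real^'n" where
  "gradL f G h x Y z = (\<chi> i. partial_deriv i f x - trace (partial_deriv i G x ** Y) + inner (partial_deriv i h x) z)"

definition hess_form :: "(real^'n \<Rightarrow> real) \<Rightarrow> (real^'n \<Rightarrow> real^'m^'m) \<Rightarrow> (real^'n \<Rightarrow> real^'s) \<Rightarrow>
    real^'n \<Rightarrow> real^'m^'m \<Rightarrow> real^'s \<Rightarrow> real^'n \<Rightarrow> real^'n \<Rightarrow> real" where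
  "hess_form f G h x Y z u \<xi> = (\<Sum>i\<in>UNIV. u $ i * (frechet_derivative (partial_deriv i f) (at x) \<xi>
     - trace (frechet_derivative (partial_deriv i G) (at x) \<xi> ** Y)
     + inner (frechet_derivative (partial_deriv i h) (at x) \<xi>) z))"

text \<open>The bilinear form of the Hessian plus \<open>Omega\<close>, with J standing for the
  pseudoinverse of \<open>G x\<close>. For symmetric J and Y the two traces agree; both are written
  because each mixed block of Y contributes one of them to the expanded stationarity
  equation.\<close>

definition sosc_form :: "(real^'n \<Rightarrow> real) \<Rightarrow> (real^'n \<Rightarrow> real^'m^'m) \<Rightarrow> (real^'n \<Rightarrow> real^'s) \<Rightarrow>
    real^'n \<Rightarrow> real^'m^'m \<Rightarrow> real^'m^'m \<Rightarrow> real^'s \<Rightarrow> real^'n \<Rightarrow> real^'n \<Rightarrow> real" where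
  "sosc_form f G h x J Y z u \<xi> = hess_form f G h x Y z u \<xi>
     + trace (frechet_derivative G (at x) u ** J ** frechet_derivative G (at x) \<xi> ** Y)
     + trace (frechet_derivative G (at x) u ** Y ** frechet_derivative G (at x) \<xi> ** J)"

lemma bilinear_sosc_form:
  fixes f :: "real^'n \<Rightarrow> real" and G :: "real^'n \<Rightarrow> real^'m^'m" and h :: "real^'n \<Rightarrow> real^'s"
  assumes "C1_map G" and "\<And>i. C1_map (partial_deriv i f)" "\<And>i. C1_map (partial_deriv i G)"
    "\<And>i. C1_map (partial_deriv i h)"
  shows "bilinear (sosc_form f G h x J Y z)"
proof -
  note l = C1_map_bounded_linear[OF assms(1)] C1_map_bounded_linear[OF assms(2)]
    C1_map_bounded_linear[OF assms(3)] C1_map_bounded_linear[OF assms(4)]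
  have t: "bounded_linear (\<lambda>\<xi>. trace (X ** B \<xi> ** Z))" if "bounded_linear B"
    for B :: "real^'n \<Rightarrow> real^'m^'m" and X Z
    by (intro bounded_linear_compose[OF bounded_linear_trace] bounded_linear_compose[OF mm.bounded_linear_left]
        bounded_linear_compose[OF mm.bounded_linear_right] that)
  have t1: "bounded_linear (\<lambda>\<xi>. trace (B \<xi> ** Z))" if "bounded_linear B"
    for B :: "real^'n \<Rightarrow> real^'m^'m" and Z using t[OF that, of "mat 1" Z] by simp
  have "bounded_linear (\<lambda>\<xi>. sosc_form f G h x J Y z u \<xi>)" for u
    unfolding sosc_form_def hess_form_def
    by (intro bounded_linear_add bounded_linear_sum bounded_linear_sub
        bounded_linear_compose[OF bounded_linear_mult_right] bounded_linear_inner_left_comp l t t1)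
  moreover have "bounded_linear (\<lambda>u. sosc_form f G h x J Y z u \<xi>)" for \<xi>
    unfolding sosc_form_def hess_form_def matrix_mul_assoc[symmetric]
    by (intro bounded_linear_add bounded_linear_sum
        bounded_linear_compose[OF bounded_linear_mult_left] bounded_linear_vec_nth l t1)
  ultimately show ?thesis by (simp add: bilinear_def bounded_linear.linear)
qed

text \<open>Directions annihilating the linearised active constraints. The second-order condition
  applies to them because they lie in the critical cone.\<close>

definition active_space :: "(real^'n \<Rightarrow> real^'m^'m) \<Rightarrow> (real^'n \<Rightarrow> real^'s) \<Rightarrow> real^'n \<Rightarrow> real^'m^'m \<Rightarrow> (real^'n) set" where
  "active_space G h x P = {d. P ** frechet_derivative G (at x) d ** P = 0 \<and> frechet_derivative h (at x) d = 0}"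

text \<open>
  \<open>P\<close> is the orthogonal projection onto the kernel of \<open>G xs\<close>, \<open>J\<close> and \<open>Yp\<close> are the pseudoinverses of
  \<open>G xs\<close> and \<open>Ya\<close>, \<open>\<pi>\<close> is the orthogonal projection onto the active space, and \<open>\<xi>a\<close> is the velocity
  of the central path at \<open>\<mu> = 0\<close>.
\<close>

locale nsdp_center =
  fixes f :: "real^'n \<Rightarrow> real" and G :: "real^'n \<Rightarrow> real^'m^'m" and h :: "real^'n \<Rightarrow> real^'s"
    and xs :: "real^'n" and P J Ya Yp :: "real^'m^'m" and za :: "real^'s"
    and \<xi>a :: "real^'n" and \<pi> :: "real^'n \<Rightarrow> real^'n"
  assumes G1: "C1_map G" and h1: "C1_map h"
    and f2: "\<And>i. C1_map (partial_deriv i f)"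
    and G2: "\<And>i. C1_map (partial_deriv i G)"
    and h2: "\<And>i. C1_map (partial_deriv i h)"
    and G_sym: "\<And>x. transpose (G x) = G x"
    and h0: "h xs = 0"
    and Pt: "transpose P = P" and PP: "P ** P = P"
    and GP: "G xs ** P = 0" and ker: "\<And>v. G xs *v v = 0 \<Longrightarrow> P *v v = v"
    and G_psd: "G xs \<in> psd_mats"
    and Jt: "transpose J = J" and JP: "J ** P = 0" and JG: "J ** G xs = mat 1 - P"
    and Ya_psd: "Ya \<in> psd_mats" and PYa: "P ** Ya = Ya"
    and Ypt: "transpose Yp = Yp" and YpP: "Yp ** P = Yp" and YaYp: "Ya ** Yp = P"
    and stat: "gradL f G h xs Ya za = 0"
    and full_rank: "\<And>z. (\<And>i. inner (partial_deriv i h xs) z = 0) \<Longrightarrow> z = 0"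
    and sosc: "\<And>d. d \<in> active_space G h xs P \<Longrightarrow> d \<noteq> 0 \<Longrightarrow> 0 < sosc_form f G h xs J Ya za d d"
    and xia_G: "P ** frechet_derivative G (at xs) \<xi>a ** Ya = P"
    and xia_h: "frechet_derivative h (at xs) \<xi>a = 0"
    and xia_q: "\<And>u. u \<in> active_space G h xs P \<Longrightarrow>
      sosc_form f G h xs J Ya za u \<xi>a = trace (frechet_derivative G (at xs) u ** J)"
    and pi_linear: "linear \<pi>" and pi_in: "\<And>x. \<pi> x \<in> active_space G h xs P"
    and pi_orth: "\<And>x u. u \<in> active_space G h xs P \<Longrightarrow> inner u (x - \<pi> x) = 0"
begin

section \<open>Block algebra at the limit point\<close>

abbreviation "D \<equiv> G xs"
abbreviation "dG \<equiv> frechet_derivative G (at xs)"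
abbreviation "dh \<equiv> frechet_derivative h (at xs)"
abbreviation "U \<equiv> active_space G h xs P"
abbreviation "Q \<equiv> mat 1 - P"
abbreviation "q \<equiv> sosc_form f G h xs J Ya za"

lemma blG: "bounded_linear dG" and blh: "bounded_linear dh"
  by (rule C1_map_bounded_linear[OF G1], rule C1_map_bounded_linear[OF h1])

lemmas dG_simps = linear_add[OF bounded_linear.linear[OF blG]] linear_diff[OF bounded_linear.linear[OF blG]]
  linear_scale[OF bounded_linear.linear[OF blG]] linear_0[OF bounded_linear.linear[OF blG]]
lemmas dh_simps = linear_add[OF bounded_linear.linear[OF blh]] linear_diff[OF bounded_linear.linear[OF blh]]
  linear_scale[OF bounded_linear.linear[OF blh]] linear_0[OF bounded_linear.linear[OF blh]]

lemma dG_sym: "transpose (dG d) = dG d"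
  by (rule frechet_derivative_symmetric[OF G1 G_sym])

lemma Yat: "transpose Ya = Ya" using psd_sym[OF Ya_psd] by (simp add: sym_mats_def)

lemma PG: "P ** D = 0"
  using arg_cong[OF GP, of transpose] by (simp add: tp_simps Pt G_sym)
lemma PJ: "P ** J = 0"
  using arg_cong[OF JP, of transpose] by (simp add: tp_simps Pt Jt)
lemma GJ: "D ** J = Q"
  using arg_cong[OF JG, of transpose] by (simp add: tp_simps Pt Jt G_sym)
lemma YaP: "Ya ** P = Ya"
  using arg_cong[OF PYa, of transpose] by (simp add: tp_simps Pt Yat)
lemma YpYa: "Yp ** Ya = P"
  using arg_cong[OF YaYp, of transpose] by (simp add: tp_simps Pt Yat Ypt)
lemma PYp: "P ** Yp = Yp"
  using arg_cong[OF YpP, of transpose] by (simp add: tp_simps Pt Ypt)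
lemma xia_G': "P ** (dG \<xi>a ** Ya) = P" "P ** (dG \<xi>a ** (Ya ** X)) = P ** X"
  using xia_G by (simp_all add: matrix_mul_assoc)

text \<open>\<open>mat_pull\<close> repeats each product rule for the head of a longer right-nested
  product, so that \<open>mat_norm\<close> normalises arbitrary words in P, D, J, Ya and Yp.\<close>

lemmas mat_rules = PP GP PG JP PJ JG GJ PYa YaP YaYp YpYa YpP PYp
lemmas mat_pull = mat_rules[THEN matrix_mul_pull]
lemmas mat_norm = mat_distrib mat_rules mat_pull xia_G'

lemma U_G: "u \<in> U \<Longrightarrow> P ** dG u ** P = 0" and U_h: "u \<in> U \<Longrightarrow> dh u = 0"
  by (auto simp: active_space_def)

lemma U_I: "P ** dG u ** Ya = 0 \<Longrightarrow> dh u = 0 \<Longrightarrow> u \<in> U"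
proof -
  assume "P ** dG u ** Ya = 0" "dh u = 0"
  moreover have "P ** dG u ** P = P ** dG u ** Ya ** Yp" by (simp add: mat_norm)
  ultimately show ?thesis by (simp add: active_space_def mm.zero_left)
qed

lemma inner_pi: "u \<in> U \<Longrightarrow> inner u (\<pi> x) = inner u x"
  using pi_orth[of u x] by (simp add: inner_diff_right)

lemma inner_gradL:
  "inner u (gradL f G h xs Y z) = (\<Sum>i\<in>UNIV. u $ i * partial_deriv i f xs) - trace (dG u ** Y) + inner (dh u) z"
proof -
  have "inner u v = (\<Sum>i\<in>UNIV. u $ i * v $ i)" for v by (simp add: inner_vec_def)
  then show ?thesis
    unfolding frechet_partial_sum[OF G1] frechet_partial_sum[OF h1]
    by (simp add: gradL_def sum.distrib sum_subtractf algebra_simps mm.sum_left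
        linear_sum[OF tr_linear] tr_simps mm.scaleR_left inner_sum_left)
qed

lemma trace_U:
  assumes "u \<in> U"
  shows "trace (dG u ** (P ** N ** P)) = 0"
proof -
  have "trace (dG u ** (P ** N ** P)) = trace ((dG u ** P ** N) ** P)" by (simp add: matrix_mul_assoc)
  also have "\<dots> = trace (P ** (dG u ** P ** N))" by (rule trace_mul_sym)
  also have "\<dots> = trace ((P ** dG u ** P) ** N)" by (simp add: matrix_mul_assoc)
  finally show ?thesis by (simp add: U_G[OF assms] mm.zero_left tr_simps)
qed

lemma PYaP: "P ** Ya ** P = Ya" by (simp add: mat_norm)

text \<open>Both multiplier terms of the stationarity equation at the center vanish when tested
  against U, which leaves the gradient of f.\<close>

lemma grad_f_U: "u \<in> U \<Longrightarrow> (\<Sum>i\<in>UNIV. u $ i * partial_deriv i f xs) = 0"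
  using inner_gradL[of u Ya za] trace_U[of u Ya] by (simp add: stat PYaP U_h)

lemma inner_gradL_U: "u \<in> U \<Longrightarrow> inner u (gradL f G h xs (P ** N ** P) z) = 0"
  by (simp add: inner_gradL grad_f_U trace_U U_h)

text \<open>The inverse of \<open>D + P ** dG \<xi>a\<close>, which is block triangular for P and Q:
  its diagonal blocks are inverted by Ya and J, and \<open>- Ya ** dG \<xi>a ** J\<close> is the
  resulting mixed block.\<close>

definition N0 where "N0 = Ya + J - Ya ** dG \<xi>a ** J"

lemma N0P: "N0 ** P = Ya" by (simp add: N0_def mat_norm)

lemma PN0P: "P ** N0 ** P = Ya" by (simp add: N0_def mat_norm)

lemma N0_right: "(D + P ** dG \<xi>a) ** N0 = mat 1"
proof -
  have "D ** Ya = 0" using mat_pull(2)[of Ya] by (simp add: PYa mm.zero_left)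
  then show ?thesis by (simp add: N0_def mat_norm matrix_mul_pull[OF \<open>D ** Ya = 0\<close>])
qed

lemma N0_left: "N0 ** (D + P ** dG \<xi>a) = mat 1"
  using N0_right by (simp add: matrix_left_right_inverse)

text \<open>Write \<open>\<Gamma>\<close> for the difference quotient of G. Multiplying
  \<open>M N = I\<close> by J and then by P gives \<open>Q N P = - \<mu> J \<Gamma> N P\<close>, so
  \<open>Y = N (P + \<mu> Q)\<close> equals \<open>P N P\<close> plus \<mu> times the bracket in the
  last trace. In this form the division by \<mu> has been carried out, and \<open>g1\<close> is
  meaningful at \<mu> = 0.\<close>

definition "g1 = (\<lambda>(\<mu>, \<xi>, N, z). \<chi> i. divdiff (partial_deriv i f) xs (\<mu>, \<xi>) + inner (divdiff (partial_deriv i h) xs (\<mu>, \<xi>)) z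
    - trace (divdiff (partial_deriv i G) xs (\<mu>, \<xi>) ** (P ** N ** P))
    - trace (partial_deriv i G (xs + \<mu> *\<^sub>R \<xi>) ** (N ** Q - J ** divdiff G xs (\<mu>, \<xi>) ** N ** P)))"

text \<open>
  The blown-up system. With \<open>x = xs + \<mu> \<xi>\<close> and \<open>Y = N (P + \<mu> Q)\<close>, the second component, multiplied
  from the left by \<open>\<mu> P + Q\<close>, is \<open>G x Y = \<mu> I\<close>. On its zero set the gradient of the Lagrangian is
  the sum of \<open>gradL f G h xs (P N P) z\<close>, which is orthogonal to \<open>U\<close>, and \<open>\<mu> g1\<close>; the first component
  divides the part of the gradient in \<open>U\<close> by \<open>\<mu>\<close>.
\<close>

definition "F = (\<lambda>(\<mu>, \<xi>, N, z).
   (gradL f G h xs (P ** N ** P) z + \<pi> (g1 (\<mu>, \<xi>, N, z)) + \<mu> *\<^sub>R (g1 (\<mu>, \<xi>, N, z) - \<pi> (g1 (\<mu>, \<xi>, N, z))),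
    (D + P ** divdiff G xs (\<mu>, \<xi>) + \<mu> *\<^sub>R (Q ** divdiff G xs (\<mu>, \<xi>))) ** N - mat 1,
    divdiff h xs (\<mu>, \<xi>)))"

lemma param_C1_F: "param_C1 F"
proof -
  let ?\<xi> = "\<lambda>q::real \<times> (real^'n) \<times> (real^'m^'m) \<times> (real^'s). fst (snd q)"
  let ?N = "\<lambda>q::real \<times> (real^'n) \<times> (real^'m^'m) \<times> (real^'s). fst (snd (snd q))"
  let ?z = "\<lambda>q::real \<times> (real^'n) \<times> (real^'m^'m) \<times> (real^'s). snd (snd (snd q))"
  have N: "param_C1 ?N" and z: "param_C1 ?z"
    by (rule param_C1_linear[OF _ param_C1_snd], auto intro!: bounded_linear_intros)+
  have dd: "param_C1 (\<lambda>q. divdiff \<phi> xs (fst q, ?\<xi> q))" if "C1_map \<phi>" for \<phi> :: "real^'n \<Rightarrow> 'x::real_normed_vector"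
    by (rule param_C1_comp_linear[OF bounded_linear_fst param_C1_divdiff[OF that]])
  have sh: "param_C1 (\<lambda>q. \<phi> (xs + fst q *\<^sub>R ?\<xi> q))" if "C1_map \<phi>" for \<phi> :: "real^'n \<Rightarrow> 'x::real_normed_vector"
    using param_C1_comp_linear[OF bounded_linear_fst param_C1_shift[OF that, of xs]] by simp
  note rl = param_C1_bilinear[OF bounded_bilinear_matrix_matrix_mult] param_C1_bilinear[OF bounded_bilinear_inner]
    param_C1_bilinear[OF bounded_bilinear_scaleR] param_C1_add param_C1_minus
    param_C1_linear[OF bounded_linear_trace] param_C1_const param_C1_fst N z dd sh G1 h1 f2 G2 h2
  have g1: "param_C1 g1"
    unfolding g1_def case_prod_beta' by (intro param_C1_vec rl)
  have pi: "bounded_linear \<pi>" using pi_linear by (simp add: linear_conv_bounded_linear)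
  have g1': "param_C1 (\<lambda>q. g1 (fst q, ?\<xi> q, ?N q, ?z q))" using g1 by simp
  have "param_C1 (\<lambda>q. gradL f G h xs (P ** ?N q ** P) (?z q))"
    unfolding gradL_def by (intro param_C1_vec rl)
  then show ?thesis
    unfolding F_def case_prod_beta'
    by (intro param_C1_Pair param_C1_linear[OF pi] g1' rl)
qed

lemma inner_sum_vec: "inner u v = (\<Sum>i\<in>UNIV. u $ i * v $ i)" for u v :: "real^'n"
  by (simp add: inner_vec_def)

lemma sum_trace_G: "(\<Sum>i\<in>UNIV. u $ i * trace (partial_deriv i G xs ** X)) = trace (dG u ** X)"
  unfolding frechet_partial_sum[OF G1]
  by (simp add: mm.sum_left linear_sum[OF tr_linear] tr_simps mm.scaleR_left)

text \<open>Since \<open>P N0 P = Ya\<close>, the unscaled part of the first component is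
  stationarity at the center. The scaled part, tested against u in U, is
  \<open>q u \<xi>a - trace (dG u ** J)\<close>, which is zero by the choice of \<xi>a.\<close>

lemma F_zero: "F (0, \<xi>a, N0, za) = 0"
proof -
  let ?g = "g1 (0, \<xi>a, N0, za)"
  have R: "N0 ** Q - J ** dG \<xi>a ** N0 ** P = J - Ya ** dG \<xi>a ** J - J ** dG \<xi>a ** Ya"
    by (simp add: N0_def mat_norm)
  have i: "inner u ?g = 0" if u: "u \<in> U" for u
  proof -
    have "?g $ i = (frechet_derivative (partial_deriv i f) (at xs) \<xi>a
          - trace (frechet_derivative (partial_deriv i G) (at xs) \<xi>a ** Ya)
          + inner (frechet_derivative (partial_deriv i h) (at xs) \<xi>a) za)
        - trace (partial_deriv i G xs ** (J - Ya ** dG \<xi>a ** J - J ** dG \<xi>a ** Ya))" for i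
      by (simp add: g1_def PN0P R)
    then have "inner u ?g = hess_form f G h xs Ya za u \<xi>a
        - trace (dG u ** (J - Ya ** dG \<xi>a ** J - J ** dG \<xi>a ** Ya))"
      by (simp only: inner_sum_vec hess_form_def right_diff_distrib[of _ "_ + _"] sum_subtractf sum_trace_G)
    also have "\<dots> = q u \<xi>a - trace (dG u ** J)"
      by (simp add: sosc_form_def mat_distrib tr_simps)
    finally show ?thesis by (simp add: xia_q u)
  qed
  have "inner (\<pi> ?g) (\<pi> ?g) = 0" using i[of "\<pi> ?g"] by (simp add: inner_pi pi_in)
  then have "\<pi> ?g = 0" by simp
  moreover have "gradL f G h xs (P ** N0 ** P) za = 0" by (simp add: PN0P stat)
  ultimately show ?thesis by (simp add: F_def N0_right xia_h zero_prod_def)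
qed

text \<open>The trace is that of the product of the semidefinite matrices \<open>X Ya X\<close> and
  Ya, so the product itself is zero. Then the form of Ya vanishes at \<open>X Ya v\<close> for every
  v, and Yp cancels the outer factors Ya.\<close>

lemma sandwich_zero:
  assumes X: "transpose X = X" and "trace (X ** Ya ** X ** Ya) = 0"
  shows "Ya ** X ** Ya = 0" and "P ** X ** P = 0"
proof -
  let ?A = "X ** Ya ** X"
  have "?A \<in> psd_mats"
    unfolding psd_mats_def sym_mats_def
  proof (intro CollectI conjI allI)
    show "transpose ?A = ?A" by (simp add: tp_simps X Yat matrix_mul_assoc)
    show "0 \<le> inner v (?A *v v)" for v
    proof -
      have "inner v (?A *v v) = inner (X *v v) (Ya *v (X *v v))"
        using inner_matrix_vector_mult[of v X "Ya *v (X *v v)"] X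
        by (simp add: matrix_vector_mul_assoc matrix_mul_assoc)
      then show ?thesis using psd_ge[OF Ya_psd] by simp
    qed
  qed
  from psd_trace_mult(2)[OF this Ya_psd assms(2)] have 0: "?A ** Ya = 0" .
  have "Ya *v (X *v (Ya *v v)) = 0" for v
  proof (rule psd_null[OF Ya_psd])
    let ?w = "X *v (Ya *v v)"
    have "inner ?w (Ya *v ?w) = inner (Ya *v v) ((?A ** Ya) *v v)"
      using inner_matrix_vector_mult[of "Ya *v v" X "Ya *v ?w"] X
      by (simp add: matrix_vector_mul_assoc matrix_mul_assoc)
    then show "inner ?w (Ya *v ?w) = 0" using 0 by simp
  qed
  then have "(Ya ** X ** Ya) *v v = 0 *v v" for v by (simp add: matrix_vector_mul_assoc[symmetric])
  then show Y: "Ya ** X ** Ya = 0" by (simp add: matrix_eq)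
  have "P ** X ** P = Yp ** (Ya ** X ** Ya) ** Yp" by (simp add: mat_norm)
  then show "P ** X ** P = 0" by (simp add: Y mm.zero_left mm.zero_right)
qed

text \<open>A kernel element \<open>(a, M, c)\<close> is eliminated in stages: the matrix equation
  expresses M through a; the unscaled stationarity equation tested with a gives
  \<open>trace (dG a Ya dG a Ya) = 0\<close>, hence a lies in U; full rank gives c = 0; the scaled
  equation tested with a gives \<open>q a a = 0\<close>, hence a = 0.\<close>

lemma F_derivative_injective:
  obtains dF where "((\<lambda>y. F (0, y)) has_derivative dF) (at (\<xi>a, N0, za))" "\<And>v. dF v = 0 \<Longrightarrow> v = 0"
proof -
  let ?f = "\<lambda>i. frechet_derivative (partial_deriv i f) (at xs)"
  let ?h = "\<lambda>i. frechet_derivative (partial_deriv i h) (at xs)"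
  let ?G = "\<lambda>i. frechet_derivative (partial_deriv i G) (at xs)"
  define G0' where "G0' M c = (\<chi> i. inner (partial_deriv i h xs) c - trace (partial_deriv i G xs ** (P ** M ** P)))"
    for M c
  define g1' where "g1' a M c = (\<chi> i. ?f i a + (inner (?h i \<xi>a) c + inner (?h i a) za)
      - (trace (?G i \<xi>a ** (P ** M ** P)) + trace (?G i a ** Ya))
      - trace (partial_deriv i G xs ** (M ** Q - (J ** dG \<xi>a ** M ** P + J ** dG a ** Ya))))"
    for a M c
  define dF where "dF = (\<lambda>(a, M, c). (G0' M c + \<pi> (g1' a M c),
      P ** dG a ** N0 + (D + P ** dG \<xi>a) ** M, dh a))"
  have bl: "bounded_linear (?f i)" "bounded_linear (?h i)" "bounded_linear (?G i)" for i
    using C1_map_bounded_linear f2 h2 G2 by blast+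
  have pi: "bounded_linear \<pi>" using pi_linear by (simp add: linear_conv_bounded_linear)
  note bd = bounded_linear.has_derivative[OF bl(1)] bounded_linear.has_derivative[OF bl(2)]
    bounded_linear.has_derivative[OF bl(3)] bounded_linear.has_derivative[OF blG]
    bounded_linear.has_derivative[OF blh] bounded_linear.has_derivative[OF bounded_linear_trace]
    bounded_linear.has_derivative[OF pi] mm.FDERIV
  let ?y0 = "(\<xi>a, N0, za)"
  have "((\<lambda>y. F (0, y)) has_derivative dF) (at ?y0)"
  proof -
    have Fy: "(\<lambda>y. F (0, y)) = (\<lambda>y. ((\<chi> i. partial_deriv i f xs - trace (partial_deriv i G xs ** (P ** fst (snd y) ** P)) + inner (partial_deriv i h xs) (snd (snd y)))
       + \<pi> (\<chi> i. ?f i (fst y) + inner (?h i (fst y)) (snd (snd y))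
           - trace (?G i (fst y) ** (P ** fst (snd y) ** P))
           - trace (partial_deriv i G xs ** (fst (snd y) ** Q - J ** dG (fst y) ** fst (snd y) ** P))),
       (D + P ** dG (fst y)) ** fst (snd y) - mat 1, dh (fst y)))"
      by (rule ext) (simp add: F_def g1_def gradL_def case_prod_beta')
    show ?thesis
      unfolding Fy
      apply (rule has_derivative_eq_rhs)
       apply (rule has_derivative_Pair has_derivative_add has_derivative_diff has_derivative_vec bd
          has_derivative_inner has_derivative_const has_derivative_fst has_derivative_snd has_derivative_ident)+
      apply (rule ext)
      apply (simp add: dF_def G0'_def g1'_def case_prod_beta' PN0P mm.zero_left mm.zero_right mm.add_left PYa
          matrix_mul_assoc[symmetric] N0P[unfolded matrix_mul_assoc[symmetric]] tr_simps)
      done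
  qed
  moreover have "v = 0" if "dF v = 0" for v
  proof -
    obtain a M c where v: "v = (a, M, c)" by (metis prod_cases3)
    have E1: "G0' M c + \<pi> (g1' a M c) = 0" and E2: "P ** dG a ** N0 + (D + P ** dG \<xi>a) ** M = 0"
      and E3: "dh a = 0" using that by (auto simp: dF_def v zero_prod_def)
    \<comment> \<open>M is the derivative of matrix inversion in the direction
      \<open>P ** dG a\<close>.\<close>
    have "M = N0 ** ((D + P ** dG \<xi>a) ** M)" by (simp add: matrix_mul_assoc N0_left)
    also have "(D + P ** dG \<xi>a) ** M = - (P ** dG a ** N0)" using E2 by (simp add: eq_neg_iff_add_eq_0 add.commute)
    also have "N0 ** - (P ** dG a ** N0) = - ((N0 ** P) ** dG a ** N0)"
      by (simp add: mm.minus_right matrix_mul_assoc)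
    finally have M: "M = - (Ya ** dG a ** N0)" by (simp add: N0P)
    have MP: "M ** P = - (Ya ** dG a ** Ya)"
      unfolding M by (simp add: mm.minus_left matrix_mul_assoc[symmetric] N0P)
    have PMP: "P ** M ** P = - (Ya ** dG a ** Ya)"
    proof -
      have "P ** M ** P = P ** (M ** P)" by (simp add: matrix_mul_assoc)
      then show ?thesis by (simp add: MP mm.minus_right matrix_mul_assoc PYa)
    qed
    have iG0: "inner u (G0' M c) = inner (dh u) c - trace (dG u ** (P ** M ** P))" for u
    proof -
      have "inner u (G0' M c) = (\<Sum>i\<in>UNIV. u $ i * inner (partial_deriv i h xs) c)
          - (\<Sum>i\<in>UNIV. u $ i * trace (partial_deriv i G xs ** (P ** M ** P)))"
        by (simp add: inner_sum_vec G0'_def right_diff_distrib sum_subtractf)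
      moreover have "(\<Sum>i\<in>UNIV. u $ i * inner (partial_deriv i h xs) c) = inner (dh u) c"
        unfolding frechet_partial_sum[OF h1] by (simp add: inner_sum_left)
      ultimately show ?thesis by (simp only: sum_trace_G)
    qed
    \<comment> \<open>\<open>G0'\<close> is orthogonal to U, so the sum of the two scales vanishes
      only if each of them does.\<close>
    have "inner (\<pi> (g1' a M c)) (G0' M c + \<pi> (g1' a M c)) = inner (\<pi> (g1' a M c)) (\<pi> (g1' a M c))"
      by (simp add: inner_add_right iG0 trace_U[OF pi_in] U_h[OF pi_in])
    then have pg: "\<pi> (g1' a M c) = 0" using E1 by simp
    then have G0: "G0' M c = 0" using E1 by simp
    have "trace (dG a ** Ya ** dG a ** Ya) = 0"
      using iG0[of a] by (simp add: G0 E3 PMP mm.minus_right tr_simps matrix_mul_assoc)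
    from sandwich_zero[OF dG_sym this] have YY: "Ya ** dG a ** Ya = 0" and aU: "a \<in> U"
      by (auto simp: active_space_def E3)
    have PMP0: "P ** M ** P = 0" and MP0: "M ** P = 0" by (simp_all add: PMP MP YY)
    have c: "c = 0"
    proof (rule full_rank)
      fix i show "inner (partial_deriv i h xs) c = 0"
        using arg_cong[OF G0, of "\<lambda>v. v $ i"] by (simp add: G0'_def PMP0 mm.zero_right tr_simps)
    qed
    have M': "M = - (Ya ** dG a ** J)"
    proof -
      have "M = - (Ya ** dG a ** Ya + Ya ** dG a ** J - (Ya ** dG a ** Ya) ** dG \<xi>a ** J)"
        unfolding M N0_def by (simp add: mm.add_right mm.diff_right matrix_mul_assoc)
      then show ?thesis by (simp add: YY mm.zero_left)
    qed
    have "inner a (g1' a M c) = 0"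
      using inner_pi[OF aU, of "g1' a M c"] pg by simp
    moreover have "inner a (g1' a M c) = q a a"
    proof -
      have R: "M ** Q - (J ** dG \<xi>a ** M ** P + J ** dG a ** Ya) = - (Ya ** dG a ** J) - J ** dG a ** Ya"
      proof -
        have "M ** Q = M" by (simp add: mm.diff_right MP0)
        moreover have "J ** dG \<xi>a ** M ** P = 0"
          using MP0 by (simp add: matrix_mul_assoc[symmetric] mm.zero_right)
        ultimately show ?thesis by (simp add: M')
      qed
      have "g1' a M c $ i = (?f i a - trace (?G i a ** Ya) + inner (?h i a) za)
          - trace (partial_deriv i G xs ** (- (Ya ** dG a ** J) - J ** dG a ** Ya))" for i
        unfolding g1'_def R PMP0 by (simp add: c mm.zero_right linear_0[OF tr_linear])
      then have "inner a (g1' a M c) = hess_form f G h xs Ya za a a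
          - trace (dG a ** (- (Ya ** dG a ** J) - J ** dG a ** Ya))"
        by (simp only: inner_sum_vec hess_form_def right_diff_distrib[of _ "_ + _"] sum_subtractf sum_trace_G)
      then show ?thesis by (simp add: sosc_form_def mat_distrib tr_simps)
    qed
    ultimately have a: "a = 0" using sosc[OF aU] by force
    then have "M = 0" by (simp add: M' dG_simps mm.zero_left mm.zero_right)
    then show "v = 0" by (simp add: v a c zero_prod_def)
  qed
  ultimately show thesis using that by blast
qed

text \<open>The BKKT equations alone. Definiteness is an open condition that F does not express; it
  is restored along the path afterwards.\<close>

definition "sol \<mu> = (\<lambda>(x, Y, z). G x ** Y = \<mu> *\<^sub>R mat 1 \<and> gradL f G h x Y z = 0 \<and> h x = 0)"

definition "unscale \<mu> = (\<lambda>(\<xi>, N, z). (xs + \<mu> *\<^sub>R \<xi>, N ** (P + \<mu> *\<^sub>R Q), z :: real^'s))"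

definition "rescale \<mu> = (\<lambda>(x, Y, z :: real^'s). ((1/\<mu>) *\<^sub>R (x - xs), Y ** (P + (1/\<mu>) *\<^sub>R Q), z))"

lemma G_expand: "G (xs + \<mu> *\<^sub>R \<xi>) = D + \<mu> *\<^sub>R divdiff G xs (\<mu>, \<xi>)"
  by (simp add: divdiff_eq)

lemma gradL_split:
  assumes Y: "Y = P ** N ** P + \<mu> *\<^sub>R (N ** Q - J ** divdiff G xs (\<mu>, \<xi>) ** N ** P)"
  shows "gradL f G h (xs + \<mu> *\<^sub>R \<xi>) Y z = gradL f G h xs (P ** N ** P) z + \<mu> *\<^sub>R g1 (\<mu>, \<xi>, N, z)"
proof (rule vec_eq_iff[THEN iffD2], rule allI)
  fix i
  let ?R = "N ** Q - J ** divdiff G xs (\<mu>, \<xi>) ** N ** P"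
  let ?x = "xs + \<mu> *\<^sub>R \<xi>"
  have 1: "partial_deriv i f ?x = partial_deriv i f xs + \<mu> * divdiff (partial_deriv i f) xs (\<mu>, \<xi>)"
    using divdiff_eq[of \<mu> "partial_deriv i f" xs \<xi>] by simp
  have 2: "partial_deriv i h ?x = partial_deriv i h xs + \<mu> *\<^sub>R divdiff (partial_deriv i h) xs (\<mu>, \<xi>)"
    using divdiff_eq[of \<mu> "partial_deriv i h" xs \<xi>] by simp
  have 3: "trace (partial_deriv i G ?x ** Y) = trace (partial_deriv i G xs ** (P ** N ** P))
      + \<mu> * trace (divdiff (partial_deriv i G) xs (\<mu>, \<xi>) ** (P ** N ** P)) + \<mu> * trace (partial_deriv i G ?x ** ?R)"
  proof -
    have "partial_deriv i G ?x ** (P ** N ** P) = partial_deriv i G xs ** (P ** N ** P)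
        + \<mu> *\<^sub>R (divdiff (partial_deriv i G) xs (\<mu>, \<xi>) ** (P ** N ** P))"
    proof -
      have "partial_deriv i G ?x = partial_deriv i G xs + \<mu> *\<^sub>R divdiff (partial_deriv i G) xs (\<mu>, \<xi>)"
        using divdiff_eq[of \<mu> "partial_deriv i G" xs \<xi>] by simp
      then show ?thesis by (simp only: mm.add_left mm.scaleR_left)
    qed
    then show ?thesis unfolding Y by (simp add: mm.add_right mm.scaleR_right tr_simps)
  qed
  show "gradL f G h ?x Y z $ i = (gradL f G h xs (P ** N ** P) z + \<mu> *\<^sub>R g1 (\<mu>, \<xi>, N, z)) $ i"
    by (simp add: gradL_def g1_def 1 2 3 inner_add_left algebra_simps)
qed

lemma scaled_product:
  assumes "\<mu> \<noteq> 0"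
  shows "(\<mu> *\<^sub>R P + Q) ** (P + \<mu> *\<^sub>R Q) = \<mu> *\<^sub>R mat 1"
    "((1/\<mu>) *\<^sub>R P + Q) ** (\<mu> *\<^sub>R P + Q) = mat 1"
    "(P + (1/\<mu>) *\<^sub>R Q) ** (P + \<mu> *\<^sub>R Q) = mat 1"
    "\<mu> *\<^sub>R (P + (1/\<mu>) *\<^sub>R Q) = \<mu> *\<^sub>R P + Q"
  using assms by (simp_all add: mat_norm algebra_simps)

text \<open>Testing with \<open>\<pi> g1\<close> removes the unscaled part, which is orthogonal to
  U. Under either equation this forces \<open>\<pi> g1 = 0\<close>, and then both first components
  read \<open>gradL + \<mu> g1 = 0\<close>.\<close>

lemma F_scaled_equiv:
  assumes \<mu>: "\<mu> > 0"
  shows "F (\<mu>, \<xi>, N, z) = 0 \<longleftrightarrow> sol \<mu> (unscale \<mu> (\<xi>, N, z))"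
proof -
  let ?\<Gamma> = "divdiff G xs (\<mu>, \<xi>)"
  let ?x = "xs + \<mu> *\<^sub>R \<xi>"
  let ?M = "D + P ** ?\<Gamma> + \<mu> *\<^sub>R (Q ** ?\<Gamma>)"
  let ?Y = "N ** (P + \<mu> *\<^sub>R Q)"
  have M1: "(\<mu> *\<^sub>R P + Q) ** ?M = G ?x" unfolding G_expand by (simp add: mat_norm algebra_simps)
  have M2: "((1/\<mu>) *\<^sub>R P + Q) ** G ?x = ?M"
    unfolding M1[symmetric] by (simp only: matrix_mul_assoc scaled_product(2)[OF less_imp_neq[OF \<mu>, symmetric]] matrix_mul_lid)
  have m0: "\<mu> \<noteq> 0" using \<mu> by simp
  have MN: "?M ** N = mat 1 \<longleftrightarrow> G ?x ** ?Y = \<mu> *\<^sub>R mat 1"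
  proof
    assume "?M ** N = mat 1"
    have "G ?x ** ?Y = (\<mu> *\<^sub>R P + Q) ** (?M ** N) ** (P + \<mu> *\<^sub>R Q)"
      unfolding M1[symmetric] by (simp only: matrix_mul_assoc)
    then show "G ?x ** ?Y = \<mu> *\<^sub>R mat 1" unfolding \<open>?M ** N = mat 1\<close>
      by (simp only: matrix_mul_rid scaled_product(1)[OF m0])
  next
    assume GY: "G ?x ** ?Y = \<mu> *\<^sub>R mat 1"
    have c: "(P + \<mu> *\<^sub>R Q) ** (P + (1/\<mu>) *\<^sub>R Q) = mat 1"
      using scaled_product(3)[OF m0] by (simp add: matrix_left_right_inverse)
    have "?M ** N = ((1/\<mu>) *\<^sub>R P + Q) ** (G ?x ** ?Y) ** (P + (1/\<mu>) *\<^sub>R Q)"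
      unfolding M2[symmetric] by (simp only: matrix_mul_assoc[symmetric] c matrix_mul_rid)
    also have "\<dots> = ((1/\<mu>) *\<^sub>R P + Q) ** (\<mu> *\<^sub>R (P + (1/\<mu>) *\<^sub>R Q))"
      unfolding GY by (simp add: mm.scaleR_left mm.scaleR_right)
    also have "\<dots> = mat 1" unfolding scaled_product(4)[OF m0] by (rule scaled_product(2)[OF m0])
    finally show "?M ** N = mat 1" .
  qed
  have "gradL f G h xs (P ** N ** P) z + \<pi> (g1 (\<mu>, \<xi>, N, z)) + \<mu> *\<^sub>R (g1 (\<mu>, \<xi>, N, z) - \<pi> (g1 (\<mu>, \<xi>, N, z))) = 0
      \<longleftrightarrow> gradL f G h ?x ?Y z = 0" if "?M ** N = mat 1"
  proof -
    let ?base = "gradL f G h xs (P ** N ** P) z" and ?g = "g1 (\<mu>, \<xi>, N, z)"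
    \<comment> \<open>The block \<open>Q N P\<close> is extracted from \<open>M N = I\<close>;
      \<open>J ** P = 0\<close> removes the constant term.\<close>
    have "J ** (?M ** N) = J" using that by simp
    then have "Q ** N + \<mu> *\<^sub>R (J ** ?\<Gamma> ** N) = J"
      by (simp add: mat_norm)
    then have "(Q ** N + \<mu> *\<^sub>R (J ** ?\<Gamma> ** N)) ** P = J ** P" by simp
    then have "Q ** N ** P = - \<mu> *\<^sub>R (J ** ?\<Gamma> ** N ** P)"
      by (simp add: mm.add_left mm.scaleR_left JP eq_neg_iff_add_eq_0)
    then have "?Y = P ** N ** P + \<mu> *\<^sub>R (N ** Q - J ** ?\<Gamma> ** N ** P)"
      by (simp add: mm.diff_left mm.diff_right mm.add_right mm.scaleR_right algebra_simps)
    then have s: "gradL f G h ?x ?Y z = ?base + \<mu> *\<^sub>R ?g" by (rule gradL_split)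
    have i: "inner (\<pi> ?g) ?base = 0" "inner (\<pi> ?g) ?g = inner (\<pi> ?g) (\<pi> ?g)"
      by (simp_all add: inner_gradL_U inner_pi pi_in)
    show ?thesis
    proof
      assume l: "?base + \<pi> ?g + \<mu> *\<^sub>R (?g - \<pi> ?g) = 0"
      then have "inner (\<pi> ?g) (?base + \<pi> ?g + \<mu> *\<^sub>R (?g - \<pi> ?g)) = 0" by simp
      then have "\<pi> ?g = 0" by (simp add: inner_add_right inner_diff_right i)
      then show "gradL f G h ?x ?Y z = 0" using l by (simp add: s)
    next
      assume r: "gradL f G h ?x ?Y z = 0"
      then have "inner (\<pi> ?g) (?base + \<mu> *\<^sub>R ?g) = 0" by (simp add: s)
      then have "\<pi> ?g = 0" using m0 by (simp add: inner_add_right i)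
      then show "?base + \<pi> ?g + \<mu> *\<^sub>R (?g - \<pi> ?g) = 0" using r by (simp add: s)
    qed
  qed
  moreover have "divdiff h xs (\<mu>, \<xi>) = 0 \<longleftrightarrow> h ?x = 0"
  proof -
    have "\<mu> *\<^sub>R divdiff h xs (\<mu>, \<xi>) = h ?x" using divdiff_eq[of \<mu> h xs \<xi>] by (simp add: h0)
    then show ?thesis using m0 scaleR_eq_0_iff[of \<mu> "divdiff h xs (\<mu>, \<xi>)"] by simp
  qed
  ultimately show ?thesis
    unfolding F_def sol_def unscale_def zero_prod_def prod.case prod.inject right_minus_eq
    using MN by blast
qed

lemma unscale_rescale: "\<mu> > 0 \<Longrightarrow> unscale \<mu> (rescale \<mu> w) = w"
  using scaled_product(3)[of \<mu>]
  by (cases w) (simp add: unscale_def rescale_def matrix_mul_assoc[symmetric])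

text \<open>Y is \<mu> times the inverse of the symmetric matrix \<open>G x\<close>.\<close>

lemma sol_sym:
  assumes "G x ** Y = \<mu> *\<^sub>R mat 1" and \<mu>: "\<mu> \<noteq> 0"
  shows "transpose Y = Y"
proof -
  have "G x ** ((1/\<mu>) *\<^sub>R Y) = mat 1" using assms by (simp add: mm.scaleR_right)
  then have "((1/\<mu>) *\<^sub>R Y) ** G x = mat 1" by (simp add: matrix_left_right_inverse)
  then have 1: "Y ** G x = \<mu> *\<^sub>R mat 1" using \<mu> by (simp add: mm.scaleR_left vector_fraction_eq_iff)
  have 2: "transpose Y ** G x = \<mu> *\<^sub>R mat 1"
    using arg_cong[OF assms(1), of transpose] by (simp add: tp_simps G_sym)
  have "transpose Y ** (G x ** Y) = Y ** (G x ** Y)"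
    unfolding matrix_mul_assoc 1 2 ..
  then show ?thesis unfolding assms(1) using \<mu> by (simp add: mm.scaleR_right)
qed

section \<open>Limits of rescaled solutions\<close>

lemma q_linear: "linear (q u)"
  using bilinear_sosc_form[OF G1 f2 G2 h2] by (simp add: bilinear_def)

text \<open>
  The normalisation by \<open>\<rho>\<close> yields \<open>x - xs = O(\<mu>)\<close> and the limit of \<open>(x - xs) / \<mu>\<close> at the same time:
  the limits \<open>\<eta>\<close>, \<open>t\<close> satisfy the homogenised limit equations, so \<open>\<eta> - t \<xi>a\<close> lies in the active space
  and annihilates the quadratic form of the second-order condition.
\<close>

lemma rescale_tendsto_normalized:
  assumes \<mu>: "\<And>k. \<mu> k > 0" and x: "x \<longlonglongrightarrow> xs" and Y: "Y \<longlonglongrightarrow> Ya" and z: "z \<longlonglongrightarrow> za"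
    and sol: "\<And>k. sol (\<mu> k) (x k, Y k, z k)"
    and \<rho>: "\<And>k. \<rho> k > 0" and \<eta>: "(\<lambda>k. (x k - xs) /\<^sub>R \<rho> k) \<longlonglongrightarrow> \<eta>" and t: "(\<lambda>k. \<mu> k / \<rho> k) \<longlonglongrightarrow> t"
    and nz: "norm \<eta> + t = 1"
  shows "(\<lambda>k. rescale (\<mu> k) (x k, Y k, z k)) \<longlonglongrightarrow> (\<xi>a, N0, za)"
proof -
  have GY: "G (x k) ** Y k = \<mu> k *\<^sub>R mat 1" and gL: "gradL f G h (x k) (Y k) (z k) = 0" and hx: "h (x k) = 0" for k
    using sol[of k] by (auto simp: sol_def)
  have Yt: "transpose (Y k) = Y k" for k using sol_sym[OF GY] \<mu>[of k] by simp
  note dq = difference_quotient_tendsto[OF C1_map_has_derivative x \<rho> \<eta>]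
  define \<Gamma> where "\<Gamma> k = (G (x k) - D) /\<^sub>R \<rho> k" for k
  have \<Gamma>: "\<Gamma> \<longlonglongrightarrow> dG \<eta>" unfolding \<Gamma>_def by (rule dq[OF G1])
  have GD: "(G (x k) - D) ** Y k = \<mu> k *\<^sub>R mat 1 - D ** Y k" for k by (simp add: mm.diff_left GY)
  have \<Gamma>Y: "\<Gamma> k ** Y k = (\<mu> k / \<rho> k) *\<^sub>R mat 1 - (1 / \<rho> k) *\<^sub>R (D ** Y k)" for k
    unfolding \<Gamma>_def mm.scaleR_left GD by (simp add: scaleR_diff_right divide_inverse_commute)
  \<comment> \<open>Multiplication by P removes the term with \<open>D ** Y k\<close>, about whose
    size relative to \<open>\<rho> k\<close> nothing is known yet.\<close>
  have "(\<lambda>k. P ** \<Gamma> k ** Y k) \<longlonglongrightarrow> P ** dG \<eta> ** Ya"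
    by (intro mm.tendsto tendsto_const \<Gamma> Y)
  moreover have "P ** \<Gamma> k ** Y k = (\<mu> k / \<rho> k) *\<^sub>R P" for k
    unfolding matrix_mul_assoc[symmetric] \<Gamma>Y by (simp add: mat_norm)
  ultimately have "(\<lambda>k. (\<mu> k / \<rho> k) *\<^sub>R P) \<longlonglongrightarrow> P ** dG \<eta> ** Ya" by simp
  from LIMSEQ_unique[OF this tendsto_scaleR[OF t tendsto_const]]
  have PG\<eta>: "P ** dG \<eta> ** Ya = t *\<^sub>R P" .
  have "(\<lambda>k. 0) \<longlonglongrightarrow> dh \<eta>" using dq[OF h1] by (simp add: hx h0)
  then have dh\<eta>: "dh \<eta> = 0" using LIMSEQ_unique tendsto_const by blast
  define e where "e = \<eta> - t *\<^sub>R \<xi>a"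
  have eU: "e \<in> U"
  proof (rule U_I)
    have "P ** dG e ** Ya = P ** dG \<eta> ** Ya - t *\<^sub>R (P ** dG \<xi>a ** Ya)"
      by (simp add: e_def dG_simps mm.diff_left mm.diff_right mm.scaleR_left mm.scaleR_right)
    then show "P ** dG e ** Ya = 0" by (simp add: PG\<eta> xia_G)
    show "dh e = 0" by (simp add: e_def dh_simps dh\<eta> xia_h)
  qed
  \<comment> \<open>Multiplying the identity for \<open>\<Gamma> k ** Y k\<close> by J instead of P
    isolates \<open>Q ** Y k\<close>: it is of order \<rho>, and Z is the limit of its
    quotient.\<close>
  define Z where "Z = t *\<^sub>R J - J ** dG \<eta> ** Ya"
  define Z' where "Z' = t *\<^sub>R J - Ya ** dG \<eta> ** J"
  have ZZ': "transpose Z = Z'" by (simp add: Z_def Z'_def tp_simps Jt Yat dG_sym matrix_mul_assoc)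
  have QY: "(\<lambda>k. (1 / \<rho> k) *\<^sub>R (Q ** Y k)) \<longlonglongrightarrow> Z"
  proof -
    have "(1 / \<rho> k) *\<^sub>R (Q ** Y k) = (\<mu> k / \<rho> k) *\<^sub>R J - J ** (\<Gamma> k ** Y k)" for k
      unfolding \<Gamma>Y JG[symmetric] by (simp add: mm.diff_right mm.scaleR_right matrix_mul_assoc)
    moreover have "(\<lambda>k. (\<mu> k / \<rho> k) *\<^sub>R J - J ** (\<Gamma> k ** Y k)) \<longlonglongrightarrow> t *\<^sub>R J - J ** (dG \<eta> ** Ya)"
      by (intro tendsto_intros mm.tendsto t \<Gamma> Y)
    ultimately show ?thesis by (simp add: Z_def matrix_mul_assoc)
  qed
  have YQ: "(\<lambda>k. (1 / \<rho> k) *\<^sub>R (Y k ** Q)) \<longlonglongrightarrow> Z'"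
    using bounded_linear.tendsto[OF bounded_linear_transpose QY]
    by (simp add: ZZ' tp_simps Yt Pt)
  have "q e e = 0"
  proof -
    \<comment> \<open>The difference quotient of the gradient of the Lagrangian with multipliers
      frozen at step k, tested with e. As the gradient vanishes at \<open>x k\<close>, only its
      value at \<open>xs\<close> remains, and since e lies in U, the block \<open>P Y P\<close>
      drops out of it.\<close>
    let ?A = "\<lambda>k. (\<Sum>i\<in>UNIV. e $ i * ((partial_deriv i f (x k) - partial_deriv i f xs) /\<^sub>R \<rho> k
       - trace (((partial_deriv i G (x k) - partial_deriv i G xs) /\<^sub>R \<rho> k) ** Y k)
       + inner ((partial_deriv i h (x k) - partial_deriv i h xs) /\<^sub>R \<rho> k) (z k)))"
    have A: "?A \<longlonglongrightarrow> hess_form f G h xs Ya za e \<eta>"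
      unfolding hess_form_def
      by (intro tendsto_intros bounded_linear.tendsto[OF bounded_linear_trace] mm.tendsto dq f2 G2 h2 Y z)
    have "?A k = trace (dG e ** ((1 / \<rho> k) *\<^sub>R (Q ** Y k) ** P + (1 / \<rho> k) *\<^sub>R (Y k ** Q)))" for k
    proof -
      have "?A k = (1 / \<rho> k) * (\<Sum>i\<in>UNIV. e $ i * (gradL f G h (x k) (Y k) (z k) $ i - gradL f G h xs (Y k) (z k) $ i))"
        unfolding sum_distrib_left gradL_def
      proof (rule sum.cong[OF refl])
        fix i
        have t: "trace (((A - B) /\<^sub>R \<rho> k) ** Y k) = (1 / \<rho> k) * (trace (A ** Y k) - trace (B ** Y k))"
          for A B :: "real^'m^'m"
          by (simp only: mm.scaleR_left mm.diff_left linear_scale[OF tr_linear] linear_diff[OF tr_linear]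
              real_scaleR_def inverse_eq_divide)
        have s: "inner ((a - b) /\<^sub>R \<rho> k) (z k) = (1 / \<rho> k) * (inner a (z k) - inner b (z k))" for a b
          by (simp add: inner_diff_left inverse_eq_divide)
        have factor: "e' * (c * (a - b) - c * (a' - b') + c * (u - v)) = c * (e' * ((a - a' + u) - (b - b' + v)))"
          for e' c a b a' b' u v :: real by (simp add: algebra_simps)
        have r: "(a - b) /\<^sub>R \<rho> k = (1 / \<rho> k) * (a - b)" for a b :: real
          by (simp add: inverse_eq_divide)
        show "e $ i * ((partial_deriv i f (x k) - partial_deriv i f xs) /\<^sub>R \<rho> k
            - trace (((partial_deriv i G (x k) - partial_deriv i G xs) /\<^sub>R \<rho> k) ** Y k)
            + inner ((partial_deriv i h (x k) - partial_deriv i h xs) /\<^sub>R \<rho> k) (z k)) =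
          (1 / \<rho> k) * (e $ i * ((\<chi> i. partial_deriv i f (x k) - trace (partial_deriv i G (x k) ** Y k) + inner (partial_deriv i h (x k)) (z k)) $ i
            - (\<chi> i. partial_deriv i f xs - trace (partial_deriv i G xs ** Y k) + inner (partial_deriv i h xs) (z k)) $ i))"
          unfolding t s r vec_lambda_beta by (rule factor)
      qed
      also have "\<dots> = (1 / \<rho> k) * - inner e (gradL f G h xs (Y k) (z k))"
        by (simp add: gL inner_sum_vec sum_negf)
      also have "\<dots> = (1 / \<rho> k) * trace (dG e ** Y k)"
        by (simp add: inner_gradL grad_f_U[OF eU] U_h[OF eU])
      also have "trace (dG e ** Y k) = trace (dG e ** (Q ** Y k ** P + Y k ** Q))"
      proof -
        have Yk: "Y k = P ** Y k ** P + (Q ** Y k ** P + Y k ** Q)"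
          by (simp add: mm.diff_left mm.diff_right)
        show ?thesis
          by (subst Yk) (simp only: mm.add_right[of _ "P ** Y k ** P"] linear_add[OF tr_linear] trace_U[OF eU] add_0_left)
      qed
      finally show ?thesis
        by (simp add: mm.add_right mm.scaleR_left mm.scaleR_right tr_simps algebra_simps)
    qed
    moreover have "(\<lambda>k. trace (dG e ** ((1 / \<rho> k) *\<^sub>R (Q ** Y k) ** P + (1 / \<rho> k) *\<^sub>R (Y k ** Q))))
        \<longlonglongrightarrow> trace (dG e ** (Z ** P + Z'))"
      by (intro bounded_linear.tendsto[OF bounded_linear_trace] mm.tendsto tendsto_intros QY YQ)
    ultimately have "hess_form f G h xs Ya za e \<eta> = trace (dG e ** (Z ** P + Z'))"
      using LIMSEQ_unique[OF A] by simp
    also have "\<dots> = t * trace (dG e ** J) - trace (dG e ** J ** dG \<eta> ** Ya) - trace (dG e ** Ya ** dG \<eta> ** J)"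
      by (simp add: Z_def Z'_def mat_norm tr_simps)
    finally have "q e \<eta> = t * trace (dG e ** J)" by (simp add: sosc_form_def)
    then have "q e \<eta> = t * q e \<xi>a" by (simp add: xia_q[OF eU])
    then show ?thesis by (subst (2) e_def) (simp add: linear_diff[OF q_linear] linear_scale[OF q_linear])
  qed
  then have "e = 0" using sosc[OF eU] by force
  then have \<eta>t: "\<eta> = t *\<^sub>R \<xi>a" by (simp add: e_def)
  \<comment> \<open>For t = 0 also \<eta> would be 0, against the normalisation.\<close>
  then have t0: "t \<noteq> 0" using nz by auto
  have 1: "(\<lambda>k. (1 / \<mu> k) *\<^sub>R (x k - xs)) \<longlonglongrightarrow> \<xi>a"
  proof -
    have "(\<lambda>k. inverse (\<mu> k / \<rho> k) *\<^sub>R ((x k - xs) /\<^sub>R \<rho> k)) \<longlonglongrightarrow> inverse t *\<^sub>R \<eta>"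
      by (intro tendsto_intros t \<eta> t0)
    moreover have eq: "inverse (\<mu> k / \<rho> k) *\<^sub>R ((x k - xs) /\<^sub>R \<rho> k) = (1 / \<mu> k) *\<^sub>R (x k - xs)" for k
      using \<mu>[of k] \<rho>[of k] by (simp add: divide_simps)
    ultimately show ?thesis unfolding eq \<eta>t using t0 by simp
  qed
  have 2: "(\<lambda>k. Y k ** (P + (1 / \<mu> k) *\<^sub>R Q)) \<longlonglongrightarrow> N0"
  proof -
    have "(\<lambda>k. Y k ** P + inverse (\<mu> k / \<rho> k) *\<^sub>R ((1 / \<rho> k) *\<^sub>R (Y k ** Q))) \<longlonglongrightarrow> Ya ** P + inverse t *\<^sub>R Z'"
      by (intro tendsto_intros mm.tendsto Y t YQ t0)
    moreover have eq: "inverse (\<mu> k / \<rho> k) *\<^sub>R ((1 / \<rho> k) *\<^sub>R (Y k ** Q)) = (1 / \<mu> k) *\<^sub>R (Y k ** Q)" for k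
      using \<mu>[of k] \<rho>[of k] by (simp add: divide_simps)
    moreover have N0: "Ya ** P + inverse t *\<^sub>R Z' = N0"
      using t0 by (simp add: Z'_def \<eta>t N0_def YaP dG_simps mm.scaleR_right mm.scaleR_left scaleR_diff_right)
    ultimately show ?thesis unfolding eq N0 by (simp only: mm.add_right mm.scaleR_right)
  qed
  show ?thesis unfolding rescale_def by (simp add: tendsto_Pair 1 2 z)
qed

text \<open>Dividing by \<open>\<rho> = \<mu> + norm (x - xs)\<close> gives pairs whose two norms
  add up to 1, so by compactness a subsequence converges and its limit satisfies the same
  normalisation. A subsequence is enough for the indirect argument in
  \<open>central_path\<close>.\<close>

lemma rescale_subsequence:
  assumes \<mu>: "\<And>k. \<mu> k > 0" and w: "w \<longlonglongrightarrow> (xs, Ya, za)" and sol: "\<And>k. sol (\<mu> k) (w k)"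
  obtains r where "strict_mono (r :: nat \<Rightarrow> nat)" "(\<lambda>k. rescale (\<mu> (r k)) (w (r k))) \<longlonglongrightarrow> (\<xi>a, N0, za)"
proof -
  define x where "x k = fst (w k)" for k
  define Y where "Y k = fst (snd (w k))" for k
  define z where "z k = snd (snd (w k))" for k
  have wk: "w k = (x k, Y k, z k)" for k by (simp add: x_def Y_def z_def)
  have lim: "x \<longlonglongrightarrow> xs" "Y \<longlonglongrightarrow> Ya" "z \<longlonglongrightarrow> za"
    unfolding x_def Y_def z_def
    using tendsto_fst[OF w] tendsto_fst[OF tendsto_snd[OF w]] tendsto_snd[OF tendsto_snd[OF w]] by auto
  define \<rho> where "\<rho> k = \<mu> k + norm (x k - xs)" for k
  have \<rho>: "\<rho> k > 0" for k using \<mu>[of k] by (simp add: \<rho>_def add_pos_nonneg)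
  define s where "s k = ((x k - xs) /\<^sub>R \<rho> k, \<mu> k / \<rho> k)" for k
  have s1: "norm (fst (s k)) + snd (s k) = 1" for k
    using \<rho>[of k] by (simp add: s_def \<rho>_def divide_simps add.commute)
  have "norm (s k) \<le> 1" for k
  proof -
    have "norm (s k) \<le> norm (fst (s k)) + norm (snd (s k))" by (metis norm_Pair_le prod.collapse)
    moreover have "snd (s k) \<ge> 0" using \<mu>[of k] \<rho>[of k] by (simp add: s_def)
    ultimately show ?thesis using s1[of k] by simp
  qed
  then have "\<forall>k. s k \<in> cball 0 1" by simp
  then obtain l r where r: "strict_mono r" and l: "(s \<circ> r) \<longlonglongrightarrow> l"
    using compact_cball[of "0 :: (real^'n) \<times> real" 1] unfolding compact_def by blast
  have l1: "(\<lambda>k. fst (s (r k))) \<longlonglongrightarrow> fst l" and l2: "(\<lambda>k. snd (s (r k))) \<longlonglongrightarrow> snd l"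
    using tendsto_fst[OF l] tendsto_snd[OF l] by (simp_all add: o_def)
  have "(\<lambda>k. norm (fst (s (r k))) + snd (s (r k))) \<longlonglongrightarrow> norm (fst l) + snd l"
    by (intro tendsto_intros l1 l2)
  then have nl: "norm (fst l) + snd l = 1" by (simp add: s1 LIMSEQ_const_iff)
  have "(\<lambda>k. rescale (\<mu> (r k)) (x (r k), Y (r k), z (r k))) \<longlonglongrightarrow> (\<xi>a, N0, za)"
  proof (rule rescale_tendsto_normalized[where \<rho>="\<lambda>k. \<rho> (r k)" and \<eta>="fst l" and t="snd l"])
    show "(\<lambda>k. x (r k)) \<longlonglongrightarrow> xs" "(\<lambda>k. Y (r k)) \<longlonglongrightarrow> Ya" "(\<lambda>k. z (r k)) \<longlonglongrightarrow> za"
      using LIMSEQ_subseq_LIMSEQ[OF lim(1) r] LIMSEQ_subseq_LIMSEQ[OF lim(2) r] LIMSEQ_subseq_LIMSEQ[OF lim(3) r]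
      by (simp_all add: o_def)
  qed (use l1 l2 \<mu> \<rho> nl sol wk in \<open>auto simp: s_def\<close>)
  then show thesis using that[OF r] by (simp add: wk)
qed

section \<open>Definiteness and smoothness of the path\<close>

lemma limit_pd: "D + P ** dG \<xi>a ** P \<in> pd_mats"
proof -
  have "P ** dG \<xi>a ** P = P ** dG \<xi>a ** Ya ** Yp" by (simp add: matrix_mul_assoc[symmetric] YaYp)
  then have Yp: "P ** dG \<xi>a ** P = Yp" by (simp add: xia_G PYp)
  have Ypq: "inner v (Yp *v v) = inner (Yp *v v) (Ya *v (Yp *v v))" for v
  proof -
    have "inner v (Yp *v v) = inner v ((Yp ** Ya ** Yp) *v v)" by (simp add: YpYa PYp)
    then show ?thesis
      using inner_matrix_vector_mult[of v Yp "Ya *v (Yp *v v)"] Ypt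
      by (simp add: matrix_vector_mul_assoc matrix_mul_assoc)
  qed
  have "0 < inner v ((D + Yp) *v v)" if "v \<noteq> 0" for v
  proof -
    have s: "inner v ((D + Yp) *v v) = inner v (D *v v) + inner (Yp *v v) (Ya *v (Yp *v v))"
      by (simp add: mat_vec inner_add_right Ypq)
    have 0: "0 \<le> inner v (D *v v)" "0 \<le> inner (Yp *v v) (Ya *v (Yp *v v))"
      using psd_ge[OF G_psd] psd_ge[OF Ya_psd] by auto
    have "inner v ((D + Yp) *v v) \<noteq> 0"
    proof
      assume "inner v ((D + Yp) *v v) = 0"
      then have "inner v (D *v v) = 0" "inner (Yp *v v) (Ya *v (Yp *v v)) = 0" using 0 s by auto
      from psd_null[OF G_psd this(1)] psd_null[OF Ya_psd this(2)]
      have "P *v v = v" "P *v v = 0" by (auto simp: ker matrix_vector_mul_assoc YaYp)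
      then show False using that by simp
    qed
    then show ?thesis using 0 s by linarith
  qed
  then show ?thesis unfolding Yp by (simp add: pd_mats_def sym_mats_def tp_simps G_sym Ypt)
qed

text \<open>The one-sided scaling does not preserve definiteness, so \<open>G x\<close> is written
  as the congruence by \<open>sqrt \<mu> P + Q\<close> of a matrix B. By
  \<open>block_scaling\<close> B tends to the positive definite matrix of \<open>limit_pd\<close>;
  here the terms in \<open>sqrt \<mu>\<close> do no harm, because only continuity is used.\<close>

lemma eventually_G_pd:
  assumes \<xi>: "(\<xi> \<longlongrightarrow> \<xi>a) (at_right 0)"
  shows "\<forall>\<^sub>F \<mu> in at_right 0. G (xs + \<mu> *\<^sub>R \<xi> \<mu>) \<in> pd_mats"
proof -
  let ?\<Gamma> = "\<lambda>\<mu>. divdiff G xs (\<mu>, \<xi> \<mu>)"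
  define B where "B \<mu> = D + P ** ?\<Gamma> \<mu> ** P + sqrt \<mu> *\<^sub>R (P ** ?\<Gamma> \<mu> ** Q + Q ** ?\<Gamma> \<mu> ** P) + \<mu> *\<^sub>R (Q ** ?\<Gamma> \<mu> ** Q)" for \<mu>
  have \<Gamma>t: "transpose (?\<Gamma> \<mu>) = ?\<Gamma> \<mu>" for \<mu>
    by (simp add: divdiff_def dG_sym G_sym tp_simps)
  have \<Gamma>: "(?\<Gamma> \<longlongrightarrow> dG \<xi>a) (at_right 0)"
  proof -
    have "continuous_on ({0..} \<times> UNIV) (divdiff G xs)"
      using param_C1_divdiff[OF G1] by (auto simp: param_C1_def)
    then have "(divdiff G xs \<longlongrightarrow> divdiff G xs (0, \<xi>a)) (at (0, \<xi>a) within {0..} \<times> UNIV)"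
      unfolding continuous_on_def by (rule bspec) simp
    moreover have "filterlim (\<lambda>\<mu>. (\<mu>, \<xi> \<mu>)) (at (0, \<xi>a) within {0..} \<times> UNIV) (at_right 0)"
      unfolding filterlim_at
      by (intro conjI tendsto_Pair \<xi> tendsto_ident_at)
        (auto simp: eventually_at_right_field intro: exI[of _ 1])
    ultimately show ?thesis using filterlim_compose by fastforce
  qed
  have "(B \<longlongrightarrow> D + P ** dG \<xi>a ** P + sqrt 0 *\<^sub>R (P ** dG \<xi>a ** Q + Q ** dG \<xi>a ** P) + 0 *\<^sub>R (Q ** dG \<xi>a ** Q)) (at_right 0)"
    unfolding B_def by (intro tendsto_intros mm.tendsto \<Gamma> tendsto_ident_at)
  then have "(B \<longlongrightarrow> D + P ** dG \<xi>a ** P) (at_right 0)" by simp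
  from eventually_pd[OF limit_pd this]
  have "\<forall>\<^sub>F \<mu> in at_right 0. B \<mu> \<in> pd_mats"
    by (simp add: B_def sym_mats_def tp_simps \<Gamma>t Pt G_sym matrix_mul_assoc add.commute)
  moreover have "\<forall>\<^sub>F \<mu> in at_right (0::real). \<mu> > 0" by (rule eventually_at_right_less)
  ultimately show ?thesis
  proof eventually_elim
    case (elim \<mu>)
    let ?T = "sqrt \<mu> *\<^sub>R P + Q"
    have "?T ** B \<mu> ** ?T \<in> pd_mats"
    proof (rule pd_congruence)
      show "B \<mu> \<in> pd_mats" by (rule elim)
      show "transpose ?T = ?T" by (simp add: tp_simps Pt)
      have "sqrt \<mu> \<noteq> 0" using elim by simp
      then show "v = 0" if "?T *v v = 0" for v using scaled_projection_injective[OF PP _ that] by blast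
    qed
    moreover have "?T ** B \<mu> ** ?T = G (xs + \<mu> *\<^sub>R \<xi> \<mu>)"
    proof -
      have "?T ** B \<mu> ** ?T = D + \<mu> *\<^sub>R (P ** ?\<Gamma> \<mu> ** P + (P ** ?\<Gamma> \<mu> ** Q + Q ** ?\<Gamma> \<mu> ** P) + Q ** ?\<Gamma> \<mu> ** Q)"
        unfolding B_def block_scaling[OF PP GP PG] using elim by (simp add: scaleR_add_right)
      also have "P ** ?\<Gamma> \<mu> ** P + (P ** ?\<Gamma> \<mu> ** Q + Q ** ?\<Gamma> \<mu> ** P) + Q ** ?\<Gamma> \<mu> ** Q = ?\<Gamma> \<mu>"
        by (simp add: mm.diff_left mm.diff_right)
      finally show ?thesis by (simp add: G_expand)
    qed
    ultimately show ?case by simp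
  qed
qed

lemma sol_Y_pd:
  assumes GY: "G x ** Y = \<mu> *\<^sub>R mat 1" and \<mu>: "\<mu> > 0" and G: "G x \<in> pd_mats"
  shows "Y \<in> pd_mats"
proof -
  have "0 < inner v (Y *v v)" if "v \<noteq> 0" for v
  proof -
    have Gu: "G x *v (Y *v v) = \<mu> *\<^sub>R v" by (simp add: matrix_vector_mul_assoc GY mat_vec)
    then have "Y *v v \<noteq> 0" using that \<mu> by auto
    then have "0 < inner (Y *v v) (G x *v (Y *v v))" using G by (simp add: pd_mats_def)
    then show ?thesis using \<mu> by (simp add: Gu inner_commute zero_less_mult_iff)
  qed
  then show ?thesis using sol_sym[OF GY] \<mu> by (simp add: pd_mats_def sym_mats_def)
qed

lemma unscale_C1:
  assumes "y C1_differentiable_on S"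
  shows "(\<lambda>\<mu>. unscale \<mu> (y \<mu>)) C1_differentiable_on S"
proof -
  obtain Dy where d: "\<And>\<mu>. \<mu> \<in> S \<Longrightarrow> (y has_vector_derivative Dy \<mu>) (at \<mu>)" and c: "continuous_on S Dy"
    using assms by (auto simp: C1_differentiable_on_def)
  have cy: "continuous_on S y"
    using d by (meson continuous_at_imp_continuous_on has_vector_derivative_continuous)
  let ?W = "\<lambda>\<mu>. (\<mu> *\<^sub>R fst (Dy \<mu>) + fst (y \<mu>), fst (snd (y \<mu>)) ** Q + fst (snd (Dy \<mu>)) ** (P + \<mu> *\<^sub>R Q), snd (snd (Dy \<mu>)))"
  show ?thesis
    unfolding C1_differentiable_on_def
  proof (intro exI[of _ ?W] conjI ballI)
    show "continuous_on S ?W" by (intro continuous_intros mm.continuous_on c cy)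
    fix \<mu> assume "\<mu> \<in> S"
    then have dy: "(y has_derivative (\<lambda>t. t *\<^sub>R Dy \<mu>)) (at \<mu>)" using d by (simp add: has_vector_derivative_def)
    have "((\<lambda>\<mu>. (xs + \<mu> *\<^sub>R fst (y \<mu>), fst (snd (y \<mu>)) ** (P + \<mu> *\<^sub>R Q), snd (snd (y \<mu>)))) has_derivative
       (\<lambda>t. t *\<^sub>R ?W \<mu>)) (at \<mu>)"
      by (rule has_derivative_eq_rhs,
          (rule has_derivative_Pair has_derivative_add has_derivative_scaleR has_derivative_scaleR_left mm.FDERIV
            has_derivative_const has_derivative_fst has_derivative_snd has_derivative_ident dy)+)
        (auto simp: fun_eq_iff scaleR_add_right mm.scaleR_left mm.scaleR_right scaleR_diff_right mm.diff_right algebra_simps)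
    then show "((\<lambda>\<mu>. unscale \<mu> (y \<mu>)) has_vector_derivative ?W \<mu>) (at \<mu>)"
      by (simp add: has_vector_derivative_def unscale_def case_prod_beta')
  qed
qed

text \<open>V is one neighbourhood in the original variables, independent of \<mu>. The path stays
  in V and is the only solution there; this is what makes coincidence with the path an open
  condition.\<close>

theorem central_path:
  obtains \<delta> w V where "\<delta> > 0" "open V" "w C1_differentiable_on {0<..<\<delta>}"
    "(w \<longlongrightarrow> (xs, Ya, za)) (at_right 0)"
    "\<And>\<mu>. \<mu> \<in> {0<..<\<delta>} \<Longrightarrow> sol \<mu> (w \<mu>) \<and> w \<mu> \<in> V \<and> w \<mu> \<in> W_pp G"
    "\<And>\<mu> v. \<mu> \<in> {0<..<\<delta>} \<Longrightarrow> v \<in> V \<Longrightarrow> sol \<mu> v \<Longrightarrow> v = w \<mu>"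
    "(xs, Ya, za) \<in> V"
proof -
  obtain dF where dF: "((\<lambda>y. F (0, y)) has_derivative dF) (at (\<xi>a, N0, za))" "\<And>v. dF v = 0 \<Longrightarrow> v = 0"
    using F_derivative_injective by blast
  obtain \<delta>0 r y where "\<delta>0 > 0" "r > 0"
    and y0: "\<And>\<mu>. \<mu> \<in> {0<..<\<delta>0} \<Longrightarrow> F (\<mu>, y \<mu>) = 0"
    and yu: "\<And>\<mu> v. \<lbrakk>\<mu> \<in> {0<..<\<delta>0}; v \<in> cball (\<xi>a, N0, za) r; F (\<mu>, v) = 0\<rbrakk> \<Longrightarrow> v = y \<mu>"
    and yC: "y C1_differentiable_on {0<..<\<delta>0}" and yl: "(y \<longlongrightarrow> (\<xi>a, N0, za)) (at_right 0)"
    using param_implicit_function[OF param_C1_F F_zero dF] by blast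
  define w where "w \<mu> = unscale \<mu> (y \<mu>)" for \<mu>
  have wl: "(w \<longlongrightarrow> (xs, Ya, za)) (at_right 0)"
  proof -
    have l: "((\<lambda>\<mu>. fst (y \<mu>)) \<longlongrightarrow> \<xi>a) (at_right 0)" "((\<lambda>\<mu>. fst (snd (y \<mu>))) \<longlongrightarrow> N0) (at_right 0)"
        "((\<lambda>\<mu>. snd (snd (y \<mu>))) \<longlongrightarrow> za) (at_right 0)"
      using tendsto_fst[OF yl] tendsto_fst[OF tendsto_snd[OF yl]] tendsto_snd[OF tendsto_snd[OF yl]] by auto
    have "((\<lambda>\<mu>. (xs + \<mu> *\<^sub>R fst (y \<mu>), fst (snd (y \<mu>)) ** (P + \<mu> *\<^sub>R Q), snd (snd (y \<mu>)))) \<longlongrightarrow>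
        (xs + 0 *\<^sub>R \<xi>a, N0 ** (P + 0 *\<^sub>R Q), za)) (at_right 0)"
      by (intro tendsto_intros mm.tendsto l tendsto_ident_at)
    then show ?thesis by (simp add: w_def[abs_def] unscale_def case_prod_beta' N0P)
  qed
  have Feq: "F (\<mu>, v) = 0 \<longleftrightarrow> sol \<mu> (unscale \<mu> v)" if "\<mu> > 0" for \<mu> v
    using F_scaled_equiv[OF that] by (cases v) auto
  \<comment> \<open>Closeness in the original variables says nothing directly about
    \<open>(x - xs) / \<mu>\<close>. A sequence of solutions tending to the center whose rescalings
    avoid the ball would contradict \<open>rescale_subsequence\<close>.\<close>
  have "\<exists>\<epsilon>>0. \<forall>\<mu> v. 0 < \<mu> \<longrightarrow> \<mu> < \<epsilon> \<longrightarrow> dist v (xs, Ya, za) < \<epsilon> \<longrightarrow> sol \<mu> v \<longrightarrow> rescale \<mu> v \<in> cball (\<xi>a, N0, za) r"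
  proof (rule ccontr)
    assume neg: "\<not> ?thesis"
    have "\<exists>\<mu> v. 0 < \<mu> \<and> \<mu> < 1 / real (Suc k) \<and> dist v (xs, Ya, za) < 1 / real (Suc k) \<and> sol \<mu> v
        \<and> rescale \<mu> v \<notin> cball (\<xi>a, N0, za) r" for k
    proof -
      have "1 / real (Suc k) > 0" by simp
      with neg show ?thesis by blast
    qed
    then obtain \<mu> v where *: "\<And>k. 0 < \<mu> k" "\<And>k. dist (v k) (xs, Ya, za) < 1 / real (Suc k)" "\<And>k. sol (\<mu> k) (v k)"
        "\<And>k. rescale (\<mu> k) (v k) \<notin> cball (\<xi>a, N0, za) r" by metis
    have "(\<lambda>k. v k - (xs, Ya, za)) \<longlonglongrightarrow> 0"
      by (rule LIMSEQ_norm_0) (use *(2) in \<open>simp only: dist_norm\<close>)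
    then have "v \<longlonglongrightarrow> (xs, Ya, za)" by (simp only: LIM_zero_iff)
    from rescale_subsequence[OF *(1) this *(3)] obtain s where
      "(\<lambda>k. rescale (\<mu> (s k)) (v (s k))) \<longlonglongrightarrow> (\<xi>a, N0, za)" by blast
    from tendstoD[OF this \<open>r > 0\<close>] have "\<exists>k. dist (rescale (\<mu> (s k)) (v (s k))) (\<xi>a, N0, za) < r"
      using eventually_happens'[OF sequentially_bot] by blast
    then obtain k where "dist (rescale (\<mu> (s k)) (v (s k))) (\<xi>a, N0, za) < r" by blast
    then show False using *(4)[of "s k"] by (simp add: dist_commute)
  qed
  then obtain \<epsilon> where \<epsilon>: "\<epsilon> > 0" "\<And>\<mu> v. 0 < \<mu> \<Longrightarrow> \<mu> < \<epsilon> \<Longrightarrow> dist v (xs, Ya, za) < \<epsilon> \<Longrightarrow> sol \<mu> v \<Longrightarrow> rescale \<mu> v \<in> cball (\<xi>a, N0, za) r"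
    by blast
  let ?V = "ball (xs, Ya, za) \<epsilon>"
  have "\<forall>\<^sub>F \<mu> in at_right 0. w \<mu> \<in> ?V"
    using tendstoD[OF wl \<epsilon>(1)] by (simp add: dist_commute)
  moreover have "\<forall>\<^sub>F \<mu> in at_right 0. G (xs + \<mu> *\<^sub>R fst (y \<mu>)) \<in> pd_mats"
    using eventually_G_pd[of "\<lambda>\<mu>. fst (y \<mu>)"] tendsto_fst[OF yl] by simp
  ultimately have "\<forall>\<^sub>F \<mu> in at_right 0. w \<mu> \<in> ?V \<and> G (xs + \<mu> *\<^sub>R fst (y \<mu>)) \<in> pd_mats"
    by eventually_elim simp
  then obtain \<delta>1 where \<delta>1: "\<delta>1 > 0" "\<And>\<mu>. 0 < \<mu> \<Longrightarrow> \<mu> < \<delta>1 \<Longrightarrow> w \<mu> \<in> ?V \<and> G (xs + \<mu> *\<^sub>R fst (y \<mu>)) \<in> pd_mats"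
    unfolding eventually_at_right_field by auto
  define \<delta> where "\<delta> = min \<delta>0 (min \<delta>1 \<epsilon>)"
  have \<delta>: "\<delta> > 0" "\<delta> \<le> \<delta>0" "\<delta> \<le> \<delta>1" "\<delta> \<le> \<epsilon>"
    using \<open>\<delta>0 > 0\<close> \<delta>1(1) \<epsilon>(1) by (auto simp: \<delta>_def)
  show thesis
  proof (rule that[of \<delta> ?V w])
    show "w C1_differentiable_on {0<..<\<delta>}"
      unfolding w_def[abs_def]
      by (rule unscale_C1, rule C1_differentiable_on_subset[OF yC]) (use \<delta> in auto)
    show "sol \<mu> (w \<mu>) \<and> w \<mu> \<in> ?V \<and> w \<mu> \<in> W_pp G" if "\<mu> \<in> {0<..<\<delta>}" for \<mu>
    proof -
      have \<mu>: "0 < \<mu>" "\<mu> < \<delta>0" "\<mu> < \<delta>1" using that \<delta> by auto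
      have s: "sol \<mu> (w \<mu>)" using y0[of \<mu>] Feq[of \<mu> "y \<mu>"] \<mu> by (simp add: w_def)
      have Gp: "G (xs + \<mu> *\<^sub>R fst (y \<mu>)) \<in> pd_mats" "w \<mu> \<in> ?V" using \<delta>1(2)[of \<mu>] \<mu> by auto
      obtain a N b where ya: "y \<mu> = (a, N, b)" by (metis prod_cases3)
      have "w \<mu> \<in> W_pp G"
        using s Gp(1) sol_Y_pd[of "xs + \<mu> *\<^sub>R a" "N ** (P + \<mu> *\<^sub>R Q)" \<mu>] \<mu>(1)
        by (simp add: w_def unscale_def ya W_pp_def sol_def)
      with s Gp show ?thesis by simp
    qed
    show "v = w \<mu>" if m: "\<mu> \<in> {0<..<\<delta>}" and v: "v \<in> ?V" "sol \<mu> v" for \<mu> v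
    proof -
      have \<mu>: "0 < \<mu>" "\<mu> < \<delta>0" "\<mu> < \<epsilon>" using m \<delta> by auto
      have "rescale \<mu> v = y \<mu>"
        using \<epsilon>(2)[of \<mu> v] v \<mu> by (intro yu) (auto simp: Feq unscale_rescale dist_commute)
      then show ?thesis using unscale_rescale[OF \<mu>(1), of v] by (simp add: w_def)
    qed
  qed (use \<delta> \<epsilon> wl in auto)
qed

end

section \<open>Determinants of compressed matrices\<close>

abbreviation jdet :: "real Matrix.mat \<Rightarrow> real" where "jdet \<equiv> Determinant.det"

lemma compress_carrier [simp]: "compress k e Y \<in> carrier_mat k k"
  by (simp add: compress_def)

lemma compress_index [simp]: "i < k \<Longrightarrow> j < k \<Longrightarrow> compress k e Y $$ (i, j) = inner (e i) (Y *v e j)"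
  by (simp add: compress_def)

lemma jdet_expand:
  assumes "A \<in> carrier_mat k k"
  shows "jdet A = (\<Sum>p | p permutes {0..<k}. signof p * (\<Prod>i = 0..<k. A $$ (i, p i)))"
  using det_def'[OF assms] by simp

text \<open>In the Leibniz formula a permutation other than the identity moves at least two indices,
  so its product contains two factors vanishing at t = 0 and contributes nothing to the
  derivative.\<close>

lemma det_one_plus_has_derivative:
  fixes K :: "real Matrix.mat"
  assumes K: "K \<in> carrier_mat k k"
  shows "((\<lambda>t. jdet (1\<^sub>m k + t \<cdot>\<^sub>m K)) has_real_derivative (\<Sum>i = 0..<k. K $$ (i, i))) (at 0)"
proof -
  let ?a = "\<lambda>p i t. (if i = p i then 1 else 0) + t * K $$ (i, p i)"
  have p_lt: "p i < k" if "p permutes {0..<k}" "i < k" for p i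
    using permutes_in_image[OF that(1), of i] that(2) by simp
  have eq: "jdet (1\<^sub>m k + t \<cdot>\<^sub>m K) = (\<Sum>p | p permutes {0..<k}. signof p * (\<Prod>i = 0..<k. ?a p i t))" for t
  proof -
    have "1\<^sub>m k + t \<cdot>\<^sub>m K \<in> carrier_mat k k" using K by simp
    from jdet_expand[OF this] show ?thesis
      using K p_lt by (auto intro!: sum.cong prod.cong arg_cong2[where f="(*)"])
  qed
  let ?d = "\<lambda>p. \<Sum>i = 0..<k. K $$ (i, p i) * (\<Prod>j\<in>{0..<k} - {i}. ?a p j 0)"
  have der: "((\<lambda>t. \<Sum>p | p permutes {0..<k}. signof p * (\<Prod>i = 0..<k. ?a p i t)) has_real_derivative
      (\<Sum>p | p permutes {0..<k}. signof p * ?d p)) (at 0)"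
    by (intro DERIV_sum DERIV_cmult has_field_derivative_prod)
      (auto intro!: derivative_eq_intros)
  have d0: "?d p = (if p = id then \<Sum>i = 0..<k. K $$ (i, i) else 0)" if p: "p permutes {0..<k}" for p
  proof (cases "p = id")
    case False
    \<comment> \<open>Both a and \<open>p a\<close> are moved by p and they differ, so one of them
      survives the removal of i.\<close>
    have z: "(\<Prod>j\<in>{0..<k} - {i}. ?a p j 0) = 0" for i
    proof -
      obtain a where a: "p a \<noteq> a" using False by (auto simp: fun_eq_iff)
      have "a \<in> {0..<k}" "p a \<in> {0..<k}"
        using a p permutes_in_image[OF p] by (auto simp: permutes_def)
      moreover have "p (p a) \<noteq> p a" using a permutes_inj[OF p] by (metis injD)
      ultimately have "\<exists>j\<in>{0..<k} - {i}. p j \<noteq> j" using a by (metis Diff_iff singletonD)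
      then obtain j where j: "j \<in> {0..<k} - {i}" "p j \<noteq> j" by blast
      then have "?a p j 0 = 0" by auto
      with j(1) show ?thesis by (intro prod_zero) blast+
    qed
    show ?thesis using False by (simp only: z mult_zero_right sum.neutral_const if_False)
  qed simp
  have "(\<Sum>p | p permutes {0..<k}. signof p * ?d p) = (\<Sum>p | p permutes {0..<k}. if p = id then (\<Sum>i = 0..<k. K $$ (i, i)) else 0)"
  proof (rule sum.cong[OF refl])
    fix p assume "p \<in> {p. p permutes {0..<k}}"
    then have "?d p = (if p = id then \<Sum>i = 0..<k. K $$ (i, i) else 0)" by (intro d0) simp
    then show "signof p * ?d p = (if p = id then (\<Sum>i = 0..<k. K $$ (i, i)) else 0)"
      by (cases "p = id") (simp_all only: sign_id if_True if_False mult_zero_right of_int_1 mult_1)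
  qed
  also have "\<dots> = (\<Sum>i = 0..<k. K $$ (i, i))"
    by (subst sum.delta) (auto simp: finite_permutations permutes_id)
  finally show ?thesis using der by (simp add: eq)
qed

section \<open>Compression to the kernel\<close>

locale kernel_basis =
  fixes D :: "real^'m^'m" and e :: "nat \<Rightarrow> real^'m" and k :: nat
  assumes orthonormal: "i < k \<Longrightarrow> j < k \<Longrightarrow> inner (e i) (e j) = (if i = j then 1 else 0)"
    and span_e: "span (e ` {..<k}) = {v. D *v v = 0}"
begin

text \<open>\<open>E E\<^sup>T\<close> for the matrix E with columns \<open>e i\<close>, the
  orthogonal projection onto the kernel of D.\<close>

definition "P = (\<Sum>i<k. outer (e i) (e i))"

lemma P_vec: "P *v v = (\<Sum>i<k. inner (e i) v *\<^sub>R e i)"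
  by (simp add: P_def mv.sum_left outer_mult_vec)

lemma P_transpose: "transpose P = P"
  by (simp add: P_def linear_sum[OF tp_linear])

lemma P_e: "j < k \<Longrightarrow> P *v e j = e j"
proof -
  assume j: "j < k"
  have "P *v e j = (\<Sum>i<k. if i = j then e j else 0)"
    unfolding P_vec using j by (intro sum.cong) (auto simp: orthonormal)
  then show ?thesis using j by simp
qed

lemma P_ker: "D *v v = 0 \<Longrightarrow> P *v v = v"
proof -
  assume "D *v v = 0"
  then have "v \<in> span (e ` {..<k})" by (simp add: span_e)
  then show ?thesis
    by (induction rule: span_induct_alt) (auto simp: mat_vec P_e)
qed

lemma D_P_vec: "D *v (P *v v) = 0"
proof -
  have "P *v v \<in> span (e ` {..<k})" unfolding P_vec
    by (intro span_sum span_scale span_base) auto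
  then show ?thesis by (simp add: span_e)
qed

lemma D_P: "D ** P = 0"
  using D_P_vec by (simp add: matrix_eq matrix_vector_mul_assoc)

lemma P_P: "P ** P = P"
  using P_ker[OF D_P_vec] by (simp add: matrix_eq matrix_vector_mul_assoc)

lemma trace_P: "trace (X ** P) = (\<Sum>i = 0..<k. inner (e i) (X *v e i))"
  by (simp add: P_def mm.sum_right linear_sum[OF tr_linear] matrix_mult_outer trace_outer
      inner_commute atLeast0LessThan)

lemma compress_mult: "compress k e A * compress k e B = compress k e (A ** P ** B)"
proof (rule eq_matI)
  fix i j assume ij: "i < dim_row (compress k e (A ** P ** B))" "j < dim_col (compress k e (A ** P ** B))"
  then have ij: "i < k" "j < k" by (auto simp: compress_def)
  have "(compress k e A * compress k e B) $$ (i, j) =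
      (\<Sum>l = 0..<k. inner (e i) (A *v e l) * inner (e l) (B *v e j))"
    using ij by (simp add: compress_def scalar_prod_def)
  also have "\<dots> = inner (e i) (A *v (P *v (B *v e j)))"
    by (simp add: P_vec mv.sum_right mat_vec inner_sum_right atLeast0LessThan mult.commute)
  finally show "(compress k e A * compress k e B) $$ (i, j) = compress k e (A ** P ** B) $$ (i, j)"
    using ij by (simp add: matrix_vector_mul_assoc matrix_mul_assoc)
qed (auto simp: compress_def)

lemma compress_P: "compress k e P = 1\<^sub>m k"
  by (rule eq_matI) (auto simp: compress_def P_e orthonormal)

lemma compress_add_scale: "compress k e (A + t *\<^sub>R B) = compress k e A + t \<cdot>\<^sub>m compress k e B"
  by (rule eq_matI) (auto simp: compress_def mat_vec inner_add_right)

text \<open>A null vector c of the compressed matrix has coordinates in the basis e; v is the vector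
  of the kernel of D with these coordinates.\<close>

lemma jdet_compress_zeroE:
  assumes "jdet (compress k e A) = 0"
  obtains v where "v \<noteq> 0" "D *v v = 0" "P *v (A *v v) = 0"
proof -
  obtain c where c: "c \<in> carrier_vec k" "c \<noteq> 0\<^sub>v k" "compress k e A *\<^sub>v c = 0\<^sub>v k"
    using assms det_0_iff_vec_prod_zero[OF compress_carrier, of k e A] by auto
  define v where "v = (\<Sum>j<k. vec_index c j *\<^sub>R e j)"
  have ev: "inner (e i) v = vec_index c i" if "i < k" for i
  proof -
    have "inner (e i) v = (\<Sum>j<k. if j = i then vec_index c i else 0)"
      unfolding v_def inner_sum_right using that by (intro sum.cong) (auto simp: orthonormal)
    then show ?thesis using that by simp
  qed
  show thesis
  proof (rule that)
    show "v \<noteq> 0"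
    proof
      assume "v = 0"
      then have "vec_index c i = 0" if "i < k" for i using ev[OF that] by simp
      then have "c = 0\<^sub>v k" using c(1) by (intro eq_vecI) auto
      then show False using c(2) by simp
    qed
    have "v \<in> span (e ` {..<k})" unfolding v_def
      by (intro span_sum span_scale span_base) auto
    then show "D *v v = 0" by (simp add: span_e)
    have "inner (e i) (A *v v) = 0" if "i < k" for i
    proof -
      have "vec_index (compress k e A *\<^sub>v c) i = (\<Sum>j = 0..<k. inner (e i) (A *v e j) * vec_index c j)"
        using that c(1) by (simp add: compress_def scalar_prod_def)
      then show ?thesis
        using that c(3) by (simp add: v_def mv.sum_right mat_vec inner_sum_right atLeast0LessThan mult.commute)
    qed
    then show "P *v (A *v v) = 0" by (simp add: P_vec)
  qed
qed

text \<open>Along the segment from P to Y the form stays positive on the kernel, so the compressed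
  determinant never vanishes. It is 1 at the start, and by the intermediate value theorem it cannot
  change sign.\<close>

lemma jdet_compress_pos:
  assumes Y: "\<And>v. v \<noteq> 0 \<Longrightarrow> D *v v = 0 \<Longrightarrow> 0 < inner v (Y *v v)"
  shows "0 < jdet (compress k e Y)"
proof (rule ccontr)
  assume neg: "\<not> 0 < jdet (compress k e Y)"
  let ?M = "\<lambda>t. P + t *\<^sub>R (Y - P)"
  define \<phi> where "\<phi> t = jdet (compress k e (?M t))" for t
  have c: "continuous_on {0..1} \<phi>"
    unfolding \<phi>_def jdet_expand[OF compress_carrier]
  proof (intro continuous_intros)
    fix p i assume "p \<in> {p. p permutes {0..<k}}" "i \<in> {0..<k}"
    then have "i < k" "p i < k" using permutes_in_image[of p "{0..<k}" i] by auto
    then show "continuous_on {0..1} (\<lambda>t. compress k e (?M t) $$ (i, p i))"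
      by (simp add: mat_vec) (intro continuous_intros)
  qed
  have "\<phi> 0 = 1" "\<phi> 1 = jdet (compress k e Y)" by (simp_all add: \<phi>_def compress_P)
  then obtain t where t: "0 \<le> t" "t \<le> 1" "\<phi> t = 0"
    using IVT2'[of \<phi> 1 0 0] neg c by auto
  then obtain v where v: "v \<noteq> 0" "D *v v = 0" "P *v (?M t *v v) = 0"
    using jdet_compress_zeroE[of "?M t"] by (auto simp: \<phi>_def)
  have Pv: "P *v v = v" by (rule P_ker[OF v(2)])
  have "0 = inner v (P *v (?M t *v v))" using v by simp
  also have "\<dots> = inner v (?M t *v v)"
    using inner_matrix_vector_mult[of v P] P_transpose Pv by metis
  also have "\<dots> = (1 - t) * inner v v + t * inner v (Y *v v)"
    by (simp add: mat_vec Pv inner_add_right inner_diff_right algebra_simps)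
  finally have 0: "(1 - t) * inner v v + t * inner v (Y *v v) = 0" by simp
  have "0 < inner v v" "0 < inner v (Y *v v)" using v Y by auto
  then have "(1 - t) * inner v v + t * inner v (Y *v v) > 0"
    using t by (cases "t = 0") (auto intro!: add_nonneg_pos)
  then show False using 0 by simp
qed

text \<open>On the kernel \<open>Y + t H = Y (1 + t Yp H)\<close>, so the determinant factors.
  Fermat's rule applies to the second factor, whose derivative at t = 0 is the trace of
  \<open>Yp H\<close>.\<close>

lemma compress_det_critical:
  assumes Yp: "Y ** Yp = P" and PYp: "Yp ** P = Yp" and H: "P ** H = H" "H ** P = H" and PY: "Y ** P = Y"
    and det: "jdet (compress k e Y) > 0" and \<epsilon>: "\<epsilon> > 0"
    and max: "\<And>t. \<bar>t\<bar> < \<epsilon> \<Longrightarrow> jdet (compress k e (Y + t *\<^sub>R H)) \<le> jdet (compress k e Y)"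
  shows "trace (Yp ** H) = 0"
proof -
  let ?K = "compress k e (Yp ** H)"
  have eq: "compress k e (Y + t *\<^sub>R H) = compress k e Y * (1\<^sub>m k + t \<cdot>\<^sub>m ?K)" for t
  proof -
    have "compress k e Y * ?K = compress k e (Y ** P ** (Yp ** H))" by (rule compress_mult)
    also have "Y ** P ** (Yp ** H) = H" by (simp add: matrix_mul_assoc PY Yp H)
    finally have "compress k e Y * ?K = compress k e H" .
    moreover have "compress k e Y * (1\<^sub>m k + t \<cdot>\<^sub>m ?K) = compress k e Y * 1\<^sub>m k + compress k e Y * (t \<cdot>\<^sub>m ?K)"
      by (rule mult_add_distrib_mat[of _ k k _ k]) auto
    moreover have "compress k e Y * (t \<cdot>\<^sub>m ?K) = t \<cdot>\<^sub>m (compress k e Y * ?K)"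
      by (rule mult_smult_distrib[of _ k k _ k]) auto
    moreover have "compress k e Y * 1\<^sub>m k = compress k e Y"
      by (rule right_mult_one_mat[of _ k k]) simp
    ultimately show ?thesis by (simp add: compress_add_scale)
  qed
  have "jdet (compress k e (Y + t *\<^sub>R H)) = jdet (compress k e Y) * jdet (1\<^sub>m k + t \<cdot>\<^sub>m ?K)" for t
    unfolding eq by (rule det_mult[of _ k]) auto
  then have le: "jdet (1\<^sub>m k + t \<cdot>\<^sub>m ?K) \<le> 1" if "\<bar>t\<bar> < \<epsilon>" for t
    using max[OF that] det by simp
  have "1\<^sub>m k + 0 \<cdot>\<^sub>m ?K = 1\<^sub>m k" by (rule eq_matI) (auto simp: compress_def)
  then have "(\<Sum>i = 0..<k. ?K $$ (i, i)) = 0"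
    by (intro DERIV_local_max[OF det_one_plus_has_derivative[OF compress_carrier] \<epsilon>]) (simp add: le)
  then have "trace (Yp ** H ** P) = 0" by (simp add: trace_P)
  then show ?thesis by (simp add: matrix_mul_assoc[symmetric] H)
qed

end

section \<open>The analytic center and the central path\<close>

lemma twice_cont_diff_C1: "twice_cont_diff \<phi> \<Longrightarrow> C1_map \<phi>"
  unfolding twice_cont_diff_def C1_map_def
  using has_derivative_continuous by (metis continuous_at_imp_continuous_on)

lemma twice_cont_diff_partial:
  fixes \<phi> :: "real^'n \<Rightarrow> 'b::real_normed_vector"
  assumes "twice_cont_diff \<phi>"
  shows "C1_map (partial_deriv i \<phi>)"
proof -
  obtain \<phi>' and \<phi>'' :: "real^'n \<Rightarrow> (real^'n) \<Rightarrow>\<^sub>L ((real^'n) \<Rightarrow>\<^sub>L 'b)" where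
    d1: "\<And>x. (\<phi> has_derivative blinfun_apply (\<phi>' x)) (at x)" and
    d2: "\<And>x. (\<phi>' has_derivative blinfun_apply (\<phi>'' x)) (at x)" and c: "continuous_on UNIV \<phi>''"
    using assms unfolding twice_cont_diff_def by blast
  define A where "A = Blinfun (\<lambda>B :: (real^'n) \<Rightarrow>\<^sub>L 'b. blinfun_apply B (axis i 1))"
  have A: "blinfun_apply A = (\<lambda>B. blinfun_apply B (axis i 1))"
    unfolding A_def by (rule bounded_linear_Blinfun_apply[OF blinfun.bounded_linear_left])
  have "frechet_derivative \<phi> (at x) = blinfun_apply (\<phi>' x)" for x
    using frechet_derivative_at[OF d1] by simp
  then have p: "partial_deriv i \<phi> = (\<lambda>x. blinfun_apply A (\<phi>' x))"
    by (simp add: fun_eq_iff partial_deriv_def A)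
  show ?thesis
    unfolding C1_map_def p
  proof (intro exI[of _ "\<lambda>x. A o\<^sub>L \<phi>'' x"] conjI allI)
    fix x
    have "blinfun_apply (A o\<^sub>L \<phi>'' x) = (\<lambda>v. blinfun_apply A (blinfun_apply (\<phi>'' x) v))"
      by (simp add: fun_eq_iff)
    then show "((\<lambda>x. blinfun_apply A (\<phi>' x)) has_derivative blinfun_apply (A o\<^sub>L \<phi>'' x)) (at x)"
      using bounded_linear.has_derivative[OF blinfun.bounded_linear_right d2] by simp
  qed (intro bounded_bilinear.continuous_on[OF bounded_bilinear_blinfun_compose] continuous_on_const c)
qed

lemma grad_lagrangian:
  fixes f :: "real^'n \<Rightarrow> real" and G :: "real^'n \<Rightarrow> real^'m^'m" and h :: "real^'n \<Rightarrow> real^'s"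
  assumes f: "C1_map f" and G: "C1_map G" and h: "C1_map h"
  shows "grad (\<lambda>x. lagrangian f G h x Y z) = (\<lambda>x. gradL f G h x Y z)"
proof
  fix x
  have d: "((\<lambda>x. lagrangian f G h x Y z) has_derivative
     (\<lambda>d. frechet_derivative f (at x) d - trace (frechet_derivative G (at x) d ** Y)
        + inner (frechet_derivative h (at x) d) z)) (at x)"
    unfolding lagrangian_def trace_inner_def
    by (intro derivative_intros C1_map_has_derivative f G h has_derivative_inner_left
        bounded_linear.has_derivative[OF bounded_linear_trace] bounded_linear.has_derivative[OF mm.bounded_linear_left])
  show "grad (\<lambda>x. lagrangian f G h x Y z) x = gradL f G h x Y z"
    by (simp add: grad_def gradL_def partial_deriv_def frechet_derivative_at[OF d, symmetric])
qed

lemma hessian_lagrangian: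
  fixes f :: "real^'n \<Rightarrow> real" and G :: "real^'n \<Rightarrow> real^'m^'m" and h :: "real^'n \<Rightarrow> real^'s"
  assumes "C1_map f" "C1_map G" "C1_map h"
    and f2: "\<And>i. C1_map (partial_deriv i f)" and G2: "\<And>i. C1_map (partial_deriv i G)"
    and h2: "\<And>i. C1_map (partial_deriv i h)"
  shows "inner u (hessian (\<lambda>x. lagrangian f G h x Y z) x *v d) = hess_form f G h x Y z u d"
proof -
  let ?g' = "\<lambda>d. \<chi> i. frechet_derivative (partial_deriv i f) (at x) d
      - trace (frechet_derivative (partial_deriv i G) (at x) d ** Y)
      + inner (frechet_derivative (partial_deriv i h) (at x) d) z"
  have der: "((\<lambda>x. gradL f G h x Y z) has_derivative ?g') (at x)"
    unfolding gradL_def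
    by (intro has_derivative_vec derivative_intros C1_map_has_derivative f2 G2 h2 has_derivative_inner_left
        bounded_linear.has_derivative[OF bounded_linear_trace] bounded_linear.has_derivative[OF mm.bounded_linear_left])
  have "hessian (\<lambda>x. lagrangian f G h x Y z) x *v d = ?g' d"
    unfolding hessian_def grad_lagrangian[OF assms(1-3)] jacobian_def frechet_derivative_at[OF der, symmetric]
    using matrix_works[of ?g' d] has_derivative_linear[OF der] by simp
  then show ?thesis by (simp add: inner_vec_def hess_form_def)
qed

lemma Omega_form:
  assumes "C1_map G" and J: "pinv (G x) = J"
  shows "inner d (Omega G x Y *v d) =
    2 * trace (Y ** frechet_derivative G (at x) d ** J ** frechet_derivative G (at x) d)"
  unfolding frechet_partial_sum[OF assms(1)]
  by (simp add: inner_vec_def Omega_def matrix_vector_mult_def trace_inner_def J mm.sum_left mm.sum_right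
      linear_sum[OF tr_linear] tr_simps mm.scaleR_left mm.scaleR_right sum_distrib_left mult_ac
      matrix_mul_assoc)
    (subst sum.swap, simp add: mult_ac)

lemma tangent_cone_psd:
  assumes D: "D \<in> psd_mats" and P: "transpose P = P" "P ** P = P" and DP: "D ** P = 0"
    and ker: "\<And>v. D *v v = 0 \<Longrightarrow> P *v v = v"
    and X: "transpose X = X" and PXP: "P ** X ** P = 0"
  shows "X \<in> tangent_cone psd_mats D"
proof -
  let ?Q = "mat 1 - P"
  have Dt: "transpose D = D" using psd_sym[OF D] by (simp add: sym_mats_def)
  have PD: "P ** D = 0" using arg_cong[OF DP, of transpose] by (simp add: tp_simps P Dt)
  \<comment> \<open>\<open>X\<close> is approached by \<open>X + \<tau>\<^sup>2 P\<close> along the step sizes \<open>\<tau>\<^sup>4\<close>; rescaling the kernel block by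
    \<open>\<tau>\<^sup>3\<close> turns \<open>D + \<tau>\<^sup>4 (X + \<tau>\<^sup>2 P)\<close> into a perturbation \<open>B \<tau>\<close> of the positive definite \<open>D + P\<close>.\<close>
  define B where "B \<tau> = D + P ** mat 1 ** P + \<tau> *\<^sub>R (P ** X ** ?Q + ?Q ** X ** P) + \<tau>^4 *\<^sub>R (?Q ** X ** ?Q)" for \<tau>
  have Bs: "B \<tau> \<in> sym_mats" for \<tau>
    by (simp add: B_def sym_mats_def tp_simps Dt P X matrix_mul_assoc add.commute)
  have "((\<lambda>\<tau>. B \<tau>) \<longlongrightarrow> D + P ** mat 1 ** P + 0 *\<^sub>R (P ** X ** ?Q + ?Q ** X ** P) + 0^4 *\<^sub>R (?Q ** X ** ?Q)) (at_right 0)"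
    unfolding B_def by (intro tendsto_intros tendsto_ident_at)
  then have "(B \<longlongrightarrow> D + P) (at_right 0)" by (simp add: P)
  from eventually_pd[OF psd_plus_projection_pd[OF D P ker] this Bs]
  obtain \<tau>0 where \<tau>0: "\<tau>0 > 0" "\<And>\<tau>. 0 < \<tau> \<Longrightarrow> \<tau> < \<tau>0 \<Longrightarrow> B \<tau> \<in> pd_mats"
    unfolding eventually_at_right_field by auto
  have psd: "D + \<tau>^4 *\<^sub>R (X + \<tau>^2 *\<^sub>R P) \<in> psd_mats" if \<tau>: "0 < \<tau>" "\<tau> < \<tau>0" for \<tau>
  proof -
    let ?T = "\<tau>^3 *\<^sub>R P + ?Q"
    have "?T ** B \<tau> ** ?T \<in> pd_mats"
    proof (rule pd_congruence[OF \<tau>0(2)[OF \<tau>]])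
      show "transpose ?T = ?T" by (simp add: tp_simps P)
      have "\<tau>^3 \<noteq> 0" using \<tau> by simp
      then show "v = 0" if "?T *v v = 0" for v using scaled_projection_injective[OF P(2) _ that] by blast
    qed
    moreover have "?T ** B \<tau> ** ?T = D + \<tau>^4 *\<^sub>R (X + \<tau>^2 *\<^sub>R P)"
    proof -
      have "P ** X ** ?Q + ?Q ** X ** P + ?Q ** X ** ?Q = X"
        by (simp add: mm.diff_left mm.diff_right PXP)
      then have "X = P ** X ** ?Q + ?Q ** X ** P + ?Q ** X ** ?Q" ..
      then have "\<tau>^4 *\<^sub>R X = \<tau>^4 *\<^sub>R (P ** X ** ?Q + ?Q ** X ** P) + \<tau>^4 *\<^sub>R (?Q ** X ** ?Q)"
        by (metis scaleR_add_right)
      \<comment> \<open>The powers match: with \<open>\<sigma> = \<tau>^3\<close> the kernel block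
        gets \<open>\<sigma>\<^sup>2 = \<tau>^4 * \<tau>^2\<close>, the mixed blocks
        \<open>\<sigma> * \<tau> = \<tau>^4\<close>.\<close>
      then show ?thesis
        unfolding B_def block_scaling[OF P(2) DP PD] by (simp add: P scaleR_add_right flip: power_mult power_add power_Suc2)
    qed
    ultimately show ?thesis using pd_subset_psd by auto
  qed
  \<comment> \<open>The shift by 2 keeps \<open>s n\<close> strictly below \<open>\<tau>0\<close>
    already for n = 0.\<close>
  define s where "s n = \<tau>0 / real (n + 2)" for n
  have s: "0 < s n" "s n < \<tau>0" for n using \<tau>0(1) by (auto simp: s_def divide_less_eq)
  have s0: "s \<longlonglongrightarrow> 0"
  proof -
    have "(\<lambda>n. \<tau>0 * (1 / real (n + 2))) \<longlonglongrightarrow> \<tau>0 * 0"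
      by (intro tendsto_intros LIMSEQ_ignore_initial_segment[OF lim_1_over_n])
    then show ?thesis by (simp add: s_def[abs_def])
  qed
  show ?thesis
    unfolding tangent_cone_def
  proof (intro CollectI exI[of _ "\<lambda>n. (s n)^4"] exI[of _ "\<lambda>n. X + (s n)^2 *\<^sub>R P"] conjI allI)
    show "0 < (s n)^4" for n using s[of n] by simp
    show "(\<lambda>n. (s n)^4) \<longlonglongrightarrow> 0" using tendsto_power[OF s0, of 4] by simp
    have "(\<lambda>n. X + (s n)^2 *\<^sub>R P) \<longlonglongrightarrow> X + 0^2 *\<^sub>R P" by (intro tendsto_intros s0)
    then show "(\<lambda>n. X + (s n)^2 *\<^sub>R P) \<longlonglongrightarrow> X" by simp
    show "D + (s n)^4 *\<^sub>R (X + (s n)^2 *\<^sub>R P) \<in> psd_mats" for n using psd s by simp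
  qed
qed

lemma multipliers_iff:
  fixes f :: "real^'n \<Rightarrow> real" and G :: "real^'n \<Rightarrow> real^'m^'m" and h :: "real^'n \<Rightarrow> real^'s"
  assumes "C1_map f" "C1_map G" "C1_map h"
  shows "(Y, z) \<in> multipliers f G h x \<longleftrightarrow> gradL f G h x Y z = 0 \<and> trace (G x ** Y) = 0 \<and>
    G x \<in> psd_mats \<and> Y \<in> psd_mats \<and> h x = 0"
  unfolding multipliers_def using grad_lagrangian[OF assms]
  by (auto simp: trace_inner_def psd_sym)

lemma BKKT_iff:
  fixes f :: "real^'n \<Rightarrow> real" and G :: "real^'n \<Rightarrow> real^'m^'m" and h :: "real^'n \<Rightarrow> real^'s"
  assumes "C1_map f" "C1_map G" "C1_map h"
  shows "BKKT_triplet f G h \<mu> (x, Y, z) \<longleftrightarrow> 0 < \<mu> \<and> gradL f G h x Y z = 0 \<and> h x = 0 \<and>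
    G x ** Y = \<mu> *\<^sub>R mat 1 \<and> G x \<in> pd_mats \<and> Y \<in> pd_mats"
  unfolding BKKT_triplet_def using grad_lagrangian[OF assms] by simp

lemma inner_partial_nabla:
  fixes h :: "real^'n \<Rightarrow> real^'s"
  assumes "C1_map h"
  shows "transpose (nabla h x) *v d = frechet_derivative h (at x) d"
    and "(nabla h x *v z) $ i = inner (partial_deriv i h x) z"
proof -
  have j: "jacobian h (at x) *v d = frechet_derivative h (at x) d" for d
    unfolding jacobian_def
    using matrix_works[of "frechet_derivative h (at x)" d] has_derivative_linear[OF C1_map_has_derivative[OF assms]]
    by simp
  show "transpose (nabla h x) *v d = frechet_derivative h (at x) d"
    unfolding nabla_def transpose_transpose by (rule j)
  have "(nabla h x *v z) $ i = inner (axis i 1) (nabla h x *v z)" by (simp add: inner_axis')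
  also have "\<dots> = inner (transpose (nabla h x) *v axis i 1) z" by (rule inner_matrix_vector_mult)
  also have "transpose (nabla h x) *v axis i 1 = partial_deriv i h x"
    unfolding nabla_def transpose_transpose j partial_deriv_def ..
  finally show "(nabla h x *v z) $ i = inner (partial_deriv i h x) z" .
qed

lemma gradL_add:
  fixes f :: "real^'n \<Rightarrow> real" and G :: "real^'n \<Rightarrow> real^'m^'m" and h :: "real^'n \<Rightarrow> real^'s"
  assumes "gradL f G h x Y z = 0"
    and "\<And>i. trace (partial_deriv i G x ** H) = inner (partial_deriv i h x) \<zeta>"
  shows "gradL f G h x (Y + t *\<^sub>R H) (z + t *\<^sub>R \<zeta>) = 0"
proof -
  have "gradL f G h x (Y + t *\<^sub>R H) (z + t *\<^sub>R \<zeta>) = gradL f G h x Y z"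
    by (simp add: gradL_def vec_eq_iff mm.add_right mm.scaleR_right tr_simps assms(2) inner_add_right)
  then show ?thesis using assms(1) by simp
qed

text \<open>
  The condition on \<open>Yp\<close> is the first-order optimality of the analytic center. Projecting \<open>(Yp, 0)\<close>
  onto the range of \<open>\<xi> \<mapsto> (P (dG \<xi>) P, dh \<xi>)\<close> leaves a residual \<open>(H, c)\<close> for which \<open>(H, - c)\<close> is
  a direction preserving stationarity; hence the residual is zero.
\<close>

lemma analytic_center_dual:
  fixes G :: "real^'n \<Rightarrow> real^'m^'m" and h :: "real^'n \<Rightarrow> real^'s"
  assumes G: "C1_map G" and h: "C1_map h" and Gt: "\<And>d. transpose (frechet_derivative G (at x) d) = frechet_derivative G (at x) d"
    and P: "transpose P = P" "P ** P = P" and Yp: "transpose Yp = Yp" "P ** Yp = Yp" "Yp ** P = Yp"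
    and crit: "\<And>H \<zeta>. \<lbrakk>transpose H = H; P ** H = H; H ** P = H;
      \<And>i. trace (partial_deriv i G x ** H) = inner (partial_deriv i h x) \<zeta>\<rbrakk> \<Longrightarrow> trace (Yp ** H) = 0"
  obtains \<xi> where "P ** frechet_derivative G (at x) \<xi> ** P = Yp" "frechet_derivative h (at x) \<xi> = 0"
proof -
  let ?dG = "frechet_derivative G (at x)" and ?dh = "frechet_derivative h (at x)"
  let ?T = "\<lambda>\<xi>. (P ** ?dG \<xi> ** P, ?dh \<xi>)"
  have "bounded_linear ?T"
    by (intro bounded_linear_Pair bounded_linear_compose[OF mm.bounded_linear_left]
        bounded_linear_compose[OF mm.bounded_linear_right] C1_map_bounded_linear G h)
  then have T: "linear ?T" by (rule bounded_linear.linear)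
  have S: "subspace (range ?T)" using T by (rule linear_subspace_image) simp
  obtain \<pi> where "linear \<pi>" and \<pi>: "\<And>y. \<pi> y \<in> range ?T" "\<And>y u. u \<in> range ?T \<Longrightarrow> inner u (y - \<pi> y) = 0"
    using orthogonal_projection_exists[OF S] by blast
  obtain \<xi> where \<xi>: "\<pi> (Yp, 0) = ?T \<xi>" using \<pi>(1) by blast
  define H where "H = Yp - P ** ?dG \<xi> ** P"
  define c where "c = - ?dh \<xi>"
  have orth: "inner (P ** ?dG d ** P) H + inner (?dh d) c = 0" for d
    using \<pi>(2)[of "?T d" "(Yp, 0)"] by (simp add: \<xi> H_def c_def inner_prod_def)
  have Ht: "transpose H = H" by (simp add: H_def tp_simps P Yp Gt matrix_mul_assoc)
  have PH: "P ** H = H" "H ** P = H"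
    by (simp_all add: H_def mm.diff_left mm.diff_right Yp P matrix_mul_assoc, simp add: matrix_mul_assoc[symmetric] P)
  have iH: "inner (P ** ?dG d ** P) H = trace (?dG d ** H)" for d
  proof -
    have "inner (P ** ?dG d ** P) H = trace (P ** (?dG d ** (P ** H)))"
      by (simp add: inner_matrix_eq_trace tp_simps P Gt matrix_mul_assoc)
    also have "\<dots> = trace ((?dG d ** (P ** H)) ** P)" by (rule trace_mul_sym)
    finally show ?thesis by (simp add: PH matrix_mul_assoc[symmetric])
  qed
  have "trace (Yp ** H) = 0"
  proof (rule crit[OF Ht PH, of "- c"])
    fix i
    show "trace (partial_deriv i G x ** H) = inner (partial_deriv i h x) (- c)"
      using orth[of "axis i 1"] by (simp add: iH partial_deriv_def)
  qed
  then have "inner Yp H = 0" by (simp add: inner_matrix_eq_trace Yp)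
  moreover have "inner (P ** ?dG \<xi> ** P) H + inner (?dh \<xi>) c = 0" by (rule orth)
  ultimately have "inner H H + inner c c = 0"
    by (simp add: H_def c_def inner_diff_left)
  then have "H = 0" "c = 0"
    by (simp_all add: add_nonneg_eq_0_iff)
  then show thesis using that[of \<xi>] by (simp add: H_def c_def)
qed

text \<open>Strict complementarity makes Ya invertible on the kernel, optimality of the center gives
  a velocity compatible with Yp, the second-order condition gives positivity of the form on the
  active space, and the rank condition makes z unique for given Y.\<close>

lemma nsdp_center_exists:
  fixes f :: "real^'n \<Rightarrow> real"
    and G :: "real^'n \<Rightarrow> real^'m^'m"
    and h :: "real^'n \<Rightarrow> real^'s"
    and xs :: "real^'n"
    and e :: "nat \<Rightarrow> real^'m"
    and Ya :: "real^'m^'m"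
    and za :: "real^'s"
  assumes f: "twice_cont_diff f" and G: "twice_cont_diff G" and h: "twice_cont_diff h"
    and Gs: "\<And>x. G x \<in> sym_mats"
    and sc: "strict_complementarity f G h xs"
    and sosc: "enhanced_SOSC f G h xs"
    and mfcq: "MFCQ G h xs"
    and onb: "kernel_onb (G xs) e"
    and ac: "analytic_center f G h e xs (Ya, za)"
  obtains P J Yp \<xi>a \<pi> where "nsdp_center f G h xs P J Ya Yp za \<xi>a \<pi>"
proof -
  note C1 = twice_cont_diff_C1[OF f] twice_cont_diff_C1[OF G] twice_cont_diff_C1[OF h]
  note C2 = twice_cont_diff_partial[OF f] twice_cont_diff_partial[OF G] twice_cont_diff_partial[OF h]
  note mult = multipliers_iff[OF C1]
  let ?D = "G xs" and ?dG = "frechet_derivative G (at xs)" and ?dh = "frechet_derivative h (at xs)"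
  define k where "k = CARD('m) - rank ?D"
  interpret kernel_basis ?D e k
    by standard (use onb in \<open>auto simp: kernel_onb_def k_def Let_def\<close>)
  let ?Q = "mat 1 - P"
  have Gt: "transpose (G x) = G x" for x using Gs by (simp add: sym_mats_def)
  have PD: "P ** ?D = 0" using arg_cong[OF D_P, of transpose] by (simp add: tp_simps P_transpose Gt)
  obtain J where J: "transpose J = J" "J ** P = 0" "P ** J = 0" "?D ** J = ?Q" "J ** ?D = ?Q"
    using sym_pseudo_inverse[OF Gt P_transpose P_P D_P P_ker] by blast
  have "is_moore_penrose ?D J"
    unfolding is_moore_penrose_def
    by (simp add: J mm.diff_left D_P PD tp_simps P_transpose)
  then have pinv: "pinv ?D = J" by (rule pinv_eqI)
  have Ya: "(Ya, za) \<in> multipliers f G h xs" and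
    opt: "\<And>Y z. (Y, z) \<in> multipliers f G h xs \<Longrightarrow>
      log_ereal (jdet (compress k e Y)) \<le> log_ereal (jdet (compress k e Ya))"
    using ac unfolding analytic_center_def k_def[symmetric] by (auto simp: Let_def ereal_minus_le_minus)
  have stat: "gradL f G h xs Ya za = 0" and Ya_psd: "Ya \<in> psd_mats" and h0: "h xs = 0"
    and D_psd: "?D \<in> psd_mats" and tr0: "trace (?D ** Ya) = 0" using Ya by (auto simp: mult)
  have DYa: "?D ** Ya = 0" by (rule psd_trace_mult(2)[OF D_psd Ya_psd tr0])
  have "J ** (?D ** Ya) = Ya - P ** Ya" by (simp add: matrix_mul_assoc J mm.diff_left)
  then have PYa: "P ** Ya = Ya" by (simp add: DYa mm.zero_right)
  have Yat: "transpose Ya = Ya" using psd_sym[OF Ya_psd] by (simp add: sym_mats_def)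
  have YaP: "Ya ** P = Ya" using arg_cong[OF PYa, of transpose] by (simp add: tp_simps P_transpose Yat)
  \<comment> \<open>A strictly complementary multiplier is positive definite on the kernel, so its
    determinant is positive and the optimal value is finite; as log 0 is minus infinity, the center
    has a positive determinant too.\<close>
  have det_pos: "jdet (compress k e Ya) > 0"
  proof -
    obtain Y0 z0 where Y0: "(Y0, z0) \<in> multipliers f G h xs" "?D + Y0 \<in> pd_mats"
      using sc by (auto simp: strict_complementarity_def)
    have "0 < inner v (Y0 *v v)" if "v \<noteq> 0" "?D *v v = 0" for v
    proof -
      have "0 < inner v ((?D + Y0) *v v)" using Y0(2) that(1) by (simp add: pd_mats_def)
      then show ?thesis by (simp add: mat_vec that(2))
    qed
    then have "jdet (compress k e Y0) > 0" by (rule jdet_compress_pos)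
    with opt[OF Y0(1)] show ?thesis by (auto simp: log_ereal_def split: if_splits)
  qed
  have Ya_ker: "P *v v = 0" if "Ya *v v = 0" for v
  proof (rule ccontr)
    assume Pv: "P *v v \<noteq> 0"
    have "Ya *v (P *v v) = 0" using that by (simp add: matrix_vector_mul_assoc YaP)
    define c where "c = Matrix.vec k (\<lambda>i. inner (e i) v)"
    have "compress k e Ya *\<^sub>v c = 0\<^sub>v k"
    proof (rule eq_vecI)
      fix i assume "i < dim_vec (0\<^sub>v k :: real Matrix.vec)"
      then have i: "i < k" by simp
      have "vec_index (compress k e Ya *\<^sub>v c) i = (\<Sum>j = 0..<k. inner (e i) (Ya *v e j) * inner (e j) v)"
        using i by (simp add: compress_def c_def scalar_prod_def)
      also have "\<dots> = inner (e i) (Ya *v (P *v v))"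
        by (simp add: P_vec mv.sum_right mat_vec inner_sum_right atLeast0LessThan mult.commute)
      finally show "vec_index (compress k e Ya *\<^sub>v c) i = vec_index (0\<^sub>v k) i"
        using i \<open>Ya *v (P *v v) = 0\<close> by simp
    qed (simp add: compress_def)
    moreover have "c \<noteq> 0\<^sub>v k"
    proof
      assume "c = 0\<^sub>v k"
      then have "inner (e i) v = 0" if "i < k" for i using that by (metis c_def index_vec index_zero_vec(1))
      then show False using Pv by (simp add: P_vec)
    qed
    moreover have "c \<in> carrier_vec k" by (simp add: c_def)
    ultimately have "jdet (compress k e Ya) = 0"
      using det_0_iff_vec_prod_zero[OF compress_carrier, of k e Ya] by blast
    then show False using det_pos by simp
  qed
  have Qt: "transpose ?Q = ?Q" "?Q ** ?Q = ?Q" "Ya ** ?Q = 0"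
    by (simp_all add: tp_simps P_transpose mm.diff_left mm.diff_right P_P YaP)
  \<comment> \<open>The same construction as for J, with Q as the projection onto the kernel of
    Ya.\<close>
  obtain Yp where Yp: "transpose Yp = Yp" "Yp ** ?Q = 0" "?Q ** Yp = 0" "Ya ** Yp = mat 1 - ?Q" "Yp ** Ya = mat 1 - ?Q"
  proof (rule sym_pseudo_inverse[OF Yat Qt])
    fix v assume "Ya *v v = 0"
    then show "?Q *v v = v" using Ya_ker[of v] by (simp add: mv.diff_left)
  qed
  have YpP: "Yp ** P = Yp" and PYp: "P ** Yp = Yp" and YaYp: "Ya ** Yp = P" and YpYa: "Yp ** Ya = P"
    using Yp by (simp_all add: mm.diff_left mm.diff_right)
  note dGt = frechet_derivative_symmetric[OF C1(2) Gt]
  have crit: "trace (Yp ** H) = 0"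
    if H: "transpose H = H" "P ** H = H" "H ** P = H"
      "\<And>i. trace (partial_deriv i G xs ** H) = inner (partial_deriv i h xs) \<zeta>" for H \<zeta>
  proof -
    \<comment> \<open>Ya itself is only semidefinite, so openness is applied to
      \<open>Ya + ?Q\<close>. Compression by P removes \<open>?Q\<close> again and shows that
      \<open>Ya + t H\<close> is semidefinite for small t of either sign, so the center maximises
      the determinant along the line.\<close>
    have "Ya + ?Q \<in> pd_mats"
    proof (rule psd_plus_projection_pd[OF Ya_psd Qt(1,2)])
      fix v assume "Ya *v v = 0"
      then show "?Q *v v = v" using Ya_ker[of v] by (simp add: mv.diff_left)
    qed
    moreover have "((\<lambda>t. Ya + ?Q + t *\<^sub>R H) \<longlongrightarrow> Ya + ?Q) (at 0)"
      by (auto intro!: tendsto_eq_intros)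
    ultimately have "\<forall>\<^sub>F t in at 0. Ya + ?Q + t *\<^sub>R H \<in> pd_mats"
      by (rule eventually_pd) (simp add: sym_mats_def tp_simps Yat P_transpose H)
    then obtain \<epsilon> where \<epsilon>: "\<epsilon> > 0" "\<And>t. t \<noteq> 0 \<Longrightarrow> \<bar>t\<bar> < \<epsilon> \<Longrightarrow> Ya + ?Q + t *\<^sub>R H \<in> pd_mats"
      unfolding eventually_at by (auto simp: dist_real_def)
    show ?thesis
    proof (rule compress_det_critical[OF YaYp YpP H(2,3) YaP det_pos \<epsilon>(1)])
      fix t :: real assume t: "\<bar>t\<bar> < \<epsilon>"
      show "jdet (compress k e (Ya + t *\<^sub>R H)) \<le> jdet (compress k e Ya)"
      proof (cases "t = 0")
        case False
        let ?M = "Ya + t *\<^sub>R H"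
        have "?M \<in> psd_mats"
          unfolding psd_mats_def sym_mats_def
        proof (intro CollectI conjI allI)
          show "transpose ?M = ?M" by (simp add: tp_simps Yat H)
          fix v
          have PM: "?M = P ** (Ya + ?Q + t *\<^sub>R H) ** P"
            by (simp add: mm.add_left mm.add_right mm.diff_left mm.diff_right mm.scaleR_left mm.scaleR_right PYa YaP P_P H)
          have "inner v (?M *v v) = inner (P *v v) ((Ya + ?Q + t *\<^sub>R H) *v (P *v v))"
            unfolding PM
            using inner_matrix_vector_mult[of v P "(Ya + ?Q + t *\<^sub>R H) *v (P *v v)"] P_transpose
            by (simp add: matrix_vector_mul_assoc matrix_mul_assoc)
          also have "\<dots> \<ge> 0" using \<epsilon>(2)[OF False t] pd_subset_psd psd_ge by blast
          finally show "0 \<le> inner v (?M *v v)" .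
        qed
        moreover have "trace (?D ** ?M) = 0"
        proof -
          have "?D ** H = ?D ** P ** H" by (simp add: matrix_mul_assoc[symmetric] H)
          then have "?D ** H = 0" by (simp add: D_P mm.zero_left)
          then show ?thesis by (simp add: mm.add_right mm.scaleR_right DYa tr_simps)
        qed
        ultimately have "(?M, za + t *\<^sub>R \<zeta>) \<in> multipliers f G h xs"
          unfolding mult using gradL_add[OF stat H(4)] D_psd h0 by blast
        from opt[OF this] det_pos show ?thesis
          by (auto simp: log_ereal_def split: if_splits)
      qed simp
    qed
  qed
  obtain \<xi>1 where \<xi>1: "P ** ?dG \<xi>1 ** P = Yp" "?dh \<xi>1 = 0"
  proof (rule analytic_center_dual[OF C1(2,3) dGt P_transpose P_P Yp(1) PYp YpP])
    fix H \<zeta>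
    assume "transpose H = H" "P ** H = H" "H ** P = H"
      "\<And>i. trace (partial_deriv i G xs ** H) = inner (partial_deriv i h xs) \<zeta>"
    then show "trace (Yp ** H) = 0" by (rule crit)
  qed
  let ?U = "active_space G h xs P" and ?q = "sosc_form f G h xs J Ya za"
  have bq: "bilinear ?q" by (rule bilinear_sosc_form) (rule C1 C2)+
  have lG: "linear ?dG" and lh: "linear ?dh"
    using C1_map_bounded_linear[OF C1(2)] C1_map_bounded_linear[OF C1(3)] by (auto intro: bounded_linear.linear)
  have sub: "subspace ?U"
    unfolding active_space_def subspace_def
    by (auto simp: linear_0[OF lG] linear_0[OF lh] linear_add[OF lG] linear_add[OF lh] linear_scale[OF lG]
        linear_scale[OF lh] mm.add_left mm.add_right mm.scaleR_left mm.scaleR_right mm.zero_left mm.zero_right)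
  have pos: "0 < ?q d d" if d: "d \<in> ?U" "d \<noteq> 0" for d
  proof -
    have dU: "P ** ?dG d ** P = 0" "?dh d = 0" using d by (auto simp: active_space_def)
    have "d \<in> critical_cone f G h xs"
      unfolding critical_cone_def
    proof (intro CollectI conjI)
      have "inner d (gradL f G h xs Ya za) = inner (grad f xs) d - trace (?dG d ** Ya) + inner (?dh d) za"
        unfolding frechet_partial_sum[OF C1(2)] frechet_partial_sum[OF C1(3)]
      proof -
        have "inner u v = (\<Sum>i\<in>UNIV. u $ i * v $ i)" for u v :: "real^'n" by (simp add: inner_vec_def)
        then show "inner d (gradL f G h xs Ya za) = inner (grad f xs) d
            - trace ((\<Sum>i\<in>UNIV. d $ i *\<^sub>R partial_deriv i G xs) ** Ya) + inner (\<Sum>i\<in>UNIV. d $ i *\<^sub>R partial_deriv i h xs) za"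
          by (simp add: gradL_def grad_def sum.distrib sum_subtractf algebra_simps mm.sum_left
              linear_sum[OF tr_linear] tr_simps mm.scaleR_left inner_sum_left)
      qed
      moreover have "trace (?dG d ** Ya) = 0"
      proof -
        have "trace (?dG d ** Ya) = trace ((?dG d ** P ** Ya) ** P)"
          by (simp add: matrix_mul_assoc[symmetric] PYa YaP)
        also have "\<dots> = trace (P ** (?dG d ** P ** Ya))" by (rule trace_mul_sym)
        also have "\<dots> = trace ((P ** ?dG d ** P) ** Ya)" by (simp add: matrix_mul_assoc)
        finally show ?thesis by (simp add: dU mm.zero_left tr_simps)
      qed
      ultimately show "inner (grad f xs) d = 0" by (simp add: stat dU)
      show "transpose (nabla h xs) *v d = 0"
        unfolding inner_partial_nabla(1)[OF C1(3)] by (rule dU(2))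
      have "Delta_G G xs d = ?dG d" by (simp add: Delta_G_def frechet_partial_sum[OF C1(2)])
      then show "Delta_G G xs d \<in> tangent_cone psd_mats ?D"
        using tangent_cone_psd[OF D_psd P_transpose P_P D_P P_ker dGt dU(1)] by simp
    qed
    then have "0 < inner d ((hessian (\<lambda>x. lagrangian f G h x Ya za) xs + Omega G xs Ya) *v d)"
      using sosc Ya d(2) unfolding enhanced_SOSC_def by blast
    also have "\<dots> = hess_form f G h xs Ya za d d + 2 * trace (Ya ** ?dG d ** J ** ?dG d)"
      unfolding mv.add_left inner_add_right hessian_lagrangian[OF C1 C2] Omega_form[of G xs J, OF C1(2) pinv] ..
    also have "\<dots> = ?q d d"
    proof -
      have "trace (Ya ** ?dG d ** J ** ?dG d) = trace (?dG d ** J ** ?dG d ** Ya)"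
        using trace_mul_sym[of Ya "?dG d ** J ** ?dG d"] by (simp add: matrix_mul_assoc)
      moreover have "trace (?dG d ** Ya ** ?dG d ** J) = trace (?dG d ** J ** ?dG d ** Ya)"
        using trace_mul_sym[of "?dG d ** Ya" "?dG d ** J"] by (simp add: matrix_mul_assoc)
      ultimately show ?thesis by (simp add: sosc_form_def)
    qed
    finally show ?thesis .
  qed
  have lq: "linear (\<lambda>u. ?q u \<xi>1)" and lq2: "linear (?q u)" for u using bq by (auto simp: bilinear_def)
  have "bounded_linear (\<lambda>u. trace (?dG u ** J))"
    by (intro bounded_linear_compose[OF bounded_linear_trace] bounded_linear_compose[OF mm.bounded_linear_left]
        C1_map_bounded_linear C1)
  then have "linear (\<lambda>u. trace (?dG u ** J) - ?q u \<xi>1)"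
    by (intro linear_compose_sub lq) (rule bounded_linear.linear)
  \<comment> \<open>Adding an element of U does not disturb the two equations that
    \<open>\<xi>1\<close> satisfies; u corrects the defect of \<open>\<xi>1\<close> in the remaining
    condition on the form.\<close>
  then obtain u where u: "u \<in> ?U" "\<And>v. v \<in> ?U \<Longrightarrow> ?q v u = trace (?dG v ** J) - ?q v \<xi>1"
    using positive_on_subspace_solvable[OF sub bq pos] by blast
  have dU: "P ** ?dG u ** P = 0" "?dh u = 0" using u(1) by (auto simp: active_space_def)
  obtain \<pi> where \<pi>: "linear \<pi>" "\<And>x. \<pi> x \<in> ?U" "\<And>x u. u \<in> ?U \<Longrightarrow> inner u (x - \<pi> x) = 0"
    using orthogonal_projection_exists[OF sub] by blast
  show thesis
  proof (rule that[of P J Yp "\<xi>1 + u" \<pi>], rule nsdp_center.intro)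
    show "z = 0" if "\<And>i. inner (partial_deriv i h xs) z = 0" for z
    proof -
      have "nabla h xs *v z = 0"
        unfolding vec_eq_iff inner_partial_nabla(2)[OF C1(3)] using that by simp
      moreover have "inj ((*v) (nabla h xs))"
        using mfcq full_rank_injective[of "nabla h xs"] by (simp add: MFCQ_def)
      ultimately show ?thesis by (metis injD mv.zero_right)
    qed
    have "P ** ?dG (\<xi>1 + u) ** Ya = (P ** ?dG \<xi>1 ** P) ** Ya + (P ** ?dG u ** P) ** Ya"
      by (simp add: linear_add[OF lG] mm.add_left mm.add_right matrix_mul_assoc[symmetric] PYa)
    then show "P ** ?dG (\<xi>1 + u) ** Ya = P" by (simp add: \<xi>1 dU YpYa mm.zero_left)
    show "?dh (\<xi>1 + u) = 0" by (simp add: linear_add[OF lh] \<xi>1 dU)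
    show "?q v (\<xi>1 + u) = trace (?dG v ** J)" if "v \<in> ?U" for v
      by (simp add: linear_add[OF lq2] u(2)[OF that])
  qed (use C1 C2 Gt h0 P_transpose P_P D_P P_ker D_psd J Ya_psd PYa Yp(1) YpP YaYp stat pos \<pi> in simp_all)
qed

text \<open>For a competitor v the coincidence set is relatively closed by continuity, relatively
  open as the preimage of V, and nonempty because v enters V as \<mu> tends to 0. The extensional
  function space fixes the values off the interval, so that uniqueness can be stated for
  functions.\<close>

lemma (in nsdp_center) unique_central_path:
  assumes "C1_map f"
  shows "\<forall>\<^sub>F mubar in at_right (0::real).
    \<exists>!w :: real \<Rightarrow> (real^'n) \<times> (real^'m^'m) \<times> (real^'s).
      w \<in> {0<..<mubar} \<rightarrow>\<^sub>E W_pp G \<and>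
      w C1_differentiable_on {0<..<mubar} \<and>
      (\<forall>\<mu>\<in>{0<..<mubar}. BKKT_triplet f G h \<mu> (w \<mu>)) \<and>
      (w \<longlongrightarrow> (xs, Ya, za)) (at_right 0)"
proof -
  obtain \<delta> w V where \<delta>: "\<delta> > 0" and V: "open V" and wC: "w C1_differentiable_on {0<..<\<delta>}"
    and wl: "(w \<longlongrightarrow> (xs, Ya, za)) (at_right 0)"
    and ws: "\<And>\<mu>. \<mu> \<in> {0<..<\<delta>} \<Longrightarrow> sol \<mu> (w \<mu>) \<and> w \<mu> \<in> V \<and> w \<mu> \<in> W_pp G"
    and wu: "\<And>\<mu> v. \<mu> \<in> {0<..<\<delta>} \<Longrightarrow> v \<in> V \<Longrightarrow> sol \<mu> v \<Longrightarrow> v = w \<mu>"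
    and V0: "(xs, Ya, za) \<in> V"
    by (rule central_path) (rule that; assumption)
  have bkkt: "BKKT_triplet f G h \<mu> v \<longleftrightarrow> 0 < \<mu> \<and> sol \<mu> v \<and> v \<in> W_pp G" for \<mu> v
    by (cases v) (auto simp: BKKT_iff[OF assms G1 h1] sol_def W_pp_def)
  show ?thesis
    unfolding eventually_at_right_field
  proof (intro exI[of _ \<delta>] conjI allI impI \<delta>)
    fix mubar assume m: "0 < mubar" "mubar < \<delta>"
    let ?S = "{0<..<mubar}"
    have sub: "\<mu> \<in> {0<..<\<delta>}" if "\<mu> \<in> ?S" for \<mu> using that m by auto
    have evS: "\<forall>\<^sub>F \<mu> in at_right 0. \<mu> \<in> ?S"
      unfolding eventually_at_right_field using m by (intro exI[of _ mubar]) auto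
    let ?w = "restrict w ?S"
    show "\<exists>!w. w \<in> ?S \<rightarrow>\<^sub>E W_pp G \<and> w C1_differentiable_on ?S \<and>
        (\<forall>\<mu>\<in>?S. BKKT_triplet f G h \<mu> (w \<mu>)) \<and> (w \<longlongrightarrow> (xs, Ya, za)) (at_right 0)"
    proof (rule ex1I[of _ ?w], intro conjI)
      show "?w \<in> ?S \<rightarrow>\<^sub>E W_pp G" using ws sub by auto
      show "?w C1_differentiable_on ?S"
      proof -
        obtain W where W: "\<And>\<mu>. \<mu> \<in> {0<..<\<delta>} \<Longrightarrow> (w has_vector_derivative W \<mu>) (at \<mu>)"
          "continuous_on {0<..<\<delta>} W" using wC unfolding C1_differentiable_on_def by blast
        show ?thesis
          unfolding C1_differentiable_on_def
        proof (intro exI[of _ W] conjI ballI)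
          fix \<mu> assume \<mu>: "\<mu> \<in> ?S"
          show "(?w has_vector_derivative W \<mu>) (at \<mu>)"
            by (rule has_vector_derivative_transform_within_open[OF W(1)[OF sub[OF \<mu>]], of ?S]) (use \<mu> in auto)
        qed (rule continuous_on_subset[OF W(2)], use sub in blast)
      qed
      show "\<forall>\<mu>\<in>?S. BKKT_triplet f G h \<mu> (?w \<mu>)" using ws sub by (auto simp: bkkt)
      have "\<forall>\<^sub>F \<mu> in at_right 0. w \<mu> = ?w \<mu>" using evS by eventually_elim simp
      then show "(?w \<longlongrightarrow> (xs, Ya, za)) (at_right 0)" using wl by (rule Lim_transform_eventually[rotated])
    next
      fix v assume v: "v \<in> ?S \<rightarrow>\<^sub>E W_pp G \<and> v C1_differentiable_on ?S \<and>
        (\<forall>\<mu>\<in>?S. BKKT_triplet f G h \<mu> (v \<mu>)) \<and> (v \<longlongrightarrow> (xs, Ya, za)) (at_right 0)"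
      have vc: "continuous_on ?S v"
        using v C1_diff_imp_diff differentiable_imp_continuous_on by blast
      have wc: "continuous_on ?S w"
        using C1_diff_imp_diff[OF C1_differentiable_on_subset[OF wC]] sub differentiable_imp_continuous_on by blast
      have vs: "sol \<mu> (v \<mu>)" if "\<mu> \<in> ?S" for \<mu> using v that bkkt by blast
      let ?A = "{\<mu> \<in> ?S. v \<mu> - w \<mu> = 0}"
      have A: "?A = ?S \<inter> v -` V"
      proof (rule Set.equalityI; rule Set.subsetI)
        fix \<mu> assume "\<mu> \<in> ?A"
        then have \<mu>: "\<mu> \<in> ?S" "v \<mu> = w \<mu>" by auto
        then show "\<mu> \<in> ?S \<inter> v -` V" using ws[OF sub[OF \<mu>(1)]] by simp
      next
        fix \<mu> assume "\<mu> \<in> ?S \<inter> v -` V"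
        then have \<mu>: "\<mu> \<in> ?S" "v \<mu> \<in> V" by auto
        then show "\<mu> \<in> ?A" using wu[OF sub[OF \<mu>(1)] \<mu>(2) vs[OF \<mu>(1)]] by simp
      qed
      have opn: "openin (top_of_set ?S) ?A"
        unfolding A by (rule continuous_openin_preimage_gen[OF vc V])
      have cls: "closedin (top_of_set ?S) ?A"
        by (intro continuous_closedin_preimage_constant continuous_on_diff vc wc)
      have ne: "?A \<noteq> {}"
      proof -
        have "\<forall>\<^sub>F \<mu> in at_right 0. v \<mu> \<in> V"
          using v V V0 by (auto intro: topological_tendstoD)
        with evS have "\<forall>\<^sub>F \<mu> in at_right 0. \<mu> \<in> ?S \<and> v \<mu> \<in> V" by eventually_elim simp
        then obtain \<mu> where "\<mu> \<in> ?S" "v \<mu> \<in> V"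
          using eventually_happens'[of "at_right (0::real)"] by auto
        then show ?thesis unfolding A by blast
      qed
      have "connected ?S" by simp
      note dis = this[unfolded connected_clopen, rule_format, OF conjI[OF opn cls]]
      have AS: "?A = ?S" by (rule disjE[OF dis], rule notE[OF ne])
      show "v = ?w"
      proof (rule extensionalityI[where A="?S"])
        show "v \<in> extensional ?S" using v by (simp only: PiE_def Int_iff)
        fix \<mu> assume \<mu>: "\<mu> \<in> ?S"
        have "\<mu> \<in> ?A" by (rule Set.equalityD2[OF AS, THEN Set.subsetD, OF \<mu>])
        then show "v \<mu> = ?w \<mu>" using \<mu> by simp
      qed simp
    qed
  qed
qed

theorem theorem4:
  fixes f :: "real^'n \<Rightarrow> real"
    and G :: "real^'n \<Rightarrow> real^'m^'m"
    and h :: "real^'n \<Rightarrow> real^'s"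
    and xs :: "real^'n"
    and e :: "nat \<Rightarrow> real^'m"
    and Ya :: "real^'m^'m"
    and za :: "real^'s"
  assumes "twice_cont_diff f" and "twice_cont_diff G" and "twice_cont_diff h"
    and "\<And>x. G x \<in> sym_mats"
    and "KKT_point f G h xs"
    and "strict_complementarity f G h xs"
    and "enhanced_SOSC f G h xs"
    and "MFCQ G h xs"
    and "kernel_onb (G xs) e"
    and "analytic_center f G h e xs (Ya, za)"
  shows "\<forall>\<^sub>F mubar in at_right (0::real).
    \<exists>!w :: real \<Rightarrow> (real^'n) \<times> (real^'m^'m) \<times> (real^'s).
      w \<in> {0<..<mubar} \<rightarrow>\<^sub>E W_pp G \<and>
      w C1_differentiable_on {0<..<mubar} \<and>
      (\<forall>\<mu>\<in>{0<..<mubar}. BKKT_triplet f G h \<mu> (w \<mu>)) \<and>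
      (w \<longlongrightarrow> (xs, Ya, za)) (at_right 0)"
proof -
  obtain P J Yp \<xi>a \<pi> where c: "nsdp_center f G h xs P J Ya Yp za \<xi>a \<pi>"
    using nsdp_center_exists[OF assms(1-4,6-10)] by blast
  show ?thesis
    by (rule nsdp_center.unique_central_path[OF c twice_cont_diff_C1[OF assms(1)]])
qed

end
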